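(* Let $\Phi$ be an optimality criterion satisfying Assumption A, and suppose that the single-covariate model satisfies one of the conditions (a)–(d) of the Complete Class Hypothesis (both defined in the context), with corresponding integer $m$, complete class $\Xi$, and objective function $\tilde\Phi(\mathbf Z)$. Suppose that any $\Phi$-optimal design has at least $m$ support points. Further assume that one of the following four conditions holds: (i) $\mathrm{fix}(\Xi)=\{L\}$, and the information matrix $\mathbf M_U(\boldsymbol\theta)$ is $0$; (ii) $\mathrm{fix}(\Xi)=\{U\}$, and $\mathbf M_L(\boldsymbol\theta)=0$; (iii) $\mathrm{fix}(\Xi)=\varnothing$, and $\mathbf M_U(\boldsymbol\theta)=\mathbf M_L(\boldsymbol\theta)=0$; (iv) $\mathrm{fix}(\Xi)=\{L,U\}$. Then a feasible critical point of $\tilde\Phi(\mathbf Z)$ exists, and any such point gives a $\Phi$-optimal design.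
   Context: **Model and designs.** The design space is an interval $[L,U]\subseteq\mathbb R$ ($L=-\infty$ or $U=\infty$ is allowed, $[L,U]$ then being half open or open; for an infinite endpoint, $\mathbf M_L(\boldsymbol\theta)$ or $\mathbf M_U(\boldsymbol\theta)$ is understood as the limit of $\mathbf M_x(\boldsymbol\theta)$ as $x$ tends to that endpoint). The unknown parameter is $\boldsymbol\theta\in\mathbb R^d$; a value of $\boldsymbol\theta$ is fixed throughout (local optimality). The model is a polynomial or nonlinear regression model or a generalized linear model with univariate response and one covariate $x\in[L,U]$; $\mathbf M_x(\boldsymbol\theta)$ denotes the $d\times d$ nonnegative definite Fisher information matrix of a single observation at $x$. It has the form $w(x)\,\mathbf f(x)\mathbf f(x)^T$, where $\mathbf f(x)=\partial\eta(x,\boldsymbol\theta)/\partial\boldsymbol\theta$, $\eta$ is the mean response (regression) or linear predictor (generalized linear model), and $w\ge 0$ is a scalar weight ($w\equiv1$ for regression with unit variance). A (approximate) design is $\xi=\{(x_i,\omega_i)\}_{i=1}^q$ with $x_i\in[L,U]$, $\omega_i\ge0$, $\sum_i\omega_i=1$; the $x_i$ are design points, those with positive weight are support points, and the number of support points is the support size. Its information matrix is $\mathbf M_\xi(\boldsymbol\theta)=\sum_i\omega_i\mathbf M_{x_i}(\boldsymbol\theta)$. A design is $\Phi$-optimal if it maximizes $\Phi(\mathbf M_\xi(\boldsymbol\theta))$ over all designs $\xi$ on $[L,U]$. It is a standing assumption that a $\Phi$-optimal design exists (hence one exists in the class $\Xi$ below). **Assumption A.** Let NND$(d)$ and PD$(d)$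 be the sets of $d\times d$ nonnegative definite and positive definite matrices. $\Phi$ is a nonnegative, nonconstant real function on NND$(d)$ that is (1) concave; (2) isotonic: $\Phi(\mathbf M_1)\ge\Phi(\mathbf M_2)$ whenever $\mathbf M_1\ge\mathbf M_2$ in the Loewner order; (3) smooth on PD$(d)$: differentiable with continuous first-order partial derivatives, as a function of the $d(d+1)/2$ upper-triangular entries. **Complete Class Hypothesis.** There is a decomposition $\mathbf M_x(\boldsymbol\theta)=\mathbf P\,\mathbf C(c(x))\,\mathbf P^T$, where $\mathbf P$ is a nonsingular $d\times d$ matrix depending only on $\boldsymbol\theta$, $c$ is a smooth strictly monotone transformation of $[L,U]$ onto an interval $[A,B]$ (so $A,B$ correspond to $L,U$ if $c$ is increasing and to $U,L$ if $c$ is decreasing), and $\mathbf C(c)=(\Psi_{ij}(c))$ is a symmetric $d\times d$ matrix function. For some $1\le d_1<d$, let $\mathbf C_{22}(c)$ be the lower $d_1\times d_1$ principal submatrix of $\mathbf C(c)$; let $\Psi_1,\dots,\Psi_{k-1}$ be a maximal set of linearly independent nonconstant functions among the entries of the first $d-d_1$ columns of $\mathbf C(c)$; put $\Psi_k=\mathbf C_{22}$ (matrix valued). Define $f_{\ell,1}=\Psi_\ell'$ for $1\le\ell\le k$ and $f_{\ell,t}=(f_{\ell,t-1}/f_{t-1,t-1})'$ for $2\le t\le\ell\le k$ (entrywise derivatives when $\ell=k$; all derivatives are assumed to exist), and $\mathbf F(c)=\prod_{\ell=1}^k f_{\ell,\ell}(c)$, a $d_1\times d_1$ matrix. One of the following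 holds, where $\mathbf F>0$ (resp. $\mathbf F<0$) means that $\mathbf F(c)$ (resp. $-\mathbf F(c)$) is positive definite for all $c\in[A,B]$: (a) $k=2m-1$ and $\mathbf F<0$; then $\Xi$ is the set of designs with at most $m$ design points including the point corresponding to $A$; (b) $k=2m-1$ and $\mathbf F>0$; then $\Xi$ is the set of designs with at most $m$ design points including the point corresponding to $B$; (c) $k=2m$ and $\mathbf F<0$; then $\Xi$ is the set of designs with at most $m$ design points; (d) $k=2m-2$ and $\mathbf F>0$; then $\Xi$ is the set of designs with at most $m$ design points including both endpoints. By a known theorem of Yang and Stufken (2012), $\Xi$ is a complete class: for every design $\xi$ there is $\tilde\xi\in\Xi$ with $\mathbf M_{\tilde\xi}(\boldsymbol\theta)\ge\mathbf M_\xi(\boldsymbol\theta)$. The required endpoints are called fixed design points (they may carry weight $0$), and $\mathrm{fix}(\Xi)\subseteq\{L,U\}$ denotes the set of fixed design points, expressed in the $x$ variable. It is understood that $m\ge d$. **Objective function and critical points.** Designs in $\Xi$ are written $\xi=\{(x_i,\omega_i)\}_{i=1}^m$ with $x_1<\dots<x_m$ ($x_1=L$ if $L\in\mathrm{fix}(\Xi)$, $x_m=U$ if $U\in\mathrm{fix}(\Xi)$), $\omega_i\ge0$, $\omega_1=1-\sum_{i=2}^m\omega_i$. $\mathbf Z$ is the vector of the non-fixed design points together with $\omega_2,\dots,\omega_m$, and $\tilde\Phi(\mathbf Z)=\Phi(\mathbf M_\xi(\boldsymbol\theta))$. A critical point $\mathbf Z^c$ of $\tilde\Phi$ (a point where the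 gradient vanishes) is a *feasible critical point* if all design points in $\mathbf Z^c$ lie in $[L,U]$ and all $m-1$ weights in $\mathbf Z^c$ are positive with sum less than $1$.
   Formalization: Adds that some design has a positive definite information matrix (θ is estimable), and reads the smooth strictly monotone transformation c as continuously differentiable with nowhere vanishing derivative; without these the claim can fail (e.g. f=(1,x³,x⁶) on [-1,2], D-optimality, x₂=0). *)

theory Defs
  imports "HOL-Analysis.Analysis"
begin

definition NND :: "(real^'n^'n) set" where
  "NND = {A. transpose A = A \<and> (\<forall>v. 0 \<le> v \<bullet> (A *v v))}"

definition PD :: "(real^'n^'n) set" where
  "PD = {A. transpose A = A \<and> (\<forall>v. v \<noteq> 0 \<longrightarrow> 0 < v \<bullet> (A *v v))}"

definition sym_matrices :: "(real^'n^'n) set" where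
  "sym_matrices = {A. transpose A = A}"

text \<open>The direction in which a symmetric matrix moves when its \<open>(i,j)\<close> entry is varied as a free
  coordinate (with the \<open>(j,i)\<close> entry following by symmetry).\<close>

definition sym_unit :: "'n \<Rightarrow> 'n \<Rightarrow> real^'n^'n" where
  "sym_unit i j = (\<chi> a b. if (a = i \<and> b = j) \<or> (a = j \<and> b = i) then 1 else 0)"

text \<open>Differentiability as a function of the upper-triangular entries is differentiability on the
  space of symmetric matrices, which these entries coordinatise; the partial derivative with
  respect to the \<open>(i,j)\<close> entry at \<open>A\<close> is \<open>D A (sym_unit i j)\<close>.\<close>

definition smooth_on_PD :: "(real^'n^'n \<Rightarrow> real) \<Rightarrow> bool" where
  "smooth_on_PD \<Phi> \<longleftrightarrow>
     (\<exists>D. (\<forall>A\<in>PD. (\<Phi> has_derivative D A) (at A within sym_matrices)) \<and>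
          (\<forall>i j. continuous_on PD (\<lambda>A. D A (sym_unit i j))))"

definition assumption_A :: "(real^'n^'n \<Rightarrow> real) \<Rightarrow> bool" where
  "assumption_A \<Phi> \<longleftrightarrow>
     (\<forall>A\<in>NND. 0 \<le> \<Phi> A) \<and>
     (\<exists>A\<in>NND. \<exists>B\<in>NND. \<Phi> A \<noteq> \<Phi> B) \<and>
     concave_on NND \<Phi> \<and>
     (\<forall>A\<in>NND. \<forall>B\<in>NND. A - B \<in> NND \<longrightarrow> \<Phi> B \<le> \<Phi> A) \<and>
     smooth_on_PD \<Phi>"

definition design_space :: "ereal \<Rightarrow> ereal \<Rightarrow> real set" where
  "design_space L U = {x. L \<le> ereal x \<and> ereal x \<le> U}"

definition fisher_info :: "(real \<Rightarrow> real) \<Rightarrow> (real \<Rightarrow> real^'n) \<Rightarrow> real \<Rightarrow> real^'n^'n" where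
  "fisher_info w f x = w x *\<^sub>R (\<chi> i j. f x $ i * f x $ j)"

text \<open>The information matrix at an endpoint of the design space equals \<open>N\<close>; at an infinite
  endpoint this is a statement about the limit.\<close>

definition info_at_endpoint :: "(real \<Rightarrow> real^'n^'n) \<Rightarrow> ereal \<Rightarrow> real^'n^'n \<Rightarrow> bool" where
  "info_at_endpoint M e N \<longleftrightarrow>
     (case e of ereal x \<Rightarrow> M x = N
      | PInfty \<Rightarrow> (M \<longlongrightarrow> N) at_top
      | MInfty \<Rightarrow> (M \<longlongrightarrow> N) at_bot)"

text \<open>A design is the finite set of its design points together with a weight function, of which
  only the values at the design points matter. Weight \<open>0\<close> is allowed.\<close>

type_synonym design = "real set \<times> (real \<Rightarrow> real)"

definition is_design :: "real set \<Rightarrow> design \<Rightarrow> bool" where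
  "is_design X \<xi> \<longleftrightarrow>
     finite (fst \<xi>) \<and> fst \<xi> \<subseteq> X \<and> (\<forall>x\<in>fst \<xi>. 0 \<le> snd \<xi> x) \<and> (\<Sum>x\<in>fst \<xi>. snd \<xi> x) = 1"

definition support_points :: "design \<Rightarrow> real set" where
  "support_points \<xi> = {x \<in> fst \<xi>. 0 < snd \<xi> x}"

definition info_matrix :: "(real \<Rightarrow> real^'n^'n) \<Rightarrow> design \<Rightarrow> real^'n^'n" where
  "info_matrix M \<xi> = (\<Sum>x\<in>fst \<xi>. snd \<xi> x *\<^sub>R M x)"

definition optimal_design ::
    "(real^'n^'n \<Rightarrow> real) \<Rightarrow> (real \<Rightarrow> real^'n^'n) \<Rightarrow> real set \<Rightarrow> design \<Rightarrow> bool" where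
  "optimal_design \<Phi> M X \<xi> \<longleftrightarrow>
     is_design X \<xi> \<and> (\<forall>\<zeta>. is_design X \<zeta> \<longrightarrow> \<Phi> (info_matrix M \<zeta>) \<le> \<Phi> (info_matrix M \<xi>))"

definition Xi :: "real set \<Rightarrow> nat \<Rightarrow> ereal set \<Rightarrow> design set" where
  "Xi X m Fx = {\<xi>. is_design X \<xi> \<and> card (fst \<xi>) \<le> m \<and> Fx \<subseteq> ereal ` fst \<xi>}"

text \<open>``Smooth'' is understood, for a change of variable, as continuously differentiable with
  nowhere vanishing derivative (one-sided at endpoints).\<close>

definition smooth_monotone_transformation :: "real set \<Rightarrow> (real \<Rightarrow> real) \<Rightarrow> bool" where
  "smooth_monotone_transformation X c \<longleftrightarrow>
     (strict_mono_on X c \<or> strict_antimono_on X c) \<and>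
     (\<exists>c'. (\<forall>x\<in>X. (c has_real_derivative c' x) (at x within X)) \<and>
           continuous_on X c' \<and> (\<forall>x\<in>X. c' x \<noteq> 0))"

text \<open>The endpoints of the design space that correspond to the endpoints \<open>A\<close> and \<open>B\<close> of \<open>c ` X\<close>.\<close>

definition endpoint_A :: "ereal \<Rightarrow> ereal \<Rightarrow> (real \<Rightarrow> real) \<Rightarrow> ereal" where
  "endpoint_A L U c = (if strict_mono_on (design_space L U) c then L else U)"

definition endpoint_B :: "ereal \<Rightarrow> ereal \<Rightarrow> (real \<Rightarrow> real) \<Rightarrow> ereal" where
  "endpoint_B L U c = (if strict_mono_on (design_space L U) c then U else L)"

text \<open>Index type \<open>'a + 'b\<close>: the summand \<open>'a\<close> holds the first \<open>d - d\<^sub>1\<close> indices, \<open>'b\<close> the last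
  \<open>d\<^sub>1\<close>. Both are nonempty, so \<open>1 \<le> d\<^sub>1 < d\<close>.\<close>

definition lower_block :: "real^('a::finite+'b::finite)^('a+'b) \<Rightarrow> real^'b^'b" where
  "lower_block A = (\<chi> i j. A $ Inr i $ Inr j)"

definition first_column_entries :: "(real \<Rightarrow> real^('a::finite+'b::finite)^('a+'b)) \<Rightarrow> (real \<Rightarrow> real) set" where
  "first_column_entries C = {g. \<exists>(i::'a+'b) (j::'a). g = (\<lambda>c. C c $ i $ Inl j)}"

definition nonconstant_on :: "real set \<Rightarrow> (real \<Rightarrow> real) \<Rightarrow> bool" where
  "nonconstant_on J g \<longleftrightarrow> (\<exists>s\<in>J. \<exists>t\<in>J. g s \<noteq> g t)"

definition lin_indep_on :: "real set \<Rightarrow> (real \<Rightarrow> real) set \<Rightarrow> bool" where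
  "lin_indep_on J S \<longleftrightarrow>
     (\<forall>a. (\<forall>c\<in>J. (\<Sum>g\<in>S. a g * g c) = 0) \<longrightarrow> (\<forall>g\<in>S. a g = 0))"

definition maximal_indep_nonconstant ::
    "real set \<Rightarrow> (real \<Rightarrow> real) set \<Rightarrow> (real \<Rightarrow> real) set \<Rightarrow> bool" where
  "maximal_indep_nonconstant J E S \<longleftrightarrow>
     S \<subseteq> {g\<in>E. nonconstant_on J g} \<and> lin_indep_on J S \<and>
     (\<forall>g\<in>E. nonconstant_on J g \<and> g \<notin> S \<longrightarrow> \<not> lin_indep_on J (insert g S))"

text \<open>The recursion \<open>f\<^bsub>l,1\<^esub> = \<Psi>\<^sub>l'\<close>, \<open>f\<^bsub>l,t\<^esub> = (f\<^bsub>l,t-1\<^esub> / f\<^bsub>t-1,t-1\<^esub>)'\<close>, including the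
  existence of all derivatives (one-sided at endpoints of \<open>J\<close>). The functions with \<open>l < k\<close> are
  scalar, \<open>f l t\<close>; those with \<open>l = k\<close> are matrix valued, \<open>fk t\<close>.\<close>

definition derivative_array ::
    "real set \<Rightarrow> nat \<Rightarrow> (nat \<Rightarrow> real \<Rightarrow> real) \<Rightarrow> (real \<Rightarrow> real^'b^'b) \<Rightarrow>
     (nat \<Rightarrow> nat \<Rightarrow> real \<Rightarrow> real) \<Rightarrow> (nat \<Rightarrow> real \<Rightarrow> real^'b^'b) \<Rightarrow> bool" where
  "derivative_array J k \<Psi> \<Psi>k f fk \<longleftrightarrow>
     (\<forall>c\<in>J. \<forall>l\<in>{1..<k}. (\<Psi> l has_real_derivative f l 1 c) (at c within J)) \<and>
     (\<forall>c\<in>J. (\<Psi>k has_vector_derivative fk 1 c) (at c within J)) \<and>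
     (\<forall>c\<in>J. \<forall>t\<in>{2..k}. \<forall>l\<in>{t..<k}.
        ((\<lambda>u. f l (t - 1) u / f (t - 1) (t - 1) u) has_real_derivative f l t c) (at c within J)) \<and>
     (\<forall>c\<in>J. \<forall>t\<in>{2..k}.
        ((\<lambda>u. fk (t - 1) u /\<^sub>R f (t - 1) (t - 1) u) has_vector_derivative fk t c) (at c within J))"

definition F_matrix ::
    "nat \<Rightarrow> (nat \<Rightarrow> nat \<Rightarrow> real \<Rightarrow> real) \<Rightarrow> (nat \<Rightarrow> real \<Rightarrow> real^'b^'b) \<Rightarrow> real \<Rightarrow> real^'b^'b" where
  "F_matrix k f fk c = (\<Prod>l\<in>{1..<k}. f l l c) *\<^sub>R fk k c"

definition pos_def_on :: "real set \<Rightarrow> (real \<Rightarrow> real^'b^'b) \<Rightarrow> bool" where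
  "pos_def_on J F \<longleftrightarrow> (\<forall>c\<in>J. F c \<in> PD)"

definition neg_def_on :: "real set \<Rightarrow> (real \<Rightarrow> real^'b^'b) \<Rightarrow> bool" where
  "neg_def_on J F \<longleftrightarrow> (\<forall>c\<in>J. - F c \<in> PD)"

definition complete_class_hypothesis ::
    "ereal \<Rightarrow> ereal \<Rightarrow> (real \<Rightarrow> real^('a::finite+'b::finite)^('a+'b)) \<Rightarrow> nat \<Rightarrow> ereal set \<Rightarrow> bool" where
  "complete_class_hypothesis L U M m Fx \<longleftrightarrow>
     (\<exists>(P :: real^('a+'b)^('a+'b)) (C :: real \<Rightarrow> real^('a+'b)^('a+'b)) c k \<Psi> f fk.
        let X = design_space L U; J = c ` X; F = F_matrix k f fk in
        invertible P \<and>
        smooth_monotone_transformation X c \<and>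
        (\<forall>u\<in>J. transpose (C u) = C u) \<and>
        (\<forall>x\<in>X. M x = P ** C (c x) ** transpose P) \<and>
        inj_on \<Psi> {1..<k} \<and>
        maximal_indep_nonconstant J (first_column_entries C) (\<Psi> ` {1..<k}) \<and>
        derivative_array J k \<Psi> (\<lambda>u. lower_block (C u)) f fk \<and>
        ((k = 2 * m - 1 \<and> neg_def_on J F \<and> Fx = {endpoint_A L U c}) \<or>
         (k = 2 * m - 1 \<and> pos_def_on J F \<and> Fx = {endpoint_B L U c}) \<or>
         (k = 2 * m \<and> neg_def_on J F \<and> Fx = {}) \<or>
         (k = 2 * m - 2 \<and> pos_def_on J F \<and> Fx = {L, U})))"

text \<open>The \<open>m\<close> points and weights are indexed by a linearly ordered type with \<open>m\<close> elements. The
  argument is a pair \<open>(x, \<omega>)\<close> of vectors of length \<open>m\<close> whose coordinates belonging to fixed points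
  and to the first weight are ignored: the former are replaced by the fixed points, the latter by
  one minus the sum of the other weights. The free coordinates are those of the vector \<open>Z\<close>.\<close>

definition Z_point ::
    "ereal \<Rightarrow> ereal \<Rightarrow> ereal set \<Rightarrow> real^('m::{finite,linorder}) \<Rightarrow> 'm \<Rightarrow> real" where
  "Z_point L U Fx x i =
     (if i = Min UNIV \<and> L \<in> Fx then real_of_ereal L
      else if i = Max UNIV \<and> U \<in> Fx then real_of_ereal U
      else x $ i)"

definition Z_weight :: "real^('m::{finite,linorder}) \<Rightarrow> 'm \<Rightarrow> real" where
  "Z_weight \<omega> i =
     (if i = Min UNIV then 1 - (\<Sum>j\<in>UNIV - {Min UNIV}. \<omega> $ j) else \<omega> $ i)"

text \<open>For distinct points the inner sum has the single term \<open>Z_weight \<omega> i\<close> with \<open>Z_point L U Fx x i = y\<close>.\<close>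

definition Z_design ::
    "ereal \<Rightarrow> ereal \<Rightarrow> ereal set \<Rightarrow>
     (real^('m::{finite,linorder})) \<times> (real^('m::{finite,linorder})) \<Rightarrow> design" where
  "Z_design L U Fx Z =
     (range (Z_point L U Fx (fst Z)),
      \<lambda>y. \<Sum>i | Z_point L U Fx (fst Z) i = y. Z_weight (snd Z) i)"

definition Phi_tilde ::
    "(real^'n^'n \<Rightarrow> real) \<Rightarrow> (real \<Rightarrow> real^'n^'n) \<Rightarrow> ereal \<Rightarrow> ereal \<Rightarrow> ereal set \<Rightarrow>
     (real^('m::{finite,linorder})) \<times> (real^('m::{finite,linorder})) \<Rightarrow> real" where
  "Phi_tilde \<Phi> M L U Fx Z = \<Phi> (info_matrix M (Z_design L U Fx Z))"

definition Z_domain ::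
    "ereal \<Rightarrow> ereal \<Rightarrow> ereal set \<Rightarrow>
     ((real^('m::{finite,linorder})) \<times> (real^('m::{finite,linorder}))) set" where
  "Z_domain L U Fx =
     {Z. strict_mono (Z_point L U Fx (fst Z)) \<and>
         Z_design L U Fx Z \<in> Xi (design_space L U) CARD('m) Fx}"

text \<open>The gradient is that of a function on \<open>Z_domain\<close>; it is one-sided in a coordinate \<open>x\<^sub>i\<close> that
  equals an endpoint of the design space. As the ignored coordinates have no influence, it vanishes
  exactly if all components belonging to coordinates of \<open>Z\<close> do.\<close>

definition feasible_critical_point ::
    "(real^'n^'n \<Rightarrow> real) \<Rightarrow> (real \<Rightarrow> real^'n^'n) \<Rightarrow> ereal \<Rightarrow> ereal \<Rightarrow> ereal set \<Rightarrow>
     (real^('m::{finite,linorder})) \<times> (real^('m::{finite,linorder})) \<Rightarrow> bool" where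
  "feasible_critical_point \<Phi> M L U Fx Z \<longleftrightarrow>
     Z \<in> Z_domain L U Fx \<and>
     (\<forall>i. i \<noteq> Min UNIV \<longrightarrow> 0 < snd Z $ i) \<and>
     (\<Sum>i\<in>UNIV - {Min UNIV}. snd Z $ i) < 1 \<and>
     (Phi_tilde \<Phi> M L U Fx has_derivative (\<lambda>_. 0)) (at Z within Z_domain L U Fx)"

end

theory Submission
  imports Defs
begin

text \<open>
  Let \<open>Q\<close> be a functional that is monotone in the Loewner order. In the transformed variable,
  \<open>Q \<bullet> C u\<close> is a combination of constants, of \<open>\<Psi> 1, \<dots>, \<Psi> (k - 1)\<close> and of the pairing of the lower blocks
  of \<open>Q\<close> and \<open>C u\<close>. Dividing by \<open>f l l\<close> and differentiating in turn leaves the pairing of the lower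
  block of \<open>Q\<close> with \<open>F\<close>, which has a known sign. By Rolle's theorem, \<open>Q \<bullet> C u - \<kappa>\<close> therefore has at most
  \<open>k\<close> zeros with multiplicity unless it vanishes identically. If it has \<open>k\<close> zeros, namely all fixed
  points and, twice each, free points, \<open>m\<close> points in total, then the parity of the number of zeros to
  the right of \<open>u\<close> shows that it is nowhere positive. These two facts (\<open>functional_zeros_le\<close> and
  \<open>functional_sign\<close>, transferred to the covariate in the locale \<open>oscillating_model\<close>) carry both
  halves of the theorem.

  A feasible critical point is optimal. Otherwise a better information matrix \<open>N\<close> exists. If the
  design could not be moved so that its information matrix \<open>A\<close> increases at least as fast as towards
  \<open>N\<close>, a separating functional \<open>Q\<close> would have equal values at all design points and be critical at the
  free ones (\<open>ascent_direction\<close>). By the sign rule its maximum over the design space would be its value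
  at \<open>A\<close>, but its value at \<open>N\<close> is larger. So there is an ascent direction, and concavity contradicts
  the vanishing gradient (\<open>critical_point_optimal\<close>).

  A feasible critical point exists. Among the matrices in the convex hull of all \<open>C x\<close> that have the
  same first columns as that of an optimal design and dominate it, one of largest trace lies on the
  relative boundary in a suitable sense; a supporting functional has maxima at all points that
  represent it (\<open>maximal_dominating_point\<close>). The bound on the number of zeros leaves at most \<open>m\<close> such
  points, hence exactly \<open>m\<close>, and forces the fixed points to be among them
  (\<open>saturated_optimal_design\<close>). The sign rule, applied to the functional of a null vector, shows that
  the information matrix is nonsingular (\<open>saturated_info_posdef\<close>), so the criterion is
  differentiable there and the gradient vanishes at the maximum.
\<close>

section \<open>Positive definite matrices and their dual cone\<close>

definition outer :: "real^'n \<Rightarrow> real^'n^'n" where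
  "outer v = (\<chi> i j. v $ i * v $ j)"

lemma quadratic_form_eq_inner: "v \<bullet> (A *v v) = A \<bullet> outer v"
  by (simp add: inner_vec_def matrix_vector_mult_def outer_def sum_distrib_left mult_ac)

lemma norm_outer: "norm (outer v) = (norm v)\<^sup>2"
proof -
  have "outer v \<bullet> outer v = (\<Sum>i\<in>UNIV. \<Sum>j\<in>UNIV. (v $ i * v $ i) * (v $ j * v $ j))"
    by (simp add: inner_vec_def outer_def mult_ac)
  also have "\<dots> = (v \<bullet> v) * (v \<bullet> v)"
    by (simp add: inner_vec_def sum_product)
  finally have "(norm (outer v))\<^sup>2 = ((norm v)\<^sup>2)\<^sup>2"
    by (simp add: power2_norm_eq_inner) (simp add: power2_eq_square)
  then show ?thesis by (rule power2_eq_imp_eq) auto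
qed

text \<open>Nonsymmetric matrices are included, so that the positive definite matrices form an open set in
  the whole matrix space and functionals separating them from a convex set are nontrivial.\<close>

definition posdef :: "(real^'n^'n) set" where
  "posdef = {S. \<forall>v. v \<noteq> 0 \<longrightarrow> 0 < v \<bullet> (S *v v)}"

definition psd :: "(real^'n^'n) set" where
  "psd = {S. \<forall>v. 0 \<le> v \<bullet> (S *v v)}"

text \<open>A matrix \<open>Q\<close> stands for the functional \<open>\<lambda>S. Q \<bullet> S\<close>. The functionals in the dual cone are those
  that are monotone in the Loewner order; separation theorems produce exactly these, and their
  strict positivity on positive definite matrices follows from openness, without a spectral
  decomposition.\<close>

definition psd_dual :: "(real^'n^'n) set" where
  "psd_dual = {Q. \<forall>S\<in>posdef. 0 \<le> Q \<bullet> S}"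

lemma PD_eq: "PD = posdef \<inter> sym_matrices"
  by (auto simp: PD_def posdef_def sym_matrices_def)

lemma NND_eq: "NND = psd \<inter> sym_matrices"
  by (auto simp: NND_def psd_def sym_matrices_def)

lemma posdef_subset_psd: "posdef \<subseteq> psd"
proof
  fix S :: "real^'n^'n" assume "S \<in> posdef"
  then have "0 \<le> v \<bullet> (S *v v)" for v
    by (cases "v = 0") (auto simp: posdef_def less_imp_le)
  then show "S \<in> psd" by (simp add: psd_def)
qed

lemma posdef_add_psd: "S \<in> posdef \<Longrightarrow> T \<in> psd \<Longrightarrow> S + T \<in> posdef"
  by (auto simp: posdef_def psd_def matrix_vector_mult_add_rdistrib inner_add_right add_pos_nonneg)

lemma psd_add: "S \<in> psd \<Longrightarrow> T \<in> psd \<Longrightarrow> S + T \<in> psd"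
  by (auto simp: psd_def matrix_vector_mult_add_rdistrib inner_add_right)

lemma psd_scaleR: "S \<in> psd \<Longrightarrow> 0 \<le> r \<Longrightarrow> r *\<^sub>R S \<in> psd"
  by (auto simp: psd_def quadratic_form_eq_inner)

lemma posdef_scaleR: "S \<in> posdef \<Longrightarrow> 0 < r \<Longrightarrow> r *\<^sub>R S \<in> posdef"
  by (auto simp: posdef_def quadratic_form_eq_inner)

lemma psd_sum: "(\<And>i. i \<in> I \<Longrightarrow> A i \<in> psd) \<Longrightarrow> (\<Sum>i\<in>I. A i) \<in> psd"
  by (auto simp: psd_def quadratic_form_eq_inner inner_sum_left intro!: sum_nonneg)

lemma sym_matrices_sum: "(\<And>i. i \<in> I \<Longrightarrow> A i \<in> sym_matrices) \<Longrightarrow> (\<Sum>i\<in>I. A i) \<in> sym_matrices"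
  by (simp add: sym_matrices_def transpose_def vec_eq_iff)

lemma mat_1_posdef: "mat 1 \<in> posdef"
  by (simp add: posdef_def)

lemma convex_posdef: "convex posdef"
proof (rule convexI)
  fix A B :: "real^'n^'n" and u v :: real
  assume A: "A \<in> posdef" "B \<in> posdef" and uv: "0 \<le> u" "0 \<le> v" "u + v = 1"
  show "u *\<^sub>R A + v *\<^sub>R B \<in> posdef"
  proof (cases "u = 0")
    case True
    then show ?thesis using A uv by simp
  next
    case False
    then show ?thesis
      using A uv posdef_subset_psd by (intro posdef_add_psd posdef_scaleR psd_scaleR) auto
  qed
qed

lemma closed_psd: "closed psd"
  unfolding psd_def quadratic_form_eq_inner
  by (intro closed_Collect_all closed_Collect_le continuous_intros)

text \<open>The quadratic form attains a positive minimum on the unit sphere, and it changes by at most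
  \<open>norm (T - S)\<close> there.\<close>

lemma open_posdef: "open (posdef :: (real^'n^'n) set)"
  unfolding open_dist
proof
  fix S :: "real^'n^'n" assume S: "S \<in> posdef"
  have "continuous_on (sphere 0 1) (\<lambda>v::real^'n. v \<bullet> (S *v v))"
    by (intro continuous_intros matrix_vector_mult_linear_continuous_on)
  moreover have "sphere (0::real^'n) 1 \<noteq> {}" by simp
  ultimately obtain v0 where v0: "v0 \<in> sphere (0::real^'n) 1"
      "\<And>v. v \<in> sphere 0 1 \<Longrightarrow> v0 \<bullet> (S *v v0) \<le> v \<bullet> (S *v v)"
    using continuous_attains_inf[OF compact_sphere, of 0 1 "\<lambda>v::real^'n. v \<bullet> (S *v v)"] by blast
  define \<mu> where "\<mu> = v0 \<bullet> (S *v v0)"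
  have "v0 \<noteq> 0" using v0(1) by force
  then have \<mu>: "0 < \<mu>" using S unfolding posdef_def \<mu>_def by blast
  have low: "\<mu> * (norm v)\<^sup>2 \<le> v \<bullet> (S *v v)" for v
  proof (cases "v = 0")
    case False
    define u where "u = v /\<^sub>R norm v"
    have "u \<in> sphere 0 1" using False by (simp add: u_def)
    then have "\<mu> \<le> u \<bullet> (S *v u)" using v0(2) unfolding \<mu>_def by blast
    then have "\<mu> * (norm v)\<^sup>2 \<le> (u \<bullet> (S *v u)) * (norm v)\<^sup>2"
      by (intro mult_right_mono) auto
    also have "\<dots> = (norm v *\<^sub>R u) \<bullet> (S *v (norm v *\<^sub>R u))"
      by (simp only: matrix_vector_mult_scaleR inner_scaleR_left inner_scaleR_right
          power2_eq_square mult_ac)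
    also have "norm v *\<^sub>R u = v" using False by (simp add: u_def)
    finally show ?thesis .
  qed simp
  show "\<exists>e>0. \<forall>T. dist T S < e \<longrightarrow> T \<in> posdef"
  proof (intro exI conjI allI impI)
    fix T assume T: "dist T S < \<mu>"
    show "T \<in> posdef" unfolding posdef_def
    proof (clarify)
      fix v :: "real^'n" assume v: "v \<noteq> 0"
      have "\<bar>(T - S) \<bullet> outer v\<bar> \<le> norm (T - S) * (norm v)\<^sup>2"
        using Cauchy_Schwarz_ineq2[of "T - S" "outer v"] by (simp add: norm_outer)
      also have "\<dots> < \<mu> * (norm v)\<^sup>2"
        using T v by (intro mult_strict_right_mono) (auto simp: dist_norm)
      finally have "\<bar>(T - S) \<bullet> outer v\<bar> < v \<bullet> (S *v v)" using low[of v] by linarith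
      then show "0 < v \<bullet> (T *v v)"
        by (simp add: quadratic_form_eq_inner inner_diff_left)
    qed
  qed (rule \<mu>)
qed

text \<open>Adding a small multiple of the identity makes a positive semidefinite matrix positive definite.\<close>

lemma psd_dual_inner_psd:
  assumes "Q \<in> psd_dual" "S \<in> psd"
  shows "0 \<le> Q \<bullet> S"
proof (rule ccontr)
  assume neg: "\<not> 0 \<le> Q \<bullet> S"
  define b where "b = Q \<bullet> mat 1"
  have *: "0 \<le> Q \<bullet> S + d * b" if "0 < d" for d
  proof -
    have "d *\<^sub>R mat 1 + S \<in> posdef"
      using assms that by (intro posdef_add_psd posdef_scaleR mat_1_posdef)
    then have "0 \<le> Q \<bullet> (d *\<^sub>R mat 1 + S)" using assms by (simp add: psd_dual_def)
    then show ?thesis by (simp add: inner_add_right b_def)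
  qed
  have "b \<ge> 0" using assms(1) mat_1_posdef unfolding psd_dual_def b_def by blast
  show False
  proof (cases "b = 0")
    case True then show False using *[of 1] neg by simp
  next
    case False
    then have "0 < b" using \<open>b \<ge> 0\<close> by simp
    then have "0 < - (Q \<bullet> S) / (2 * b)" using neg by (intro divide_pos_pos) auto
    from *[OF this] \<open>0 < b\<close> neg show False by (simp add: field_simps)
  qed
qed

text \<open>\<open>S - d *\<^sub>R Q\<close> is still positive definite for a small \<open>d > 0\<close>.\<close>

lemma psd_dual_inner_posdef:
  assumes Q: "Q \<in> psd_dual" "Q \<noteq> 0" and S: "S \<in> posdef"
  shows "0 < Q \<bullet> S"
proof -
  obtain e where e: "0 < e" "\<And>T. dist T S < e \<Longrightarrow> T \<in> posdef"
    using open_posdef S unfolding open_dist by blast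
  define d where "d = e / (2 * norm Q)"
  have d: "0 < d" using e Q by (simp add: d_def)
  have "dist (S - d *\<^sub>R Q) S = e / 2" using e Q by (simp add: dist_norm d_def)
  then have "S - d *\<^sub>R Q \<in> posdef" using e by simp
  then have "0 \<le> Q \<bullet> (S - d *\<^sub>R Q)" using Q by (simp add: psd_dual_def)
  moreover have "0 < d * (Q \<bullet> Q)" using d Q by simp
  ultimately show ?thesis by (simp add: inner_diff_right)
qed

lemma outer_psd_dual: "outer v \<in> psd_dual"
proof -
  have "0 \<le> outer v \<bullet> S" if "S \<in> posdef" for S
    using that posdef_subset_psd
    by (auto simp: psd_def quadratic_form_eq_inner inner_commute)
  then show ?thesis by (simp add: psd_dual_def)
qed

text \<open>A functional that is bounded below on all positive definite matrices is nonnegative there,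
  since they form a cone.\<close>

lemma psd_dualI_bounded:
  fixes Q :: "real^'n^'n"
  assumes "\<And>S. S \<in> posdef \<Longrightarrow> b \<le> Q \<bullet> S"
  shows "Q \<in> psd_dual"
  unfolding psd_dual_def
proof (safe, rule ccontr)
  fix S :: "real^'n^'n" assume S: "S \<in> posdef" and neg: "\<not> 0 \<le> Q \<bullet> S"
  define r where "r = (\<bar>b\<bar> + 1) / - (Q \<bullet> S)"
  have "0 < r" unfolding r_def using neg by (intro divide_pos_pos) auto
  then have "b \<le> Q \<bullet> (r *\<^sub>R S)" using assms posdef_scaleR[OF S] by blast
  also have "\<dots> = - (\<bar>b\<bar> + 1)" using neg by (simp add: r_def)
  finally show False by linarith
qed

lemma inner_matrix_mult_right:
  fixes A B R :: "real^'n^'n"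
  shows "R \<bullet> (A ** B) = (R ** transpose B) \<bullet> A"
proof -
  have "R \<bullet> (A ** B) = (\<Sum>i\<in>UNIV. \<Sum>j\<in>UNIV. \<Sum>k\<in>UNIV. R$i$j * (A$i$k * B$k$j))"
    by (simp add: inner_vec_def matrix_matrix_mult_def sum_distrib_left)
  also have "\<dots> = (\<Sum>i\<in>UNIV. \<Sum>k\<in>UNIV. \<Sum>j\<in>UNIV. R$i$j * (A$i$k * B$k$j))"
    by (intro sum.cong sum.swap refl)
  also have "\<dots> = (R ** transpose B) \<bullet> A"
    by (simp add: inner_vec_def matrix_matrix_mult_def transpose_def sum_distrib_left sum_distrib_right mult_ac)
  finally show ?thesis .
qed

lemma inner_transpose: "transpose A \<bullet> transpose B = A \<bullet> (B :: real^'n^'n)"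
  unfolding inner_vec_def transpose_def by (simp, rule sum.swap)

lemma inner_congruence:
  fixes P A R :: "real^'n^'n"
  shows "R \<bullet> (P ** A ** transpose P) = (transpose P ** R ** P) \<bullet> A"
proof -
  have "R \<bullet> (P ** A ** transpose P) = (R ** P) \<bullet> (P ** A)"
    using inner_matrix_mult_right[of R "P ** A" "transpose P"] by simp
  also have "\<dots> = transpose (R ** P) \<bullet> (transpose A ** transpose P)"
    using inner_transpose[of "R ** P" "P ** A"] by (simp add: matrix_transpose_mul)
  also have "\<dots> = transpose (transpose P ** R ** P) \<bullet> transpose A"
    using inner_matrix_mult_right[of "transpose (R ** P)" "transpose A" "transpose P"]
    by (simp add: matrix_transpose_mul matrix_mul_assoc)
  finally show ?thesis by (simp only: inner_transpose)
qed

lemma congruence_quadratic_form: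
  fixes P A :: "real^'n^'n"
  shows "v \<bullet> ((P ** A ** transpose P) *v v) = (transpose P *v v) \<bullet> (A *v (transpose P *v v))"
  by (metis dot_lmul_matrix matrix_vector_mul_assoc transpose_matrix_vector)

definition lower_embed :: "real^'b^'b \<Rightarrow> real^('a::finite+'b::finite)^('a+'b)" where
  "lower_embed S = (\<chi> i j. case i of Inl _ \<Rightarrow> 0 | Inr a \<Rightarrow> (case j of Inl _ \<Rightarrow> 0 | Inr b \<Rightarrow> S $ a $ b))"

lemma sum_UNIV_sum_type:
  "(\<Sum>i\<in>(UNIV::('a::finite+'b::finite) set). g i) = (\<Sum>a\<in>UNIV. g (Inl a)) + (\<Sum>b\<in>UNIV. g (Inr b))"
  unfolding UNIV_Plus_UNIV[symmetric] by (subst sum.Plus) auto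

lemma inner_lower_embed: "Q \<bullet> lower_embed S = lower_block Q \<bullet> S"
  by (simp add: inner_vec_def sum_UNIV_sum_type lower_embed_def lower_block_def)

lemma lower_embed_psd:
  assumes "S \<in> psd" shows "lower_embed S \<in> psd"
proof -
  have "v \<bullet> (lower_embed S *v v) = (\<chi> i. v $ Inr i) \<bullet> (S *v (\<chi> i. v $ Inr i))" for v :: "real^('b+'a)"
    by (simp add: inner_vec_def sum_UNIV_sum_type lower_embed_def matrix_vector_mult_def)
  with assms show ?thesis by (simp add: psd_def)
qed

lemma lower_block_psd_dual:
  assumes "Q \<in> psd_dual" shows "lower_block Q \<in> psd_dual"
proof -
  have "0 \<le> lower_block Q \<bullet> S" if "S \<in> posdef" for S
  proof -
    have "(lower_embed S :: real^('a+'b)^('a+'b)) \<in> psd"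
      using that posdef_subset_psd by (blast intro: lower_embed_psd)
    with assms show ?thesis
      using psd_dual_inner_psd[of Q "lower_embed S"] by (simp add: inner_lower_embed)
  qed
  then show ?thesis by (simp add: psd_dual_def)
qed

section \<open>Zeros and signs along a chain of derivatives\<close>

lemma DERIV_within_interval_at:
  fixes J :: "real set"
  assumes "is_interval J" and "\<And>u. u \<in> J \<Longrightarrow> (q has_real_derivative q' u) (at u within J)"
    and "a \<in> J" "b \<in> J" "a < u" "u < b"
  shows "(q has_real_derivative q' u) (at u)"
proof -
  have sub: "{a..b} \<subseteq> J"
    using assms(1,3,4) unfolding is_interval_1 by (meson atLeastAtMost_iff subsetI)
  then have "(q has_real_derivative q' u) (at u within {a..b})"
    using assms by (intro DERIV_subset[OF assms(2)]) auto
  then show ?thesis using assms by (simp add: at_within_Icc_at)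
qed

lemma MVT_on_interval:
  fixes J :: "real set"
  assumes "is_interval J" and d: "\<And>u. u \<in> J \<Longrightarrow> (q has_real_derivative q' u) (at u within J)"
    and "a \<in> J" "b \<in> J" "a < b"
  obtains z where "a < z" "z < b" "z \<in> J" "q b - q a = q' z * (b - a)"
proof -
  have sub: "{a..b} \<subseteq> J"
    using assms(1,3,4) unfolding is_interval_1 by (meson atLeastAtMost_iff subsetI)
  have "continuous_on {a..b} q"
    using DERIV_continuous_on[OF d] continuous_on_subset[OF _ sub] by blast
  moreover have "(q has_derivative (*) (q' z)) (at z)" if "a < z" "z < b" for z
    using DERIV_within_interval_at[OF assms(1) d assms(3,4) that]
    by (simp add: has_field_derivative_def)
  ultimately obtain z where "a < z" "z < b" "q b - q a = q' z * (b - a)"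
    using mvt[OF \<open>a < b\<close>, of q "\<lambda>z. (*) (q' z)"] by blast
  moreover from this have "z \<in> J" using sub by auto
  ultimately show ?thesis using that by blast
qed

lemma critical_point_between_zeros:
  fixes J :: "real set"
  assumes "is_interval J" and d: "\<And>u. u \<in> J \<Longrightarrow> (q has_real_derivative q' u) (at u within J)"
    and "a \<in> J" "b \<in> J" "a < c" "c < b" and zero: "q a = 0" "q b = 0" and pos: "0 < \<sigma> * q c"
  obtains z where "a < z" "z < b" "z \<in> J" "q' z = 0" "0 < \<sigma> * q z"
proof -
  have sub: "{a..b} \<subseteq> J"
    using assms(1,3,4) unfolding is_interval_1 by (meson atLeastAtMost_iff subsetI)
  have "continuous_on {a..b} (\<lambda>u. \<sigma> * q u)"
    using DERIV_continuous_on[OF d] continuous_on_subset[OF _ sub] by (intro continuous_intros) blast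
  then obtain z where z: "z \<in> {a..b}" "\<And>u. u \<in> {a..b} \<Longrightarrow> \<sigma> * q u \<le> \<sigma> * q z"
    using continuous_attains_sup[of "{a..b}" "\<lambda>u. \<sigma> * q u"] assms(5,6) by fastforce
  have zpos: "0 < \<sigma> * q z" using z(2)[of c] pos assms(5,6) by simp
  have "z \<noteq> a" "z \<noteq> b" using zpos zero by auto
  then have zi: "a < z" "z < b" using z(1) by auto
  have "((\<lambda>u. \<sigma> * q u) has_real_derivative \<sigma> * q' z) (at z)"
    using DERIV_within_interval_at[OF assms(1) d assms(3,4) zi]
    by (auto intro!: derivative_eq_intros)
  moreover have "\<forall>u. \<bar>z - u\<bar> < min (z - a) (b - z) \<longrightarrow> \<sigma> * q u \<le> \<sigma> * q z"
    using z(2) by (auto simp: abs_less_iff)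
  ultimately have "\<sigma> * q' z = 0"
    using zi DERIV_local_max[of "\<lambda>u. \<sigma> * q u" "\<sigma> * q' z" z "min (z - a) (b - z)"] by simp
  with zpos have "q' z = 0" by auto
  with that zi zpos sub z(1) show ?thesis by blast
qed

text \<open>The zeros in \<open>D\<close> are double. They are zeros of the derivative themselves and differ from those
  that Rolle's theorem yields strictly between consecutive zeros; the last conjunct keeps the two
  kinds apart in the induction.\<close>

lemma Rolle_finite:
  fixes J :: "real set"
  assumes J: "is_interval J" and d: "\<And>u. u \<in> J \<Longrightarrow> (q has_real_derivative q' u) (at u within J)"
    and "finite S" "S \<noteq> {}" "S \<subseteq> J" "\<And>y. y \<in> S \<Longrightarrow> q y = 0"
    and D: "\<And>y. y \<in> S \<inter> D \<Longrightarrow> q' y = 0"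
  shows "\<exists>S'. finite S' \<and> S' \<subseteq> J \<and> S' \<subseteq> {Min S..Max S} \<and> (\<forall>y\<in>S'. q' y = 0) \<and>
    Suc (card S') = card S + card (S \<inter> D) \<and> (S' \<inter> S = S \<inter> D)"
  using assms(3-7)
proof (induction S rule: finite_linorder_max_induct)
  case empty
  then show ?case by simp
next
  case (insert b S)
  show ?case
  proof (cases "S = {}")
    case True
    then show ?thesis using insert.prems
      by (intro exI[of _ "{b} \<inter> D"]) (cases "b \<in> D"; auto)
  next
    case False
    from insert.IH False insert.prems obtain S' where S': "finite S'" "S' \<subseteq> J"
        "S' \<subseteq> {Min S..Max S}" "\<forall>y\<in>S'. q' y = 0" "Suc (card S') = card S + card (S \<inter> D)"
        "S' \<inter> S = S \<inter> D"
      by auto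
    define a where "a = Max S"
    have a: "a \<in> S" "a < b" using False insert.hyps by (auto simp: a_def)
    have ab: "a \<in> J" "b \<in> J" "q a = 0" "q b = 0" using a insert.prems by auto
    obtain z where z: "a < z" "z < b" "z \<in> J" "q b - q a = q' z * (b - a)"
      using MVT_on_interval[OF J d ab(1,2) a(2)] .
    then have "q' z = 0" using ab a by simp
    have mm: "Min (insert b S) = Min S" "Max (insert b S) = b"
      using insert.hyps False a
      by (simp_all add: Min_insert Max_insert min_absorb2 max_absorb1 less_imp_le flip: a_def)
    have le: "\<forall>y\<in>S'. y \<le> a" using S'(3) by (auto simp: a_def)
    have leS: "\<forall>y\<in>S. y \<le> a" using insert.hyps by (auto simp: a_def)
    have minS: "Min S \<le> a" using a insert.hyps by (simp add: a_def)
    define T where "T = insert z (S' \<union> ({b} \<inter> D))"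
    have "b \<notin> S'" "z \<notin> S'" using le z a by force+
    then have cT: "card T = Suc (card S' + card ({b} \<inter> D))"
      using S'(1) z by (cases "b \<in> D") (auto simp: T_def card_insert_if)
    have "b \<notin> S" using insert.hyps by auto
    then have c2: "card (insert b S) = Suc (card S)"
        "card (insert b S \<inter> D) = card (S \<inter> D) + card ({b} \<inter> D)"
      using insert.hyps(1) by (cases "b \<in> D"; simp add: card_insert_if)+
    have "z \<notin> insert b S" using z leS by force
    moreover have "S' \<inter> insert b S = S \<inter> D" using \<open>b \<notin> S'\<close> S'(6) by auto
    ultimately have "T \<inter> insert b S = insert b S \<inter> D" unfolding T_def by auto
    moreover have "T \<subseteq> {Min (insert b S)..Max (insert b S)}"
      unfolding mm T_def using S'(3) le z a minS by force
    moreover have "T \<subseteq> J" "finite T" "\<forall>y\<in>T. q' y = 0"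
      using S' z insert.prems \<open>q' z = 0\<close> by (auto simp: T_def)
    ultimately show ?thesis using cT c2 S'(5) by (intro exI[of _ T]) simp
  qed
qed

text \<open>The data that are carried along a chain of derivatives: a point where the sign is known, together
  with the numbers \<open>a\<close> and \<open>b\<close> of zeros on either side of it, zeros in \<open>D\<close> being counted twice.\<close>

definition sign_with_zeros ::
    "real set \<Rightarrow> real set \<Rightarrow> (real \<Rightarrow> real) \<Rightarrow> nat \<Rightarrow> nat \<Rightarrow> real \<Rightarrow> bool" where
  "sign_with_zeros J D q a b \<sigma> \<longleftrightarrow>
     (\<exists>c S T. c \<in> J \<and> finite S \<and> finite T \<and> S \<subseteq> J \<and> T \<subseteq> J \<and>
        (\<forall>y\<in>S. y < c \<and> q y = 0) \<and> (\<forall>y\<in>T. c < y \<and> q y = 0) \<and>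
        a = card S + card (S \<inter> D) \<and> b = card T + card (T \<inter> D) \<and> 0 < \<sigma> * q c)"

text \<open>The sign is transported to the derivative at a point between the last zero on the left and
  the extremum that follows it; that extremum replaces the zero that Rolle's theorem loses on
  the right.\<close>

lemma sign_with_zeros_derivative_left:
  fixes J :: "real set"
  assumes J: "is_interval J" and d: "\<And>u. u \<in> J \<Longrightarrow> (q has_real_derivative q' u) (at u within J)"
    and D: "\<And>y. y \<in> D \<Longrightarrow> q' y = 0"
    and s: "sign_with_zeros J D q (Suc a) b \<sigma>"
  shows "sign_with_zeros J {} q' a b \<sigma>"
proof -
  from s obtain c S T where c: "c \<in> J" and fin: "finite S" "finite T" and sub: "S \<subseteq> J" "T \<subseteq> J"
    and S: "\<And>y. y \<in> S \<Longrightarrow> y < c \<and> q y = 0" and T: "\<And>y. y \<in> T \<Longrightarrow> c < y \<and> q y = 0"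
    and cS: "Suc a = card S + card (S \<inter> D)" and cT: "b = card T + card (T \<inter> D)"
    and pos: "0 < \<sigma> * q c"
    unfolding sign_with_zeros_def by blast
  have "S \<noteq> {}" using cS by auto
  define y where "y = Max S"
  have y: "y \<in> S" "y \<in> J" "y < c" "q y = 0" using Max_in[OF fin(1) \<open>S \<noteq> {}\<close>] sub S by (auto simp: y_def)
  obtain S' where S': "finite S'" "S' \<subseteq> J" "S' \<subseteq> {Min S..Max S}" "\<forall>y\<in>S'. q' y = 0"
      "Suc (card S') = card S + card (S \<inter> D)"
    using Rolle_finite[OF J d fin(1) \<open>S \<noteq> {}\<close> sub(1), of D] S D by blast
  have cS': "card S' = a" using S' cS by simp
  have "\<exists>z T'. y < z \<and> z \<in> J \<and> 0 < \<sigma> * q z \<and> finite T' \<and> T' \<subseteq> J \<and> (\<forall>u\<in>T'. z \<le> u \<and> q' u = 0) \<and> card T' = b"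
  proof (cases "T = {}")
    case True
    then show ?thesis using y c pos cT by (intro exI[of _ c] exI[of _ "{}"]) auto
  next
    case False
    define y' where "y' = Min T"
    have y': "y' \<in> T" "y' \<in> J" "c < y'" "q y' = 0" using Min_in[OF fin(2) False] sub T by (auto simp: y'_def)
    obtain T' where T': "finite T'" "T' \<subseteq> J" "T' \<subseteq> {Min T..Max T}" "\<forall>y\<in>T'. q' y = 0"
        "Suc (card T') = card T + card (T \<inter> D)"
      using Rolle_finite[OF J d fin(2) False sub(2), of D] T D by blast
    obtain z where z: "y < z" "z < y'" "z \<in> J" "q' z = 0" "0 < \<sigma> * q z"
      using critical_point_between_zeros[OF J d y(2) y'(2) y(3) y'(3) y(4) y'(4) pos] .
    have T'z: "\<forall>u\<in>T'. z < u" using T'(3) z by (auto simp: y'_def)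
    then have "z \<notin> T'" by blast
    then have "card (insert z T') = b" using T' cT by simp
    then show ?thesis using T' z T'z by (intro exI[of _ z] exI[of _ "insert z T'"]) force
  qed
  then obtain z T' where z: "y < z" "z \<in> J" "0 < \<sigma> * q z"
    and T': "finite T'" "T' \<subseteq> J" "\<forall>u\<in>T'. z \<le> u \<and> q' u = 0" "card T' = b" by blast
  obtain c' where c': "y < c'" "c' < z" "c' \<in> J" "q z - q y = q' c' * (z - y)"
    using MVT_on_interval[OF J d y(2) z(2,1)] .
  have "0 < (\<sigma> * q' c') * (z - y)" using c'(4) y z by (simp add: mult.assoc)
  then have "0 < \<sigma> * q' c'" using z by (simp add: zero_less_mult_iff)
  moreover have "\<forall>u\<in>S'. u < c'" using S'(3) c'(1) by (auto simp: y_def)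
  moreover have "\<forall>u\<in>T'. c' < u" using T'(3) c'(2) by auto
  ultimately show ?thesis
    unfolding sign_with_zeros_def using S' T' c'(3) cS' by (intro exI[of _ c'] exI[of _ S'] exI[of _ T']) auto
qed

text \<open>With no zero left to spend on the left, the mean value theorem up to the first zero on the right
  spends that zero and reverses the sign.\<close>

lemma sign_with_zeros_derivative_right:
  fixes J :: "real set"
  assumes J: "is_interval J" and d: "\<And>u. u \<in> J \<Longrightarrow> (q has_real_derivative q' u) (at u within J)"
    and D: "\<And>y. y \<in> D \<Longrightarrow> q' y = 0"
    and s: "sign_with_zeros J D q 0 (Suc b) \<sigma>"
  shows "sign_with_zeros J {} q' 0 b (- \<sigma>)"
proof -
  from s obtain c T where c: "c \<in> J" and fin: "finite T" and sub: "T \<subseteq> J"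
    and T: "\<And>y. y \<in> T \<Longrightarrow> c < y \<and> q y = 0"
    and cT: "Suc b = card T + card (T \<inter> D)" and pos: "0 < \<sigma> * q c"
    unfolding sign_with_zeros_def by blast
  have "T \<noteq> {}" using cT by auto
  define y where "y = Min T"
  have y: "y \<in> J" "c < y" "q y = 0" using Min_in[OF fin \<open>T \<noteq> {}\<close>] sub T by (auto simp: y_def)
  obtain T' where T': "finite T'" "T' \<subseteq> J" "T' \<subseteq> {Min T..Max T}" "\<forall>y\<in>T'. q' y = 0"
      "Suc (card T') = card T + card (T \<inter> D)"
    using Rolle_finite[OF J d fin \<open>T \<noteq> {}\<close> sub, of D] T D by blast
  obtain c' where c': "c < c'" "c' < y" "c' \<in> J" "q y - q c = q' c' * (y - c)"
    using MVT_on_interval[OF J d c y(1,2)] .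
  have "0 < (- \<sigma> * q' c') * (y - c)" using c'(4) y pos by (simp add: mult.assoc flip: c'(4))
  then have "0 < - \<sigma> * q' c'" using y(2) by (simp only: zero_less_mult_iff) auto
  moreover have "\<forall>u\<in>T'. c' < u" using T'(3) c'(2) by (auto simp: y_def)
  ultimately show ?thesis
    unfolding sign_with_zeros_def using T' c'(3) cT
    by (intro exI[of _ c'] exI[of _ "{}"] exI[of _ T']) auto
qed

lemma sign_with_zeros_mult:
  assumes s: "sign_with_zeros J {} q' a b \<sigma>"
    and "\<And>u. u \<in> J \<Longrightarrow> q' u = r u * p u" "\<And>u. u \<in> J \<Longrightarrow> 0 < s * r u"
  shows "sign_with_zeros J {} p a b (s * \<sigma>)"
proof -
  from s obtain c S T where c: "c \<in> J" and fin: "finite S" "finite T" and sub: "S \<subseteq> J" "T \<subseteq> J"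
    and S: "\<And>y. y \<in> S \<Longrightarrow> y < c \<and> q' y = 0" and T: "\<And>y. y \<in> T \<Longrightarrow> c < y \<and> q' y = 0"
    and ab: "a = card S" "b = card T" and pos: "0 < \<sigma> * q' c"
    unfolding sign_with_zeros_def by auto
  have rn: "r u \<noteq> 0" if "u \<in> J" for u using assms(3)[OF that] by auto
  have "0 < (\<sigma> * (r c * p c)) * (s * r c)" using pos assms(2,3)[OF c] by simp
  also have "\<dots> = (r c)\<^sup>2 * (s * \<sigma> * p c)" by (simp add: power2_eq_square mult_ac)
  finally have "0 < s * \<sigma> * p c" by (simp add: zero_less_mult_iff)
  moreover have "p y = 0" if "y \<in> S \<union> T" for y
    using that S T assms(2)[of y] rn[of y] sub by auto
  ultimately show ?thesis
    unfolding sign_with_zeros_def using c fin sub S T ab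
    by (intro exI[of _ c] exI[of _ S] exI[of _ T]) auto
qed

text \<open>Zeros on the left are spent first, which preserves the sign; each zero spent on the right
  reverses it. Truncated subtraction expresses both phases: \<open>a - t\<close> zeros remain on the left after
  \<open>t\<close> steps, and \<open>t - a\<close> have been taken from the right.\<close>

lemma sign_with_zeros_chain:
  fixes J :: "real set"
  assumes J: "is_interval J"
    and d: "\<And>t u. t < k \<Longrightarrow> u \<in> J \<Longrightarrow> (q t has_real_derivative r t u * q (Suc t) u) (at u within J)"
    and s: "\<And>t u. t < k \<Longrightarrow> u \<in> J \<Longrightarrow> 0 < s t * r t u"
    and D: "\<And>y. y \<in> D \<Longrightarrow> r 0 y * q 1 y = 0"
    and start: "sign_with_zeros J D (q 0) a b \<sigma>" and "k \<le> a + b" and "t \<le> k"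
  shows "sign_with_zeros J (if t = 0 then D else {}) (q t) (a - t) (b - (t - a))
     ((\<Prod>i<t. s i) * (-1) ^ (t - a) * \<sigma>)"
  using \<open>t \<le> k\<close>
proof (induction t)
  case 0
  then show ?case using start by simp
next
  case (Suc t)
  define E where "E = (if t = 0 then D else {})"
  define \<tau> where "\<tau> = (\<Prod>i<t. s i) * (-1) ^ (t - a) * \<sigma>"
  have IH: "sign_with_zeros J E (q t) (a - t) (b - (t - a)) \<tau>"
    using Suc by (simp add: E_def \<tau>_def)
  have t: "t < k" using Suc.prems by simp
  have E: "r t y * q (Suc t) y = 0" if "y \<in> E" for y
    using that D[of y] by (auto simp: E_def split: if_splits)
  show ?case
  proof (cases "t < a")
    case True
    then have "a - t = Suc (a - Suc t)" "b - (t - a) = b" by auto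
    then have "sign_with_zeros J {} (\<lambda>u. r t u * q (Suc t) u) (a - Suc t) b \<tau>"
      using sign_with_zeros_derivative_left[OF J d[OF t], of E] E IH by simp
    then have "sign_with_zeros J {} (q (Suc t)) (a - Suc t) b (s t * \<tau>)"
      by (rule sign_with_zeros_mult) (use s[OF t] in auto)
    then show ?thesis using True by (simp add: \<tau>_def mult_ac)
  next
    case False
    then have eq: "a - t = 0" "b - (t - a) = Suc (b - (Suc t - a))" "Suc t - a = Suc (t - a)"
      using t \<open>k \<le> a + b\<close> by auto
    then have "sign_with_zeros J {} (\<lambda>u. r t u * q (Suc t) u) 0 (b - (Suc t - a)) (- \<tau>)"
      using sign_with_zeros_derivative_right[OF J d[OF t], of E] E IH by simp
    then have "sign_with_zeros J {} (q (Suc t)) 0 (b - (Suc t - a)) (s t * (- \<tau>))"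
      by (rule sign_with_zeros_mult) (use s[OF t] in auto)
    then show ?thesis using False eq by (simp add: \<tau>_def mult_ac)
  qed
qed

lemma chain_sign:
  fixes J :: "real set"
  assumes J: "is_interval J" and "0 < k"
    and d: "\<And>t u. t < k \<Longrightarrow> u \<in> J \<Longrightarrow> (q t has_real_derivative r t u * q (Suc t) u) (at u within J)"
    and s: "\<And>t u. t < k \<Longrightarrow> u \<in> J \<Longrightarrow> 0 < s t * r t u"
    and D: "\<And>y. y \<in> D \<Longrightarrow> r 0 y * q 1 y = 0"
    and start: "sign_with_zeros J D (q 0) a b \<sigma>" and "k = a + b"
  shows "\<exists>u\<in>J. 0 < (\<Prod>i<k. s i) * (-1) ^ b * \<sigma> * q k u"
proof -
  have "sign_with_zeros J {} (q k) (a - k) (b - (k - a)) ((\<Prod>i<k. s i) * (-1) ^ (k - a) * \<sigma>)"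
    using sign_with_zeros_chain[OF J d s D start, where t = k] assms by simp
  then show ?thesis using \<open>k = a + b\<close> unfolding sign_with_zeros_def by auto
qed

lemma chain_zero:
  fixes J :: "real set"
  assumes J: "is_interval J" and "0 < k"
    and d: "\<And>t u. t < k \<Longrightarrow> u \<in> J \<Longrightarrow> (q t has_real_derivative r t u * q (Suc t) u) (at u within J)"
    and s: "\<And>t u. t < k \<Longrightarrow> u \<in> J \<Longrightarrow> 0 < s t * r t u"
    and D: "\<And>y. y \<in> D \<Longrightarrow> r 0 y * q 1 y = 0"
    and start: "sign_with_zeros J D (q 0) a b \<sigma>" and "k < a + b"
  shows "(\<exists>u\<in>J. q k u = 0) \<and> (\<exists>u\<in>J. q k u \<noteq> 0)"
proof -
  have "sign_with_zeros J {} (q k) (a - k) (b - (k - a)) ((\<Prod>i<k. s i) * (-1) ^ (k - a) * \<sigma>)"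
    using sign_with_zeros_chain[OF J d s D start, where t = k] assms by simp
  then obtain c S T where *: "c \<in> J" "S \<subseteq> J" "T \<subseteq> J" "\<forall>y\<in>S \<union> T. q k y = 0"
      "a - k = card S" "b - (k - a) = card T" "q k c \<noteq> 0"
    unfolding sign_with_zeros_def Int_empty_right card.empty add_0_right
    by (metis Un_iff less_irrefl mult_zero_right)
  moreover have "S \<union> T \<noteq> {}" using *(5,6) \<open>k < a + b\<close> by auto
  ultimately show ?thesis by blast
qed

text \<open>By Darboux's theorem, a derivative without zeros does not change sign.\<close>

lemma nonvanishing_derivative_sign:
  fixes J :: "real set"
  assumes J: "is_interval J" and d: "\<And>u. u \<in> J \<Longrightarrow> (q has_real_derivative q' u) (at u within J)"
    and nz: "\<And>u. u \<in> J \<Longrightarrow> q' u \<noteq> 0"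
  shows "\<exists>s. \<forall>u\<in>J. 0 < s * q' u"
proof -
  have no_change: False if ab: "a \<in> J" "b \<in> J" "a < b" and neg: "q' a * q' b < 0" for a b
  proof -
    define p where "p u = q' a * q u" for u
    have p: "(p has_real_derivative q' a * q' u) (at u within J)" if "u \<in> J" for u
      unfolding p_def using d[OF that] by (auto intro!: derivative_eq_intros)
    have sub: "{a..b} \<subseteq> J"
      using J ab unfolding is_interval_1 by (meson atLeastAtMost_iff subsetI)
    have "continuous_on {a..b} p"
      using DERIV_continuous_on[OF p] continuous_on_subset[OF _ sub] by blast
    then obtain z where z: "z \<in> {a..b}" "\<And>u. u \<in> {a..b} \<Longrightarrow> p u \<le> p z"
      using continuous_attains_sup[of "{a..b}" p] ab by fastforce
    have "0 < q' a * q' a" using nz[OF ab(1)] by (metis not_square_less_zero linorder_neqE_linordered_idom mult_eq_0_iff)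
    from has_real_derivative_pos_inc_right[OF p[OF ab(1)] this] obtain e
      where e: "0 < e" "\<forall>h>0. a + h \<in> J \<longrightarrow> h < e \<longrightarrow> p a < p (a + h)" by blast
    define h where "h = min (e / 2) (b - a)"
    have "0 < h" "h < e" "a + h \<in> {a..b}" using e(1) ab by (auto simp: h_def)
    then have "p a < p (a + h)" "p (a + h) \<le> p z" using e(2) z(2) sub by blast+
    then have "z \<noteq> a" by (metis leD)
    from has_real_derivative_neg_dec_left[OF p[OF ab(2)] neg] obtain e
      where e: "0 < e" "\<forall>h>0. b - h \<in> J \<longrightarrow> h < e \<longrightarrow> p b < p (b - h)" by blast
    define h where "h = min (e / 2) (b - a)"
    have "0 < h" "h < e" "b - h \<in> {a..b}" using e(1) ab by (auto simp: h_def)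
    then have "p b < p (b - h)" "p (b - h) \<le> p z" using e(2) z(2) sub by blast+
    then have "z \<noteq> b" by (metis leD)
    with z(1) \<open>z \<noteq> a\<close> have zi: "a < z" "z < b" by auto
    have "(p has_real_derivative q' a * q' z) (at z)"
      using DERIV_within_interval_at[OF J p ab(1,2) zi] .
    moreover have "\<forall>u. \<bar>z - u\<bar> < min (z - a) (b - z) \<longrightarrow> p u \<le> p z"
      using z(2) by (auto simp: abs_less_iff)
    ultimately have "q' a * q' z = 0"
      using zi DERIV_local_max[of p "q' a * q' z" z "min (z - a) (b - z)"] by simp
    then show False using nz ab(1) z(1) sub by auto
  qed
  have "0 < q' a * q' b" if "a \<in> J" "b \<in> J" for a b
  proof (rule ccontr)
    assume "\<not> 0 < q' a * q' b"
    then have neg: "q' a * q' b < 0" using nz that by (metis linorder_neqE_linordered_idom mult_eq_0_iff)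
    then have "a \<noteq> b" by (auto simp: mult_less_0_iff)
    then consider "a < b" | "b < a" by linarith
    then show False
      using no_change[OF that] no_change[OF that(2,1)] neg by cases (auto simp: mult.commute)
  qed
  then have *: "\<forall>u\<in>J. 0 < q' a * q' u" if "a \<in> J" for a using that by blast
  show ?thesis
  proof (cases "J = {}")
    case False
    then obtain a where "a \<in> J" by auto
    then show ?thesis using * by (intro exI[of _ "q' a"])
  qed simp
qed

section \<open>Linear functionals of the information matrix\<close>

text \<open>The factor \<open>\<sigma>\<close> turns both the positive and the negative definite case into one assumption.\<close>

locale derivative_chain =
  fixes J :: "real set"
    and C :: "real \<Rightarrow> real^('a::finite+'b::finite)^('a+'b)"
    and k :: nat and \<Psi> :: "nat \<Rightarrow> real \<Rightarrow> real"
    and f :: "nat \<Rightarrow> nat \<Rightarrow> real \<Rightarrow> real" and fk :: "nat \<Rightarrow> real \<Rightarrow> real^'b^'b"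
    and \<sigma> :: real
  assumes J: "is_interval J" "\<nexists>u. J = {u}" "J \<noteq> {}"
    and sym: "\<And>u. u \<in> J \<Longrightarrow> transpose (C u) = C u"
    and inj: "inj_on \<Psi> {1..<k}"
    and maximal: "maximal_indep_nonconstant J (first_column_entries C) (\<Psi> ` {1..<k})"
    and array: "derivative_array J k \<Psi> (\<lambda>u. lower_block (C u)) f fk"
    and k_pos: "0 < k"
    and F_posdef: "\<And>u. u \<in> J \<Longrightarrow> \<sigma> *\<^sub>R F_matrix k f fk u \<in> posdef"
begin

lemma deriv_f:
  assumes "u \<in> J" "t \<in> {2..k}" "l \<in> {t..<k}"
  shows "((\<lambda>u. f l (t - 1) u / f (t - 1) (t - 1) u) has_real_derivative f l t u) (at u within J)"
  using array assms unfolding derivative_array_def by blast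

lemma deriv_fk:
  assumes "u \<in> J" "t \<in> {2..k}"
  shows "((\<lambda>u. fk (t - 1) u /\<^sub>R f (t - 1) (t - 1) u) has_vector_derivative fk t u) (at u within J)"
  using array assms unfolding derivative_array_def by blast

lemma deriv_\<Psi>:
  assumes "u \<in> J" "l \<in> {1..<k}"
  shows "(\<Psi> l has_real_derivative f l 1 u) (at u within J)"
  using array assms unfolding derivative_array_def by blast

lemma deriv_lower_block:
  assumes "u \<in> J"
  shows "((\<lambda>u. lower_block (C u)) has_vector_derivative fk 1 u) (at u within J)"
  using array assms unfolding derivative_array_def by blast

lemma f_nonzero:
  assumes "u \<in> J" "l \<in> {1..<k}"
  shows "f l l u \<noteq> 0"
proof
  assume "f l l u = 0"
  then have "(\<Prod>l\<in>{1..<k}. f l l u) = 0" using assms by (auto simp: prod_zero_iff)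
  then have "F_matrix k f fk u = 0" by (simp only: F_matrix_def scaleR_zero_left)
  then have "(0 :: real^'b^'b) \<in> posdef" using F_posdef[OF assms(1)] by simp
  then show False by (auto simp: posdef_def dest: spec[of _ "axis undefined 1"])
qed

lemma f_sign:
  assumes l: "l \<in> {1..<k}"
  shows "\<exists>s. \<forall>u\<in>J. 0 < s * f l l u"
proof (cases "l = 1")
  case True
  show ?thesis unfolding True
    by (rule nonvanishing_derivative_sign[OF J(1) deriv_\<Psi>]) (use l True f_nonzero in auto)
next
  case False
  show ?thesis
    by (rule nonvanishing_derivative_sign[OF J(1) deriv_f]) (use l False f_nonzero in auto)
qed

definition in_affine_span :: "(real \<Rightarrow> real) \<Rightarrow> bool" where
  "in_affine_span e \<longleftrightarrow> (\<exists>\<alpha>0 \<alpha>. \<forall>u\<in>J. e u = \<alpha>0 + (\<Sum>l\<in>{1..<k}. \<alpha> l * \<Psi> l u))"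

lemma in_affine_span_add:
  assumes "in_affine_span e" "in_affine_span e'"
  shows "in_affine_span (\<lambda>u. e u + e' u)"
proof -
  obtain a0 a b0 b where "\<And>u. u \<in> J \<Longrightarrow> e u = a0 + (\<Sum>l\<in>{1..<k}. a l * \<Psi> l u)"
      "\<And>u. u \<in> J \<Longrightarrow> e' u = b0 + (\<Sum>l\<in>{1..<k}. b l * \<Psi> l u)"
    using assms unfolding in_affine_span_def by blast
  then show ?thesis unfolding in_affine_span_def
    by (intro exI[of _ "a0 + b0"] exI[of _ "\<lambda>l. a l + b l"]) (simp add: distrib_right sum.distrib)
qed

lemma in_affine_span_mult:
  assumes "in_affine_span e"
  shows "in_affine_span (\<lambda>u. r * e u)"
proof -
  obtain a0 a where "\<And>u. u \<in> J \<Longrightarrow> e u = a0 + (\<Sum>l\<in>{1..<k}. a l * \<Psi> l u)"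
    using assms unfolding in_affine_span_def by blast
  then show ?thesis unfolding in_affine_span_def
    by (intro exI[of _ "r * a0"] exI[of _ "\<lambda>l. r * a l"]) (simp add: distrib_left sum_distrib_left mult.assoc)
qed

lemma in_affine_span_const: "in_affine_span (\<lambda>u. r)"
  unfolding in_affine_span_def by (intro exI[of _ r] exI[of _ "\<lambda>_. 0"]) simp

lemma in_affine_span_sum:
  "(\<And>i. i \<in> I \<Longrightarrow> in_affine_span (e i)) \<Longrightarrow> in_affine_span (\<lambda>u. \<Sum>i\<in>I. e i u)"
  by (induction I rule: infinite_finite_induct) (auto intro: in_affine_span_const in_affine_span_add)

lemma in_affine_span_cong:
  "in_affine_span e \<Longrightarrow> (\<And>u. u \<in> J \<Longrightarrow> e u = e' u) \<Longrightarrow> in_affine_span e'"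
  unfolding in_affine_span_def by simp

text \<open>By maximality, a nonconstant entry outside the chosen functions depends linearly on them.\<close>

lemma first_column_in_affine_span:
  assumes e: "e \<in> first_column_entries C"
  shows "in_affine_span e"
proof -
  define S where "S = \<Psi> ` {1..<k}"
  have fin: "finite S" by (simp add: S_def)
  have sum_S: "(\<Sum>g\<in>S. h g) = (\<Sum>l\<in>{1..<k}. h (\<Psi> l))" for h :: "(real \<Rightarrow> real) \<Rightarrow> real"
    unfolding S_def by (subst sum.reindex[OF inj]) (simp only: o_def)
  have indep: "lin_indep_on J S"
    and max: "nonconstant_on J e \<Longrightarrow> e \<notin> S \<Longrightarrow> \<not> lin_indep_on J (insert e S)"
    using maximal e unfolding maximal_indep_nonconstant_def S_def by blast+
  consider "\<not> nonconstant_on J e" | "e \<in> S" | "nonconstant_on J e" "e \<notin> S" by blast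
  then show ?thesis
  proof cases
    case 1
    then have "\<exists>r. \<forall>u\<in>J. e u = r" unfolding nonconstant_on_def by blast
    then show ?thesis using in_affine_span_cong[OF in_affine_span_const] by metis
  next
    case 2
    then obtain l where l: "l \<in> {1..<k}" "e = \<Psi> l" by (auto simp: S_def)
    have "(\<Sum>i\<in>{1..<k}. (if i = l then 1 else 0) * \<Psi> i u) = \<Psi> l u" for u
      using l(1) by (subst sum.remove[of _ l]) auto
    then show ?thesis unfolding in_affine_span_def l(2)
      by (intro exI[of _ 0] exI[of _ "\<lambda>i. if i = l then 1 else 0"]) auto
  next
    case 3
    then obtain a where a: "\<forall>c\<in>J. (\<Sum>g\<in>insert e S. a g * g c) = 0" "\<exists>g\<in>insert e S. a g \<noteq> 0"
      using max unfolding lin_indep_on_def by blast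
    have eq: "a e * e c + (\<Sum>g\<in>S. a g * g c) = 0" if "c \<in> J" for c
      using a(1) that fin 3(2) by auto
    have "a e \<noteq> 0"
    proof
      assume "a e = 0"
      then have "\<forall>c\<in>J. (\<Sum>g\<in>S. a g * g c) = 0" using eq by auto
      then have "\<forall>g\<in>S. a g = 0" using indep unfolding lin_indep_on_def by blast
      with a(2) \<open>a e = 0\<close> show False by auto
    qed
    have "e u = (\<Sum>l\<in>{1..<k}. (- a (\<Psi> l) / a e) * \<Psi> l u)" if "u \<in> J" for u
    proof -
      have "e u = - (\<Sum>g\<in>S. a g * g u) / a e"
        using eq[OF that] \<open>a e \<noteq> 0\<close> by (simp add: field_simps)
      then show ?thesis unfolding sum_S
        by (simp add: sum_divide_distrib sum_negf)
    qed
    then show ?thesis unfolding in_affine_span_def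
      by (intro exI[of _ 0] exI[of _ "\<lambda>l. - a (\<Psi> l) / a e"]) auto
  qed
qed

text \<open>Since \<open>C u\<close> is symmetric, only its lower block is not covered by the first columns.\<close>

lemma functional_decomposition:
  "in_affine_span (\<lambda>u. Q \<bullet> C u - lower_block Q \<bullet> lower_block (C u))"
proof (rule in_affine_span_cong)
  have col: "in_affine_span (\<lambda>u. r * C u $ i $ Inl j)" for r i j
    by (intro in_affine_span_mult first_column_in_affine_span) (auto simp: first_column_entries_def)
  show "in_affine_span (\<lambda>u. (\<Sum>i\<in>UNIV. \<Sum>a\<in>UNIV. Q $ i $ Inl a * C u $ i $ Inl a) +
      (\<Sum>a\<in>UNIV. \<Sum>b\<in>UNIV. Q $ Inl a $ Inr b * C u $ Inr b $ Inl a))"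
    by (intro in_affine_span_add in_affine_span_sum col)
  fix u assume u: "u \<in> J"
  have sw: "C u $ Inr b $ Inl a = C u $ Inl a $ Inr b" for a b
    using arg_cong[OF sym[OF u], of "\<lambda>A. A $ Inl a $ Inr b"] by (simp add: transpose_def)
  show "(\<Sum>i\<in>UNIV. \<Sum>a\<in>UNIV. Q $ i $ Inl a * C u $ i $ Inl a) +
      (\<Sum>a\<in>UNIV. \<Sum>b\<in>UNIV. Q $ Inl a $ Inr b * C u $ Inr b $ Inl a)
      = Q \<bullet> C u - lower_block Q \<bullet> lower_block (C u)"
    by (simp add: sw inner_vec_def sum_UNIV_sum_type lower_block_def sum.distrib)
qed

lemma C_differentiable: "\<exists>C'. \<forall>u\<in>J. (C has_vector_derivative C' u) (at u within J)"
proof -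
  have ex: "\<exists>d. ((\<lambda>u. C u $ i $ j) has_real_derivative d) (at u within J)" if u: "u \<in> J" for i j u
  proof -
    define Q :: "real^('a+'b)^('a+'b)" where "Q = axis i (axis j 1)"
    have QC: "Q \<bullet> C v = C v $ i $ j" for v by (simp add: Q_def inner_axis')
    obtain \<alpha>0 \<alpha> where dec: "\<forall>v\<in>J.
        C v $ i $ j - lower_block Q \<bullet> lower_block (C v) = \<alpha>0 + (\<Sum>l\<in>{1..<k}. \<alpha> l * \<Psi> l v)"
      using functional_decomposition[of Q] unfolding in_affine_span_def QC by (elim exE)
    have eq: "C v $ i $ j = \<alpha>0 + (\<Sum>l\<in>{1..<k}. \<alpha> l * \<Psi> l v) + lower_block Q \<bullet> lower_block (C v)"
      if "v \<in> J" for v using dec that by fastforce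
    have "((\<lambda>v. \<alpha>0 + (\<Sum>l\<in>{1..<k}. \<alpha> l * \<Psi> l v) + lower_block Q \<bullet> lower_block (C v))
        has_real_derivative (0 + (\<Sum>l\<in>{1..<k}. \<alpha> l * f l 1 u) + lower_block Q \<bullet> fk 1 u)) (at u within J)"
      using bounded_linear.has_vector_derivative[OF bounded_linear_inner_right deriv_lower_block[OF u]]
      by (intro DERIV_add DERIV_const DERIV_sum DERIV_cmult deriv_\<Psi>[OF u])
        (auto simp: has_real_derivative_iff_has_vector_derivative)
    then have "((\<lambda>v. C v $ i $ j) has_real_derivative
        (0 + (\<Sum>l\<in>{1..<k}. \<alpha> l * f l 1 u) + lower_block Q \<bullet> fk 1 u)) (at u within J)"
      unfolding has_field_derivative_def by (rule has_derivative_transform[OF u, rotated]) (simp add: eq)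
    then show ?thesis by blast
  qed
  define d where "d i j u = (SOME d. ((\<lambda>u. C u $ i $ j) has_real_derivative d) (at u within J))" for i j u
  have d: "((\<lambda>u. C u $ i $ j) has_real_derivative d i j u) (at u within J)" if "u \<in> J" for i j u
    unfolding d_def using ex[OF that] by (rule someI_ex)
  have "(C has_vector_derivative (\<chi> i j. d i j u)) (at u within J)" if "u \<in> J" for u
  proof -
    have "((\<lambda>v. (\<chi> i j. C v $ i $ j)) has_vector_derivative (\<chi> i j. d i j u)) (at u within J)"
      using d[OF that] unfolding has_vector_derivative_def has_field_derivative_def
      by (subst has_derivative_componentwise_within) (auto simp: Basis_vec_def inner_axis mult_commute_abs)
    then show ?thesis by simp
  qed
  then show ?thesis by (intro exI[of _ "\<lambda>u. \<chi> i j. d i j u"] ballI)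
qed

text \<open>Differentiating a functional and dividing by \<open>f l l\<close> removes the functions \<open>\<Psi> 1\<close>, \<open>\<Psi> 2\<close>, \<open>\<dots>\<close> one after
  the other. What remains at the end is, up to a positive factor and the signs \<open>s\<close> of the
  divisors, the pairing of \<open>lower_block Q\<close> with \<open>F\<close>, whose sign is known.\<close>

definition is_functional_chain where
  "is_functional_chain Q \<kappa> q r s \<longleftrightarrow>
     (\<forall>u\<in>J. q 0 u = Q \<bullet> C u - \<kappa>) \<and>
     (\<forall>t<k. \<forall>u\<in>J. (q t has_real_derivative r t u * q (Suc t) u) (at u within J)) \<and>
     (\<forall>t<k. \<forall>u\<in>J. 0 < s t * r t u) \<and>
     (\<forall>u\<in>J. \<exists>c>0. (\<Prod>i<k. s i) * q k u = c * (lower_block Q \<bullet> F_matrix k f fk u))"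

lemma functional_chain: "\<exists>q r s. is_functional_chain Q \<kappa> q r s"
proof -
  obtain \<alpha>0 \<alpha> where dec': "\<forall>v\<in>J.
      Q \<bullet> C v - lower_block Q \<bullet> lower_block (C v) = \<alpha>0 + (\<Sum>l\<in>{1..<k}. \<alpha> l * \<Psi> l v)"
    using functional_decomposition[of Q] unfolding in_affine_span_def by (elim exE)
  have dec: "Q \<bullet> C v = \<alpha>0 + (\<Sum>l\<in>{1..<k}. \<alpha> l * \<Psi> l v) + lower_block Q \<bullet> lower_block (C v)"
    if "v \<in> J" for v using dec' that by fastforce
  define g where "g t u = (\<Sum>l\<in>{t..<k}. \<alpha> l * f l t u) + lower_block Q \<bullet> fk t u" for t u
  define q where "q t u = (if t = 0 then Q \<bullet> C u - \<kappa> else if t < k then g t u / f t t u else g t u)" for t u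
  define r where "r t u = (if Suc t < k then f (Suc t) (Suc t) u else 1)" for t u
  have rq: "r t u * q (Suc t) u = g (Suc t) u" if "u \<in> J" for t u
    using f_nonzero[OF that, of "Suc t"] by (simp add: r_def q_def)
  have "\<exists>s. \<forall>u\<in>J. 0 < s * r t u" for t
  proof (cases "Suc t < k")
    case True
    then show ?thesis using f_sign[of "Suc t"] by (simp add: r_def)
  qed (auto simp: r_def intro: exI[of _ 1])
  then have "\<forall>t. \<exists>s. \<forall>u\<in>J. 0 < s * r t u" by blast
  from choice[OF this] obtain s where s: "\<forall>t. \<forall>u\<in>J. 0 < s t * r t u" ..
  have "is_functional_chain Q \<kappa> q r s"
    unfolding is_functional_chain_def
  proof (intro conjI ballI allI impI)
    show "q 0 u = Q \<bullet> C u - \<kappa>" for u by (simp add: q_def)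
    show "0 < s t * r t u" if "u \<in> J" for t u using s that by blast
    show "(q t has_real_derivative r t u * q (Suc t) u) (at u within J)" if t: "t < k" and u: "u \<in> J" for t u
    proof (cases "t = 0")
      case True
      have "((\<lambda>v. \<alpha>0 + (\<Sum>l\<in>{1..<k}. \<alpha> l * \<Psi> l v) + lower_block Q \<bullet> lower_block (C v) - \<kappa>)
          has_real_derivative (0 + (\<Sum>l\<in>{1..<k}. \<alpha> l * f l 1 u) + lower_block Q \<bullet> fk 1 u - 0)) (at u within J)"
        using bounded_linear.has_vector_derivative[OF bounded_linear_inner_right deriv_lower_block[OF u]]
        by (intro DERIV_add DERIV_diff DERIV_const DERIV_sum DERIV_cmult deriv_\<Psi>[OF u])
          (auto simp: has_real_derivative_iff_has_vector_derivative)
      then have "((\<lambda>v. \<alpha>0 + (\<Sum>l\<in>{1..<k}. \<alpha> l * \<Psi> l v) + lower_block Q \<bullet> lower_block (C v) - \<kappa>)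
          has_real_derivative g 1 u) (at u within J)" by (simp add: g_def)
      then have "(q 0 has_real_derivative g 1 u) (at u within J)"
        unfolding has_field_derivative_def
        by (rule has_derivative_transform[OF u, rotated]) (simp add: dec q_def)
      then show ?thesis using True rq[OF u, of 0] by simp
    next
      case False
      then have t1: "Suc t \<in> {2..k}" "t \<in> {1..<k}" using t by auto
      have der: "((\<lambda>v. \<alpha> t + (\<Sum>l\<in>{Suc t..<k}. \<alpha> l * (f l t v / f t t v)) + lower_block Q \<bullet> (fk t v /\<^sub>R f t t v))
          has_real_derivative (0 + (\<Sum>l\<in>{Suc t..<k}. \<alpha> l * f l (Suc t) u) + lower_block Q \<bullet> fk (Suc t) u))
          (at u within J)"
        using bounded_linear.has_vector_derivative[OF bounded_linear_inner_right deriv_fk[OF u t1(1)]]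
          deriv_f[OF u t1(1)]
        by (intro DERIV_add DERIV_const DERIV_sum DERIV_cmult)
          (auto simp: has_real_derivative_iff_has_vector_derivative)
      have eq: "q t v = \<alpha> t + (\<Sum>l\<in>{Suc t..<k}. \<alpha> l * (f l t v / f t t v)) + lower_block Q \<bullet> (fk t v /\<^sub>R f t t v)"
        if "v \<in> J" for v
      proof -
        have "q t v = (\<alpha> t * f t t v + (\<Sum>l\<in>{Suc t..<k}. \<alpha> l * f l t v) + lower_block Q \<bullet> fk t v) / f t t v"
          using False t by (simp only: q_def g_def sum.atLeast_Suc_lessThan if_True if_False)
        also have "\<dots> = \<alpha> t + (\<Sum>l\<in>{Suc t..<k}. \<alpha> l * (f l t v / f t t v)) + (lower_block Q \<bullet> fk t v) / f t t v"
          using f_nonzero[OF that t1(2)] by (simp only: add_divide_distrib sum_divide_distrib) simp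
        finally show ?thesis by (simp add: divide_inverse mult.commute)
      qed
      have "(q t has_real_derivative g (Suc t) u) (at u within J)"
        using has_derivative_transform[OF u eq der[unfolded has_field_derivative_def]]
        unfolding has_field_derivative_def g_def by simp
      then show ?thesis using rq[OF u, of t] by simp
    qed
    show "\<exists>c>0. (\<Prod>i<k. s i) * q k u = c * (lower_block Q \<bullet> F_matrix k f fk u)" if u: "u \<in> J" for u
    proof -
      define p where "p = (\<Prod>i<k. r i u)"
      have p: "p = (\<Prod>l\<in>{1..<k}. f l l u)"
      proof -
        obtain k' where k': "k = Suc k'" using k_pos by (cases k) auto
        have "p = (\<Prod>i<k'. f (Suc i) (Suc i) u)" by (simp add: p_def k' r_def)
        also have "\<dots> = (\<Prod>l\<in>{1..<k}. f l l u)"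
          unfolding k' by (simp only: One_nat_def prod.atLeast_Suc_lessThan_Suc_shift lessThan_atLeast0 o_def)
        finally show ?thesis .
      qed
      have sp: "0 < (\<Prod>i<k. s i) * p"
        unfolding p_def prod.distrib[symmetric] using s u by (intro prod_pos) auto
      have "q k u = lower_block Q \<bullet> fk k u" using k_pos by (simp add: q_def g_def)
      then have "p * q k u = lower_block Q \<bullet> F_matrix k f fk u" by (simp add: F_matrix_def p)
      moreover have "(\<Prod>i<k. s i) * q k u = ((\<Prod>i<k. s i) * p / p\<^sup>2) * (p * q k u)"
        using sp by (auto simp: power2_eq_square)
      moreover have "0 < (\<Prod>i<k. s i) * p / p\<^sup>2" using sp by (intro divide_pos_pos) auto
      ultimately show ?thesis by auto
    qed
  qed
  then show ?thesis by blast
qed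

lemma derivative_unique:
  assumes "y \<in> J" "(g has_real_derivative a) (at y within J)" "(g has_real_derivative b) (at y within J)"
  shows "a = b"
proof -
  have "connected J" using J(1) by (simp add: is_interval_connected)
  then have "y islimpt J" using connected_imp_perfect[of J y] J(2) assms(1) by blast
  then have "at y within J \<noteq> bot" by (simp add: trivial_limit_within)
  then show ?thesis
    using vector_derivative_unique_within[of y J g a b] assms(2,3)
    by (simp add: has_real_derivative_iff_has_vector_derivative)
qed

lemma functional_chain_at_zeros:
  assumes chain: "is_functional_chain Q \<kappa> q r s"
    and N: "finite N" "N \<subseteq> J" "\<And>y. y \<in> N \<Longrightarrow> Q \<bullet> C y = \<kappa>"
    and D: "D \<subseteq> N" "\<And>y. y \<in> D \<Longrightarrow> ((\<lambda>u. Q \<bullet> C u) has_real_derivative 0) (at y within J)"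
    and u: "u \<in> J" and pos: "0 < \<tau> * (Q \<bullet> C u - \<kappa>)"
    and ab: "a = card {y\<in>N. y < u} + card {y\<in>D. y < u}" "b = card {y\<in>N. u < y} + card {y\<in>D. u < y}"
  shows "\<forall>y\<in>D. r 0 y * q 1 y = 0" and "sign_with_zeros J D (q 0) a b \<tau>" and "a + b = card N + card D"
proof -
  have q0: "q 0 u = Q \<bullet> C u - \<kappa>" if "u \<in> J" for u
    using chain that unfolding is_functional_chain_def by blast
  have d: "(q t has_real_derivative r t u * q (Suc t) u) (at u within J)" if "t < k" "u \<in> J" for t u
    using chain that unfolding is_functional_chain_def by blast
  have dd: "r 0 y * q 1 y = 0" if "y \<in> D" for y
  proof -
    have y: "y \<in> J" using that N D by blast
    have "((\<lambda>u. Q \<bullet> C u - \<kappa>) has_real_derivative 0) (at y within J)"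
      using DERIV_diff[OF D(2)[OF that] DERIV_const[of \<kappa>]] by simp
    then have "(q 0 has_real_derivative 0) (at y within J)"
      unfolding has_field_derivative_def
      by (rule has_derivative_transform[OF y, rotated]) (simp add: q0)
    then have "r 0 y * q (Suc 0) y = 0" by (rule derivative_unique[OF y d[OF k_pos y]])
    then show ?thesis by simp
  qed
  have "u \<notin> N"
  proof
    assume "u \<in> N"
    then have "Q \<bullet> C u = \<kappa>" by (rule N(3))
    then show False using pos by simp
  qed
  have split: "card A = card {y\<in>A. y < u} + card {y\<in>A. u < y}" if sub: "A \<subseteq> N" for A
  proof -
    have "finite A" using sub N(1) finite_subset by blast
    then have "card ({y\<in>A. y < u} \<union> {y\<in>A. u < y}) = card {y\<in>A. y < u} + card {y\<in>A. u < y}"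
      by (intro card_Un_disjoint) auto
    moreover have "y < u \<or> u < y" if "y \<in> A" for y
      using \<open>u \<notin> N\<close> sub that by (metis linorder_less_linear subsetD)
    then have "{y\<in>A. y < u} \<union> {y\<in>A. u < y} = A" by auto
    ultimately show ?thesis by simp
  qed
  show "\<forall>y\<in>D. r 0 y * q 1 y = 0" using dd by blast
  show "sign_with_zeros J D (q 0) a b \<tau>"
    unfolding sign_with_zeros_def
  proof (rule exI[of _ u], rule exI[of _ "{y\<in>N. y < u}"], rule exI[of _ "{y\<in>N. u < y}"], intro conjI)
    have "{y\<in>N. y < u} \<inter> D = {y\<in>D. y < u}" "{y\<in>N. u < y} \<inter> D = {y\<in>D. u < y}"
      using D(1) by auto
    then show "a = card {y\<in>N. y < u} + card ({y\<in>N. y < u} \<inter> D)"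
        "b = card {y\<in>N. u < y} + card ({y\<in>N. u < y} \<inter> D)" using ab by simp_all
    show "\<forall>y\<in>{y\<in>N. y < u}. y < u \<and> q 0 y = 0" "\<forall>y\<in>{y\<in>N. u < y}. u < y \<and> q 0 y = 0"
      using N(2,3) q0 by auto
    show "0 < \<tau> * q 0 u" using pos q0[OF u] by simp
    show "u \<in> J" by (rule u)
    show "{y \<in> N. y < u} \<subseteq> J" "{y \<in> N. u < y} \<subseteq> J" using N(2) by blast+
    show "finite {y \<in> N. y < u}" "finite {y \<in> N. u < y}" using N(1) by simp_all
  qed
  show "a + b = card N + card D" using split[of N] split[of D] D(1) ab by simp
qed

text \<open>The sign of the last function of the chain at one point determines the sign of the functional
  at \<open>u\<close>: a zero to the right of \<open>u\<close> reverses the sign, a double zero does so twice.\<close>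

lemma functional_sign:
  assumes Q: "lower_block Q \<in> psd_dual"
    and N: "finite N" "N \<subseteq> J" "\<And>y. y \<in> N \<Longrightarrow> Q \<bullet> C y = \<kappa>"
    and E: "E \<subseteq> N" "\<And>e. e \<in> E \<Longrightarrow> (\<forall>u\<in>J. e \<le> u) \<or> (\<forall>u\<in>J. u \<le> e)"
    and double: "\<And>y. y \<in> N - E \<Longrightarrow> ((\<lambda>u. Q \<bullet> C u) has_real_derivative 0) (at y within J)"
    and card: "card N + card (N - E) = k"
    and \<sigma>: "\<sigma> = (if \<exists>e\<in>E. \<forall>u\<in>J. u \<le> e then 1 else - 1)"
    and u: "u \<in> J"
  shows "Q \<bullet> C u \<le> \<kappa>"
proof (rule ccontr)
  assume "\<not> Q \<bullet> C u \<le> \<kappa>"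
  then have pos: "0 < 1 * (Q \<bullet> C u - \<kappa>)" by simp
  define b where "b = card {y\<in>N. u < y} + card {y\<in>N - E. u < y}"
  define a where "a = card {y\<in>N. y < u} + card {y\<in>N - E. y < u}"
  obtain q r s where chain: "is_functional_chain Q \<kappa> q r s" using functional_chain by blast
  have d: "(q t has_real_derivative r t u * q (Suc t) u) (at u within J)" if "t < k" "u \<in> J" for t u
    using chain that unfolding is_functional_chain_def by blast
  have s: "0 < s t * r t u" if "t < k" "u \<in> J" for t u
    using chain that unfolding is_functional_chain_def by blast
  have last: "\<exists>c>0. (\<Prod>i<k. s i) * q k u = c * (lower_block Q \<bullet> F_matrix k f fk u)" if "u \<in> J" for u
    using chain that unfolding is_functional_chain_def by blast
  note zeros = functional_chain_at_zeros[OF chain N Diff_subset double u pos a_def b_def]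
  obtain v where v: "v \<in> J" "0 < (\<Prod>i<k. s i) * (-1) ^ b * 1 * q k v"
    using chain_sign[OF J(1) k_pos d s bspec[OF zeros(1)] zeros(2)] zeros(3) card by auto
  obtain c where c: "0 < c" "(\<Prod>i<k. s i) * q k v = c * (lower_block Q \<bullet> F_matrix k f fk v)"
    using last[OF v(1)] by blast
  have "u \<notin> N" using N(3)[of u] pos by auto
  have "card {y\<in>E. u < y} = (if \<exists>e\<in>E. \<forall>u\<in>J. u \<le> e then 1 else 0)"
  proof (cases "\<exists>e\<in>E. \<forall>u\<in>J. u \<le> e")
    case True
    then obtain e where e: "e \<in> E" "\<forall>u\<in>J. u \<le> e" by blast
    have "u \<noteq> e" using e E(1) \<open>u \<notin> N\<close> by auto
    then have "u < e" using e u by force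
    moreover have "y = e" if "y \<in> E" "u < y" for y
    proof -
      have "\<forall>w\<in>J. w \<le> y" using E(2)[OF that(1)] that(2) u by force
      moreover have "e \<in> J" "y \<in> J" using e that E(1) N(2) by auto
      ultimately show ?thesis using e(2) by (meson antisym)
    qed
    ultimately have "{y\<in>E. u < y} = {e}" using e(1) by blast
    then show ?thesis using True by simp
  next
    case False
    have "\<not> u < y" if "y \<in> E" for y using E(2)[OF that] False that u by (meson leD)
    then have "{y\<in>E. u < y} = {}" by blast
    then show ?thesis using False by (simp only: card.empty if_False)
  qed
  moreover have "card {y\<in>N. u < y} = card {y\<in>N - E. u < y} + card {y\<in>E. u < y}"
  proof -
    have "finite E" using E(1) N(1) finite_subset by blast
    then have "card ({y\<in>N - E. u < y} \<union> {y\<in>E. u < y}) = card {y\<in>N - E. u < y} + card {y\<in>E. u < y}"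
      using N(1) by (intro card_Un_disjoint) auto
    moreover have "{y\<in>N - E. u < y} \<union> {y\<in>E. u < y} = {y\<in>N. u < y}" using E(1) by blast
    ultimately show ?thesis by simp
  qed
  ultimately have "b = 2 * card {y\<in>N - E. u < y} + (if \<exists>e\<in>E. \<forall>u\<in>J. u \<le> e then 1 else 0)"
    by (simp add: b_def)
  then have "(-1) ^ b = - \<sigma>" using \<sigma> by (simp add: power_add power_mult)
  then have "0 < - (c * (lower_block Q \<bullet> (\<sigma> *\<^sub>R F_matrix k f fk v)))"
    using v(2) c(2) by (simp add: algebra_simps)
  moreover have "0 \<le> lower_block Q \<bullet> (\<sigma> *\<^sub>R F_matrix k f fk v)"
    using Q F_posdef[OF v(1)] unfolding psd_dual_def by blast
  ultimately show False
    using c(1) mult_nonneg_nonneg[of c "lower_block Q \<bullet> (\<sigma> *\<^sub>R F_matrix k f fk v)"] by linarith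
qed

text \<open>With one zero more, a zero would survive to the end of the chain. There the function vanishes
  nowhere if \<open>lower_block Q\<close> is nonzero, and identically otherwise, whereas the sign that is carried
  along excludes the latter.\<close>

lemma functional_zeros_le:
  assumes Q: "lower_block Q \<in> psd_dual"
    and N: "finite N" "N \<subseteq> J" "\<And>y. y \<in> N \<Longrightarrow> Q \<bullet> C y = \<kappa>"
    and D: "D \<subseteq> N" "\<And>y. y \<in> D \<Longrightarrow> ((\<lambda>u. Q \<bullet> C u) has_real_derivative 0) (at y within J)"
    and u: "u \<in> J" "Q \<bullet> C u \<noteq> \<kappa>"
  shows "card N + card D \<le> k"
proof (rule ccontr)
  assume "\<not> card N + card D \<le> k"
  define \<tau> where "\<tau> = Q \<bullet> C u - \<kappa>"
  have pos: "0 < \<tau> * (Q \<bullet> C u - \<kappa>)" using u(2) by (simp add: \<tau>_def flip: power2_eq_square)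
  define b where "b = card {y\<in>N. u < y} + card {y\<in>D. u < y}"
  define a where "a = card {y\<in>N. y < u} + card {y\<in>D. y < u}"
  obtain q r s where chain: "is_functional_chain Q \<kappa> q r s" using functional_chain by blast
  have d: "(q t has_real_derivative r t u * q (Suc t) u) (at u within J)" if "t < k" "u \<in> J" for t u
    using chain that unfolding is_functional_chain_def by blast
  have s: "0 < s t * r t u" if "t < k" "u \<in> J" for t u
    using chain that unfolding is_functional_chain_def by blast
  have last: "\<exists>c>0. (\<Prod>i<k. s i) * q k u = c * (lower_block Q \<bullet> F_matrix k f fk u)" if "u \<in> J" for u
    using chain that unfolding is_functional_chain_def by blast
  note zeros = functional_chain_at_zeros[OF chain N D u(1) pos a_def b_def]
  have "k < a + b" using zeros(3) \<open>\<not> card N + card D \<le> k\<close> by simp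
  then obtain v w where vw: "v \<in> J" "q k v = 0" "w \<in> J" "q k w \<noteq> 0"
    using chain_zero[OF J(1) k_pos d s bspec[OF zeros(1)] zeros(2)] by blast
  have "s t \<noteq> 0" if "t < k" for t using s[OF that u(1)] by auto
  then have s0: "(\<Prod>i<k. s i) \<noteq> 0" by (simp add: prod_zero_iff)
  have "lower_block Q \<bullet> F_matrix k f fk v = 0" using last[OF vw(1)] vw(2) by auto
  then have "lower_block Q = 0"
    using psd_dual_inner_posdef[OF Q _ F_posdef[OF vw(1)]] by force
  then have "(\<Prod>i<k. s i) * q k w = 0" using last[OF vw(3)] by auto
  with s0 vw(4) show False by simp
qed

text \<open>The chain of a constant functional consists of zero functions, so \<open>lower_block Q\<close> would be orthogonal
  to a definite matrix.\<close>

lemma functional_nontrivial: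
  assumes Q: "lower_block Q \<in> psd_dual" "lower_block Q \<noteq> 0"
  shows "\<exists>u\<in>J. Q \<bullet> C u \<noteq> \<kappa>"
proof (rule ccontr)
  assume const: "\<not> (\<exists>u\<in>J. Q \<bullet> C u \<noteq> \<kappa>)"
  obtain q r s where chain: "is_functional_chain Q \<kappa> q r s" using functional_chain by blast
  have d: "(q t has_real_derivative r t u * q (Suc t) u) (at u within J)" if "t < k" "u \<in> J" for t u
    using chain that unfolding is_functional_chain_def by blast
  have s: "0 < s t * r t u" if "t < k" "u \<in> J" for t u
    using chain that unfolding is_functional_chain_def by blast
  have zero: "\<forall>u\<in>J. q t u = 0" if "t \<le> k" for t
    using that
  proof (induction t)
    case 0
    show ?case using chain const unfolding is_functional_chain_def by simp
  next
    case (Suc t)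
    show ?case
    proof
      fix u assume u: "u \<in> J"
      have "(q t has_real_derivative 0) (at u within J)"
        unfolding has_field_derivative_def
        by (rule has_derivative_transform[OF u _ has_derivative_const[of 0], THEN has_derivative_eq_rhs])
          (use Suc in auto)
      then have "r t u * q (Suc t) u = 0"
        using derivative_unique[OF u d[OF _ u]] Suc.prems by simp
      then show "q (Suc t) u = 0" using s[of t u] u Suc.prems by auto
    qed
  qed
  obtain u where u: "u \<in> J" using J(3) by blast
  have "\<exists>c>0. (\<Prod>i<k. s i) * q k u = c * (lower_block Q \<bullet> F_matrix k f fk u)"
    using chain u unfolding is_functional_chain_def by blast
  then have "lower_block Q \<bullet> F_matrix k f fk u = 0" using zero[of k] u by auto
  then show False using psd_dual_inner_posdef[OF Q F_posdef[OF u]] by simp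
qed

end

lemma is_interval_design_space: "is_interval (design_space L U)"
  unfolding is_interval_1 design_space_def
  by (auto intro: order_trans simp flip: ereal_less_eq(3) dest: ereal_less_eq(3)[THEN iffD2])

lemma design_space_two_points:
  assumes "L < U"
  obtains a b where "a \<in> design_space L U" "b \<in> design_space L U" "a < b"
proof -
  obtain b where b: "L < ereal b" "ereal b < U" using ereal_dense2[OF assms] by blast
  obtain a where a: "L < ereal a" "ereal a < ereal b" using ereal_dense2[OF b(1)] by blast
  show ?thesis
  proof (rule that[of a b])
    show "a \<in> design_space L U" "b \<in> design_space L U"
      using a b by (auto simp: design_space_def less_imp_le intro: order.trans[of _ "ereal b"])
  qed (use a in simp)
qed

text \<open>What the optimality argument uses of the model, in terms of the original covariate: the sign rule
  for functionals with as many zeros as possible, the bound on the number of zeros, and the fact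
  that the lower block makes a functional nonconstant. Zeros outside the set \<open>E\<close> of fixed points
  are double.\<close>

locale oscillating_model =
  fixes X :: "real set" and C C' :: "real \<Rightarrow> real^('a::finite+'b::finite)^('a+'b)"
    and E :: "real set" and m :: nat
  assumes deriv: "\<And>x. x \<in> X \<Longrightarrow> (C has_vector_derivative C' x) (at x within X)"
    and sym: "\<And>x. x \<in> X \<Longrightarrow> transpose (C x) = C x"
    and sign: "\<And>Q N \<kappa> x. lower_block Q \<in> psd_dual \<Longrightarrow> finite N \<Longrightarrow> N \<subseteq> X \<Longrightarrow> card N = m \<Longrightarrow> E \<subseteq> N \<Longrightarrow>
      (\<And>x. x \<in> N \<Longrightarrow> Q \<bullet> C x = \<kappa>) \<Longrightarrow> (\<And>x. x \<in> N - E \<Longrightarrow> Q \<bullet> C' x = 0) \<Longrightarrow> x \<in> X \<Longrightarrow> Q \<bullet> C x \<le> \<kappa>"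
    and zeros: "\<And>Q N \<kappa> x. lower_block Q \<in> psd_dual \<Longrightarrow> finite N \<Longrightarrow> N \<subseteq> X \<Longrightarrow>
      (\<And>x. x \<in> N \<Longrightarrow> Q \<bullet> C x = \<kappa>) \<Longrightarrow> (\<And>x. x \<in> N - E \<Longrightarrow> Q \<bullet> C' x = 0) \<Longrightarrow>
      x \<in> X \<Longrightarrow> Q \<bullet> C x \<noteq> \<kappa> \<Longrightarrow> card N + card (N - E) + card E \<le> 2 * m"
    and nontrivial: "\<And>Q \<kappa>. lower_block Q \<in> psd_dual \<Longrightarrow> lower_block Q \<noteq> 0 \<Longrightarrow> \<exists>x\<in>X. Q \<bullet> C x \<noteq> \<kappa>"

text \<open>The common content of the four cases: \<open>k\<close> is \<open>2 * m\<close> minus the number of fixed points, and \<open>F\<close> is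
  positive definite exactly if the upper end of the transformed interval is fixed. There a fixed
  point lies to the right of every other point and, as a simple zero, reverses the sign once; all
  other zeros to the right are double.\<close>

lemma complete_class_oscillating_model:
  fixes M :: "real \<Rightarrow> real^('a::finite+'b::finite)^('a+'b)"
  assumes LU: "L < U" and cc: "complete_class_hypothesis L U M m Fx"
    and Fx: "Fx \<subseteq> ereal ` design_space L U" and m: "2 \<le> m"
  shows "\<exists>(P :: real^('a+'b)^('a+'b)) (C :: real \<Rightarrow> real^('a+'b)^('a+'b)) C'. invertible P \<and> (\<forall>x\<in>design_space L U. M x = P ** C x ** transpose P) \<and>
    oscillating_model (design_space L U) C C' {x \<in> design_space L U. ereal x \<in> Fx} m"
proof -
  define X where "X = design_space L U"
  define E where "E = {x \<in> X. ereal x \<in> Fx}"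
  obtain P :: "real^('a+'b)^('a+'b)" and C :: "real \<Rightarrow> real^('a+'b)^('a+'b)" and c k \<Psi> f fk where
    "invertible P \<and> smooth_monotone_transformation X c \<and>
     (\<forall>u\<in>c ` X. transpose (C u) = C u) \<and> (\<forall>x\<in>X. M x = P ** C (c x) ** transpose P) \<and>
     inj_on \<Psi> {1..<k} \<and>
     maximal_indep_nonconstant (c ` X) (first_column_entries C) (\<Psi> ` {1..<k}) \<and>
     derivative_array (c ` X) k \<Psi> (\<lambda>u. lower_block (C u)) f fk \<and>
     ((k = 2 * m - 1 \<and> neg_def_on (c ` X) (F_matrix k f fk) \<and> Fx = {endpoint_A L U c}) \<or>
      (k = 2 * m - 1 \<and> pos_def_on (c ` X) (F_matrix k f fk) \<and> Fx = {endpoint_B L U c}) \<or>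
      (k = 2 * m \<and> neg_def_on (c ` X) (F_matrix k f fk) \<and> Fx = {}) \<or>
      (k = 2 * m - 2 \<and> pos_def_on (c ` X) (F_matrix k f fk) \<and> Fx = {L, U}))"
    using cc unfolding complete_class_hypothesis_def Let_def X_def by (elim exE) assumption
  then have P: "invertible P" and c: "smooth_monotone_transformation X c"
    and symC: "\<forall>u\<in>c ` X. transpose (C u) = C u"
    and M: "\<forall>x\<in>X. M x = P ** C (c x) ** transpose P"
    and inj: "inj_on \<Psi> {1..<k}"
    and max: "maximal_indep_nonconstant (c ` X) (first_column_entries C) (\<Psi> ` {1..<k})"
    and array: "derivative_array (c ` X) k \<Psi> (\<lambda>u. lower_block (C u)) f fk"
    and cases: "(k = 2 * m - 1 \<and> neg_def_on (c ` X) (F_matrix k f fk) \<and> Fx = {endpoint_A L U c}) \<or>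
         (k = 2 * m - 1 \<and> pos_def_on (c ` X) (F_matrix k f fk) \<and> Fx = {endpoint_B L U c}) \<or>
         (k = 2 * m \<and> neg_def_on (c ` X) (F_matrix k f fk) \<and> Fx = {}) \<or>
         (k = 2 * m - 2 \<and> pos_def_on (c ` X) (F_matrix k f fk) \<and> Fx = {L, U})"
    by simp_all
  define J where "J = c ` X"
  have ends: "endpoint_A L U c \<noteq> endpoint_B L U c" "endpoint_B L U c \<in> {L, U}" "endpoint_A L U c \<in> {L, U}"
    using LU by (auto simp: endpoint_A_def endpoint_B_def)
  define \<sigma> :: real where "\<sigma> = (if endpoint_B L U c \<in> Fx then 1 else - 1)"
  have FxLU: "Fx \<subseteq> {L, U}" using cases ends by auto
  have kFx: "k + card Fx = 2 * m" using cases m LU by (elim disjE) auto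
  have F: "\<sigma> *\<^sub>R F_matrix k f fk u \<in> posdef" if "u \<in> J" for u
    using cases ends that
    by (elim disjE) (auto simp: \<sigma>_def pos_def_on_def neg_def_on_def J_def PD_eq)
  have card_E: "card E = card Fx"
  proof -
    have "Fx = ereal ` E" using Fx by (auto simp: E_def X_def)
    then show ?thesis by (simp add: card_image)
  qed
  have finE: "finite E"
  proof -
    have "ereal ` E \<subseteq> {L, U}" using FxLU by (auto simp: E_def)
    then show ?thesis by (metis finite.emptyI finite.insertI finite_imageD finite_subset inj_ereal inj_on_subset subset_UNIV)
  qed
  obtain a b where ab: "a \<in> X" "b \<in> X" "a < b" using design_space_two_points[OF LU] unfolding X_def .
  obtain c' where c': "\<And>x. x \<in> X \<Longrightarrow> (c has_real_derivative c' x) (at x within X)"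
      "\<And>x. x \<in> X \<Longrightarrow> c' x \<noteq> 0"
    and mono: "strict_mono_on X c \<or> strict_antimono_on X c"
    using c unfolding smooth_monotone_transformation_def by blast
  have inj_c: "inj_on c X"
  proof (rule linorder_inj_onI)
    fix y z assume "y < z" "y \<in> X" "z \<in> X"
    then have "c y < c z \<or> c z < c y" using mono unfolding monotone_on_def by blast
    then show "c y \<noteq> c z" by auto
  qed auto
  have J_int: "is_interval J"
  proof -
    have "connected X" using is_interval_design_space by (simp add: X_def is_interval_connected)
    then have "connected J" unfolding J_def
      using DERIV_continuous_on[OF c'(1)] by (rule connected_continuous_image[rotated])
    then show ?thesis by (simp add: is_interval_connected_1)
  qed
  have J_two: "\<nexists>u. J = {u}"
  proof
    assume "\<exists>u. J = {u}"
    then obtain u where u: "J = {u}" ..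
    moreover have "c a \<in> J" "c b \<in> J" using ab by (auto simp: J_def)
    ultimately have "c a = c b" by simp
    then show False using inj_onD[OF inj_c] ab by auto
  qed
  have k0: "0 < k" using cases m by (elim disjE) auto
  have J_ne: "J \<noteq> {}" using ab by (auto simp: J_def)
  interpret derivative_chain J C k \<Psi> f fk \<sigma>
    by unfold_locales (use J_int J_two J_ne symC inj max array F k0 in \<open>auto simp: J_def\<close>)
  obtain C' where C'_all: "\<forall>u\<in>J. (C has_vector_derivative C' u) (at u within J)"
    using C_differentiable by blast
  then have C': "(C has_vector_derivative C' u) (at u within J)" if "u \<in> J" for u using that by blast
  have endpt: "(\<forall>u\<in>J. c x \<le> u) \<or> (\<forall>u\<in>J. u \<le> c x)" if "x \<in> E" for x
  proof -
    have x: "x \<in> X" "ereal x = L \<or> ereal x = U" using that FxLU by (auto simp: E_def)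
    then have "(\<forall>z\<in>X. x \<le> z) \<or> (\<forall>z\<in>X. z \<le> x)" by (auto simp: X_def design_space_def)
    moreover have "(\<forall>y\<in>X. \<forall>z\<in>X. y \<le> z \<longrightarrow> c y \<le> c z) \<or> (\<forall>y\<in>X. \<forall>z\<in>X. y \<le> z \<longrightarrow> c z \<le> c y)"
      using mono unfolding monotone_on_def le_less by blast
    ultimately show ?thesis using x(1) unfolding J_def by blast
  qed
  have top: "(\<exists>e\<in>c ` E. \<forall>u\<in>J. u \<le> e) \<longleftrightarrow> endpoint_B L U c \<in> Fx"
  proof
    assume "\<exists>e\<in>c ` E. \<forall>u\<in>J. u \<le> e"
    then obtain x where x: "x \<in> X" "ereal x \<in> Fx" "\<And>z. z \<in> X \<Longrightarrow> c z \<le> c x"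
      by (auto simp: E_def J_def)
    show "endpoint_B L U c \<in> Fx"
    proof (cases "strict_mono_on X c")
      case True
      then have "z \<le> x" if "z \<in> X" for z
        using x(3)[OF that] strict_mono_onD[OF True x(1) that] by force
      then have "b \<le> x" using ab by blast
      then have "ereal x \<noteq> L" using ab by (auto simp: X_def design_space_def)
      then have "ereal x = U" using x(2) FxLU by blast
      with True x(2) show ?thesis by (simp add: endpoint_B_def X_def)
    next
      case False
      then have anti: "strict_antimono_on X c" using mono by blast
      then have "x \<le> z" if "z \<in> X" for z
        using x(3)[OF that] monotone_onD[OF anti that x(1)] by force
      then have "x \<le> a" using ab by blast
      then have "ereal x \<noteq> U" using ab by (auto simp: X_def design_space_def)
      then have "ereal x = L" using x(2) FxLU by blast
      with False x(2) show ?thesis by (simp add: endpoint_B_def X_def)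
    qed
  next
    assume B: "endpoint_B L U c \<in> Fx"
    then obtain x where x: "x \<in> X" "endpoint_B L U c = ereal x" using Fx by (auto simp: X_def)
    have "c z \<le> c x" if "z \<in> X" for z
    proof (cases "strict_mono_on X c")
      case True
      then have "U = ereal x" using x by (simp add: endpoint_B_def X_def)
      then have "z \<le> x" using that by (auto simp: X_def design_space_def)
      then show ?thesis using strict_mono_onD[OF True that x(1)] by (auto simp: le_less)
    next
      case False
      then have anti: "strict_antimono_on X c" using mono by blast
      have "L = ereal x" using x False by (simp add: endpoint_B_def X_def)
      then have "x \<le> z" using that by (auto simp: X_def design_space_def)
      then show ?thesis using monotone_onD[OF anti x(1) that] by (auto simp: le_less)
    qed
    then show "\<exists>e\<in>c ` E. \<forall>u\<in>J. u \<le> e" using x B by (auto simp: E_def J_def)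
  qed
  have \<sigma>: "\<sigma> = (if \<exists>e\<in>c ` E. \<forall>u\<in>J. u \<le> e then 1 else - 1)" by (simp only: \<sigma>_def top)
  have zero_deriv: "((\<lambda>u. Q \<bullet> C u) has_real_derivative 0) (at (c x) within J)"
    if "x \<in> X" "Q \<bullet> (c' x *\<^sub>R C' (c x)) = 0" for Q x
  proof -
    have "Q \<bullet> C' (c x) = 0" using that c'(2) by simp
    moreover have "c x \<in> J" using that(1) by (simp add: J_def)
    ultimately show ?thesis
      using bounded_linear.has_vector_derivative[OF bounded_linear_inner_right C', of "c x" Q]
      by (simp add: has_real_derivative_iff_has_vector_derivative)
  qed
  have card_c: "card (c ` N) = card N" if "N \<subseteq> X" for N
    using inj_c that by (meson card_image inj_on_subset)
  have diff_c: "c ` N - c ` E = c ` (N - E)" if "N \<subseteq> X" for N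
    using inj_c that by (auto simp: E_def inj_on_def)
  have "oscillating_model X (\<lambda>x. C (c x)) (\<lambda>x. c' x *\<^sub>R C' (c x)) E m"
  proof
    show "((\<lambda>x. C (c x)) has_vector_derivative c' x *\<^sub>R C' (c x)) (at x within X)" if "x \<in> X" for x
      using vector_diff_chain_within[of c "c' x" x X C "C' (c x)"] c'(1)[OF that] C'[of "c x"] that
      by (simp add: J_def o_def has_real_derivative_iff_has_vector_derivative)
    show "transpose (C (c x)) = C (c x)" if "x \<in> X" for x using symC that by simp
  next
    fix Q :: "real^('a+'b)^('a+'b)" and N \<kappa> x
    assume Q: "lower_block Q \<in> psd_dual" and N: "finite N" "N \<subseteq> X" "card N = m" "E \<subseteq> N"
      and z: "\<And>x. x \<in> N \<Longrightarrow> Q \<bullet> C (c x) = \<kappa>" "\<And>x. x \<in> N - E \<Longrightarrow> Q \<bullet> (c' x *\<^sub>R C' (c x)) = 0"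
      and x: "x \<in> X"
    show "Q \<bullet> C (c x) \<le> \<kappa>"
    proof (rule functional_sign[OF Q, of "c ` N" \<kappa> "c ` E"])
      have "card (N - E) = card N - card E" using N finE by (intro card_Diff_subset) auto
      moreover have "card E \<le> card N" using N by (intro card_mono) auto
      ultimately show "card (c ` N) + card (c ` N - c ` E) = k"
        using N kFx card_E by (simp add: card_c diff_c subset_iff)
      show "((\<lambda>u. Q \<bullet> C u) has_real_derivative 0) (at y within J)" if "y \<in> c ` N - c ` E" for y
        using that z(2) N zero_deriv unfolding diff_c[OF N(2)] by blast
      show "(\<forall>u\<in>J. e \<le> u) \<or> (\<forall>u\<in>J. u \<le> e)" if "e \<in> c ` E" for e
        using that endpt by blast
      show "\<sigma> = (if \<exists>e\<in>c ` E. \<forall>u\<in>J. u \<le> e then 1 else - 1)" by (rule \<sigma>)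
    qed (use N z x in \<open>auto simp: J_def\<close>)
  next
    fix Q :: "real^('a+'b)^('a+'b)" and N \<kappa> x
    assume Q: "lower_block Q \<in> psd_dual" and N: "finite N" "N \<subseteq> X"
      and z: "\<And>x. x \<in> N \<Longrightarrow> Q \<bullet> C (c x) = \<kappa>" "\<And>x. x \<in> N - E \<Longrightarrow> Q \<bullet> (c' x *\<^sub>R C' (c x)) = 0"
      and x: "x \<in> X" "Q \<bullet> C (c x) \<noteq> \<kappa>"
    have "card (c ` N) + card (c ` (N - E)) \<le> k"
    proof (rule functional_zeros_le[OF Q, of _ \<kappa> _ "c x"])
      show "((\<lambda>u. Q \<bullet> C u) has_real_derivative 0) (at y within J)" if "y \<in> c ` (N - E)" for y
        using that z(2) N zero_deriv by blast
    qed (use N z x in \<open>auto simp: J_def\<close>)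
    then have "card N + card (N - E) \<le> k" using card_c[OF N(2)] card_c[of "N - E"] N(2) by (simp add: subset_iff)
    then show "card N + card (N - E) + card E \<le> 2 * m" using kFx card_E by simp
  next
    show "\<exists>x\<in>X. Q \<bullet> C (c x) \<noteq> \<kappa>" if "lower_block Q \<in> psd_dual" "lower_block Q \<noteq> 0" for Q \<kappa>
      using functional_nontrivial[OF that, of \<kappa>] by (auto simp: J_def)
  qed
  with P M have "invertible P \<and> (\<forall>x\<in>X. M x = P ** C (c x) ** transpose P) \<and>
    oscillating_model X (\<lambda>x. C (c x)) (\<lambda>x. c' x *\<^sub>R C' (c x)) E m" by blast
  then show ?thesis unfolding E_def X_def by (intro exI)
qed

section \<open>Designs and the criterion\<close>

lemma linear_congruence: "linear (\<lambda>A. P ** A ** transpose (P :: real^'n^'n))"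
  by (rule linearI)
    (simp_all add: vec_eq_iff matrix_matrix_mult_def distrib_left distrib_right sum.distrib
      sum_distrib_left sum_distrib_right mult_ac)

lemma right_slope:
  fixes g :: "real \<Rightarrow> 'v::real_normed_vector"
  assumes "(g has_vector_derivative D) (at 0 within {0..e})" "0 < e"
  shows "((\<lambda>t. (g t - g 0) /\<^sub>R t) \<longlongrightarrow> D) (at_right 0)"
proof -
  have "((\<lambda>t. (1 / norm (t - 0)) *\<^sub>R (g t - (g 0 + (t - 0) *\<^sub>R D))) \<longlongrightarrow> 0) (at_right 0)"
    using assms unfolding has_vector_derivative_def has_derivative_within
    by (simp add: at_within_Icc_at_right)
  then have "((\<lambda>t. (1 / norm (t - 0)) *\<^sub>R (g t - (g 0 + (t - 0) *\<^sub>R D)) + D) \<longlongrightarrow> 0 + D) (at_right 0)"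
    by (intro tendsto_intros)
  moreover have "\<forall>\<^sub>F t in at_right 0. (1 / norm (t - 0)) *\<^sub>R (g t - (g 0 + (t - 0) *\<^sub>R D)) + D = (g t - g 0) /\<^sub>R t"
    unfolding eventually_at_right_field
    by (intro exI[of _ 1]) (auto simp: algebra_simps divide_inverse)
  ultimately show ?thesis by (simp add: tendsto_cong)
qed

text \<open>At a free end of the design space only one-sided variations are possible, so a minimum there gives
  one inequality for the derivative.\<close>

lemma min_endpoint_derivative:
  fixes X :: "real set"
  assumes X: "is_interval X" "y \<in> X" "y \<noteq> p" "p \<in> X"
    and d: "(g has_real_derivative d) (at p within X)" and min: "\<And>x. x \<in> X \<Longrightarrow> g p \<le> g x"
  shows "(\<And>x. x \<in> X \<Longrightarrow> x \<le> p) \<Longrightarrow> d \<le> 0" "(\<And>x. x \<in> X \<Longrightarrow> p \<le> x) \<Longrightarrow> 0 \<le> d"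
proof -
  have seg: "{y..p} \<subseteq> X" "{p..y} \<subseteq> X"
    using X unfolding is_interval_1 by (meson atLeastAtMost_iff subsetI)+
  show "d \<le> 0" if "\<And>x. x \<in> X \<Longrightarrow> x \<le> p"
  proof (rule ccontr)
    assume "\<not> d \<le> 0"
    then obtain e where e: "0 < e" "\<forall>h>0. p - h \<in> X \<longrightarrow> h < e \<longrightarrow> g (p - h) < g p"
      using has_real_derivative_pos_inc_left[OF d] by auto
    have "y < p" using that[OF X(2)] X(3) by simp
    define h where "h = min (e / 2) (p - y)"
    have "0 < h" "h < e" "p - h \<in> {y..p}" using e(1) \<open>y < p\<close> by (auto simp: h_def)
    then have "g (p - h) < g p" "p - h \<in> X" using e(2) seg by blast+
    then show False using min by (meson leD)
  qed
  show "0 \<le> d" if "\<And>x. x \<in> X \<Longrightarrow> p \<le> x"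
  proof (rule ccontr)
    assume "\<not> 0 \<le> d"
    then obtain e where e: "0 < e" "\<forall>h>0. p + h \<in> X \<longrightarrow> h < e \<longrightarrow> g (p + h) < g p"
      using has_real_derivative_neg_dec_right[OF d] by auto
    have "p < y" using that[OF X(2)] X(3) by simp
    define h where "h = min (e / 2) (y - p)"
    have "0 < h" "h < e" "p + h \<in> {p..y}" using e(1) \<open>p < y\<close> by (auto simp: h_def)
    then have "g (p + h) < g p" "p + h \<in> X" using e(2) seg by blast+
    then show False using min by (meson leD)
  qed
qed

lemma Z_weight_sum: "(\<Sum>i\<in>UNIV. Z_weight \<omega> i) = 1"
proof -
  have "(\<Sum>i\<in>UNIV. Z_weight \<omega> i) = Z_weight \<omega> (Min UNIV) + (\<Sum>i\<in>UNIV - {Min UNIV}. Z_weight \<omega> i)"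
    by (rule sum.remove) auto
  also have "(\<Sum>i\<in>UNIV - {Min UNIV}. Z_weight \<omega> i) = (\<Sum>i\<in>UNIV - {Min UNIV}. \<omega> $ i)"
    by (intro sum.cong) (auto simp: Z_weight_def)
  finally show ?thesis by (simp add: Z_weight_def)
qed

lemma sum_Z_design:
  assumes "inj (Z_point L U Fx x)"
  shows "(\<Sum>y\<in>fst (Z_design L U Fx (x, \<omega>)). snd (Z_design L U Fx (x, \<omega>)) y *\<^sub>R h y) =
    (\<Sum>i\<in>UNIV. Z_weight \<omega> i *\<^sub>R h (Z_point L U Fx x i))"
proof -
  have "{j. Z_point L U Fx x j = Z_point L U Fx x i} = {i}" for i
    using assms by (auto dest: injD)
  then show ?thesis by (simp add: Z_design_def sum.reindex[OF assms])
qed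

lemma info_Z_design:
  assumes "inj (Z_point L U Fx x)"
  shows "info_matrix M (Z_design L U Fx (x, \<omega>)) = (\<Sum>i\<in>UNIV. Z_weight \<omega> i *\<^sub>R M (Z_point L U Fx x i))"
  unfolding info_matrix_def by (rule sum_Z_design[OF assms])

lemma Z_weight_shift_sum_zero:
  assumes "(\<Sum>i\<in>UNIV. a $ i) = 0"
  shows "Z_weight (\<omega> + e *\<^sub>R a) i = Z_weight \<omega> i + e * a $ i"
proof -
  have "(\<Sum>i\<in>UNIV. a $ i) = a $ Min UNIV + (\<Sum>i\<in>UNIV - {Min UNIV}. a $ i)"
    by (rule sum.remove) auto
  then have "(\<Sum>i\<in>UNIV - {Min UNIV}. a $ i) = - a $ Min UNIV" using assms by simp
  then show ?thesis
    by (simp add: Z_weight_def sum.distrib sum_distrib_left[symmetric])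
qed

text \<open>In all four cases of the theorem, an end of the design space that belongs to it and is not a fixed
  point carries no information.\<close>

locale design_problem = oscillating_model X C C' E m
  for X and C C' :: "real \<Rightarrow> real^('a::finite+'b::finite)^('a+'b)" and E m +
  fixes L U :: ereal and Fx :: "ereal set"
    and M :: "real \<Rightarrow> real^('a+'b)^('a+'b)" and P :: "real^('a+'b)^('a+'b)"
    and \<Phi> :: "real^('a+'b)^('a+'b) \<Rightarrow> real"
  assumes X: "X = design_space L U" and LU: "L < U" and E: "E = {x \<in> X. ereal x \<in> Fx}"
    and FxLU: "Fx \<subseteq> {L, U}" and FxX: "Fx \<subseteq> ereal ` X"
    and P: "invertible P" and M: "\<And>x. x \<in> X \<Longrightarrow> M x = P ** C x ** transpose P"
    and M_psd: "\<And>x. x \<in> X \<Longrightarrow> M x \<in> psd"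
    and free_end: "\<And>x. x \<in> X \<Longrightarrow> ereal x \<in> {L, U} \<Longrightarrow> ereal x \<notin> Fx \<Longrightarrow> M x = 0"
    and nonsingular: "\<exists>\<xi>. is_design X \<xi> \<and> info_matrix M \<xi> \<in> PD"
    and criterion: "assumption_A \<Phi>" and m2: "2 \<le> m"
begin

lemma X_interval: "is_interval X" using is_interval_design_space by (simp add: X)

lemma X_other_point:
  obtains y where "y \<in> X" "y \<noteq> p"
proof -
  obtain a b where "a \<in> X" "b \<in> X" "a < b" using design_space_two_points[OF LU] unfolding X .
  then show ?thesis using that by (cases "a = p") auto
qed

lemma M_NND: "x \<in> X \<Longrightarrow> M x \<in> NND"
  using M_psd[of x] M[of x] sym[of x]
  by (simp add: NND_eq sym_matrices_def matrix_transpose_mul matrix_mul_assoc)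

lemma NND_sum: "(\<And>i. i \<in> I \<Longrightarrow> 0 \<le> w i) \<Longrightarrow> (\<And>i. i \<in> I \<Longrightarrow> A i \<in> NND) \<Longrightarrow> (\<Sum>i\<in>I. w i *\<^sub>R A i) \<in> NND"
  by (auto simp: NND_eq sym_matrices_def intro!: psd_sum psd_scaleR sym_matrices_sum[unfolded sym_matrices_def, simplified])
    (simp add: transpose_def vec_eq_iff)

lemma info_NND: "is_design X \<xi> \<Longrightarrow> info_matrix M \<xi> \<in> NND"
  unfolding info_matrix_def is_design_def by (intro NND_sum M_NND) auto

lemma Phi_mono: "A \<in> NND \<Longrightarrow> B \<in> NND \<Longrightarrow> A - B \<in> psd \<Longrightarrow> \<Phi> B \<le> \<Phi> A"
proof -
  assume A: "A \<in> NND" "B \<in> NND" "A - B \<in> psd"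
  then have "transpose (A - B) = A - B"
    by (simp add: NND_def transpose_def vec_eq_iff)
  then have "A - B \<in> NND" using A by (simp add: NND_eq sym_matrices_def)
  then show "\<Phi> B \<le> \<Phi> A" using criterion A unfolding assumption_A_def by blast
qed

lemma Phi_nonneg: "A \<in> NND \<Longrightarrow> 0 \<le> \<Phi> A"
  using criterion unfolding assumption_A_def by blast

lemma Phi_concave:
  assumes "A \<in> NND" "B \<in> NND" "0 \<le> t" "t \<le> 1"
  shows "(1 - t) * \<Phi> A + t * \<Phi> B \<le> \<Phi> ((1 - t) *\<^sub>R A + t *\<^sub>R B)"
proof -
  have "concave_on NND \<Phi>" using criterion unfolding assumption_A_def by blast
  then show ?thesis using assms by (simp add: concave_on_iff)
qed

lemma zero_NND: "0 \<in> NND"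
  by (simp add: NND_def transpose_def vec_eq_iff)

lemma Phi_scaleR:
  assumes "A \<in> NND" "0 \<le> t" "t \<le> 1"
  shows "t * \<Phi> A \<le> \<Phi> (t *\<^sub>R A)"
proof -
  have "0 \<le> (1 - t) * \<Phi> 0" using Phi_nonneg[OF zero_NND] assms by simp
  then show ?thesis using Phi_concave[OF zero_NND assms(1) assms(2,3)] by simp
qed

definition M' :: "real \<Rightarrow> real^('a+'b)^('a+'b)" where
  "M' x = P ** C' x ** transpose P"

lemma M_deriv:
  assumes "x \<in> X"
  shows "(M has_vector_derivative M' x) (at x within X)"
proof -
  have "bounded_linear (\<lambda>A. P ** A ** transpose P)"
    using linear_congruence by (simp add: linear_conv_bounded_linear)
  from bounded_linear.has_vector_derivative[OF this deriv[OF assms]]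
  have "((\<lambda>x. P ** C x ** transpose P) has_vector_derivative M' x) (at x within X)"
    by (simp add: M'_def)
  then show ?thesis unfolding has_vector_derivative_def
    by (rule has_derivative_transform[OF assms, rotated]) (simp add: M)
qed

lemma functional_sign_M:
  assumes R: "R \<in> psd_dual" and N: "finite N" "N \<subseteq> X" "card N = m" "E \<subseteq> N"
    and z: "\<And>x. x \<in> N \<Longrightarrow> R \<bullet> M x = \<kappa>" "\<And>x. x \<in> N - E \<Longrightarrow> R \<bullet> M' x = 0"
    and x: "x \<in> X"
  shows "R \<bullet> M x \<le> \<kappa>"
proof -
  define Q where "Q = transpose P ** R ** P"
  have "0 \<le> Q \<bullet> S" if "S \<in> posdef" for S
  proof -
    have "S \<in> psd" using that posdef_subset_psd by blast
    then have "P ** S ** transpose P \<in> psd" by (simp add: psd_def congruence_quadratic_form)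
    then show ?thesis using psd_dual_inner_psd[OF R] by (simp add: Q_def flip: inner_congruence)
  qed
  then have "lower_block Q \<in> psd_dual" by (intro lower_block_psd_dual) (simp add: psd_dual_def)
  moreover have "R \<bullet> M y = Q \<bullet> C y" if "y \<in> X" for y
    using that by (simp add: M Q_def inner_congruence)
  moreover have "R \<bullet> M' y = Q \<bullet> C' y" for y
    by (simp add: M'_def Q_def inner_congruence)
  ultimately show ?thesis using sign[of Q N \<kappa> x] N z x by (simp add: subset_iff)
qed

lemma Fx_real: "e \<in> Fx \<Longrightarrow> ereal (real_of_ereal e) = e"
  using FxX by auto

lemma Z_domain_iff:
  fixes x \<omega> :: "real^'m::{finite,linorder}"
  assumes "CARD('m) = m"
  shows "(x, \<omega>) \<in> Z_domain L U Fx \<longleftrightarrow> strict_mono (Z_point L U Fx x) \<and>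
    (\<forall>i. Z_point L U Fx x i \<in> X) \<and> (\<forall>i. 0 \<le> Z_weight \<omega> i)"
proof -
  let ?p = "Z_point L U Fx x"
  have minmax: "Min (UNIV :: 'm set) \<noteq> Max UNIV"
  proof
    assume eq: "Min (UNIV :: 'm set) = Max UNIV"
    have "i = Min UNIV" for i :: 'm
      using Min_le[OF finite UNIV_I, of i] Max_ge[OF finite UNIV_I, of i] eq by (metis antisym)
    then have "(UNIV :: 'm set) = {Min UNIV}" by blast
    then have "CARD('m) = 1" by (metis card_1_singleton_iff One_nat_def)
    then show False using assms m2 by simp
  qed
  have Fxp: "Fx \<subseteq> ereal ` range ?p"
  proof
    fix e assume e: "e \<in> Fx"
    then consider "e = L" | "e = U" using FxLU by auto
    then show "e \<in> ereal ` range ?p"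
    proof cases
      case 1
      then have "ereal (?p (Min UNIV)) = e" using e Fx_real[OF e] by (simp add: Z_point_def)
      then show ?thesis by (metis imageI rangeI)
    next
      case 2
      then have "ereal (?p (Max UNIV)) = e" using e Fx_real[OF e] minmax by (auto simp: Z_point_def)
      then show ?thesis by (metis imageI rangeI)
    qed
  qed
  have "is_design X (Z_design L U Fx (x, \<omega>)) \<longleftrightarrow> (\<forall>i. ?p i \<in> X) \<and> (\<forall>i. 0 \<le> Z_weight \<omega> i)"
    if "strict_mono ?p"
  proof -
    have inj: "inj ?p" using that by (rule strict_mono_imp_inj_on)
    then have eq: "{j. ?p j = ?p i} = {i}" for i by (auto dest: injD)
    have "(\<Sum>y\<in>fst (Z_design L U Fx (x, \<omega>)). snd (Z_design L U Fx (x, \<omega>)) y) = 1"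
      using sum_Z_design[OF inj, of \<omega> "\<lambda>_. 1::real"] Z_weight_sum[of \<omega>] by simp
    then show ?thesis by (auto simp: is_design_def Z_design_def eq)
  qed
  moreover have "card (range ?p) \<le> CARD('m)" by (rule card_image_le) simp
  ultimately show ?thesis
    using Fxp by (auto simp: Z_domain_def Xi_def X) (auto simp: Z_design_def)
qed

section \<open>Critical points are optimal\<close>

definition fixed_index :: "'m::{finite,linorder} \<Rightarrow> bool" where
  "fixed_index i \<longleftrightarrow> (i = Min UNIV \<and> L \<in> Fx) \<or> (i = Max UNIV \<and> U \<in> Fx)"

lemma Z_point_fixed:
  assumes "fixed_index i"
  shows "Z_point L U Fx x i = Z_point L U Fx y i"
  using assms by (auto simp: fixed_index_def Z_point_def)

lemma Z_point_free: "\<not> fixed_index i \<Longrightarrow> Z_point L U Fx x i = x $ i"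
  by (auto simp: fixed_index_def Z_point_def)

text \<open>Directions in which the free points and the weights can move; a free point at an end of the
  design space can only move inwards.\<close>

definition directions ::
    "real^('m::{finite,linorder}) \<Rightarrow> ((real^('m::{finite,linorder})) \<times> (real^('m::{finite,linorder}))) set" where
  "directions x = {(b, a). (\<Sum>i\<in>UNIV. a $ i) = 0 \<and> (\<forall>i. fixed_index i \<longrightarrow> b $ i = 0) \<and>
     (\<forall>i. ereal (Z_point L U Fx x i) = U \<longrightarrow> b $ i \<le> 0) \<and>
     (\<forall>i. ereal (Z_point L U Fx x i) = L \<longrightarrow> 0 \<le> b $ i)}"

text \<open>The one-sided derivative of the information matrix in a direction.\<close>

definition velocity ::
    "real^('m::{finite,linorder}) \<Rightarrow> real^('m::{finite,linorder}) \<Rightarrow>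
     (real^('m::{finite,linorder})) \<times> (real^('m::{finite,linorder})) \<Rightarrow> real^('a+'b)^('a+'b)" where
  "velocity x \<omega> d = (\<Sum>i\<in>UNIV. snd d $ i *\<^sub>R M (Z_point L U Fx x i) +
     (Z_weight \<omega> i * fst d $ i) *\<^sub>R M' (Z_point L U Fx x i))"

lemma Z_point_shift:
  assumes "(b, a) \<in> directions x"
  shows "Z_point L U Fx (x + e *\<^sub>R b) i = Z_point L U Fx x i + e * b $ i"
proof (cases "fixed_index i")
  case True
  then have "b $ i = 0" using assms by (simp add: directions_def)
  then show ?thesis using Z_point_fixed[OF True] by simp
qed (simp add: Z_point_free)

lemma Z_weight_shift:
  assumes "(b, a) \<in> directions x"
  shows "Z_weight (\<omega> + e *\<^sub>R a) i = Z_weight \<omega> i + e * a $ i"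
  using assms by (intro Z_weight_shift_sum_zero) (simp add: directions_def)

lemma directions_stay_in_Z_domain:
  fixes x \<omega> a b :: "real^'m::{finite,linorder}"
  assumes m: "CARD('m) = m" and Z: "(x, \<omega>) \<in> Z_domain L U Fx" and w: "\<And>i. 0 < Z_weight \<omega> i"
    and d: "(b, a) \<in> directions x"
  obtains e where "0 < e" "\<And>t. 0 \<le> t \<Longrightarrow> t \<le> e \<Longrightarrow> (x + t *\<^sub>R b, \<omega> + t *\<^sub>R a) \<in> Z_domain L U Fx"
proof -
  let ?p = "Z_point L U Fx x"
  have mono: "strict_mono ?p" and pX: "?p i \<in> X" for i
    using Z Z_domain_iff[OF m] by auto
  have lim: "((\<lambda>t. u + t * v) \<longlongrightarrow> u) (at_right 0)" for u v :: real
  proof -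
    have "((\<lambda>t. u + t * v) \<longlongrightarrow> u + 0 * v) (at_right 0)" by (intro tendsto_intros)
    then show ?thesis by simp
  qed
  have pos: "\<forall>\<^sub>F t::real in at_right 0. 0 < t" by (simp add: eventually_at_right_less)
  have 1: "\<forall>\<^sub>F t in at_right 0. \<forall>i j. i < j \<longrightarrow> ?p i + t * b $ i < ?p j + t * b $ j"
  proof (intro eventually_all_finite)
    fix i j
    show "\<forall>\<^sub>F t in at_right 0. i < j \<longrightarrow> ?p i + t * b $ i < ?p j + t * b $ j"
    proof (cases "i < j")
      case True
      then have "0 < ?p j - ?p i" using mono by (simp add: strict_mono_def)
      from order_tendstoD(1)[OF lim this, of "b $ j - b $ i"]
      show ?thesis by eventually_elim (simp add: algebra_simps)
    qed simp
  qed
  have 2: "\<forall>\<^sub>F t in at_right 0. \<forall>i. ?p i + t * b $ i \<in> X"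
  proof (intro eventually_all_finite)
    fix i
    have LU: "L \<le> ereal (?p i)" "ereal (?p i) \<le> U" using pX[of i] by (auto simp: X design_space_def)
    have eL: "\<forall>\<^sub>F t in at_right 0. L \<le> ereal (?p i + t * b $ i)"
    proof (cases "ereal (?p i) = L")
      case True
      then have "0 \<le> b $ i" using d by (auto simp: directions_def)
      have "L \<le> ereal (?p i + t * b $ i)" if "0 < t" for t
        using LU(1) that \<open>0 \<le> b $ i\<close> by (auto intro: order.trans)
      with pos show ?thesis by (rule eventually_mono)
    next
      case False
      then have "L < ereal (?p i)" using LU by simp
      from order_tendstoD(1)[OF tendsto_ereal[OF lim] this, of "b $ i"] show ?thesis
        by eventually_elim simp
    qed
    have eU: "\<forall>\<^sub>F t in at_right 0. ereal (?p i + t * b $ i) \<le> U"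
    proof (cases "ereal (?p i) = U")
      case True
      then have "b $ i \<le> 0" using d by (auto simp: directions_def)
      have "ereal (?p i + t * b $ i) \<le> U" if "0 < t" for t
        using LU(2) that \<open>b $ i \<le> 0\<close> by (auto simp: mult_nonneg_nonpos intro: order.trans[rotated])
      with pos show ?thesis by (rule eventually_mono)
    next
      case False
      then have "ereal (?p i) < U" using LU by simp
      from order_tendstoD(2)[OF tendsto_ereal[OF lim] this, of "b $ i"] show ?thesis
        by eventually_elim simp
    qed
    from eL eU show "\<forall>\<^sub>F t in at_right 0. ?p i + t * b $ i \<in> X"
      by eventually_elim (simp add: X design_space_def)
  qed
  have 3: "\<forall>\<^sub>F t in at_right 0. \<forall>i. 0 < Z_weight \<omega> i + t * a $ i"
    by (intro eventually_all_finite order_tendstoD(1)[OF lim] w)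
  from 1 2 3 have "\<forall>\<^sub>F t in at_right 0. (x + t *\<^sub>R b, \<omega> + t *\<^sub>R a) \<in> Z_domain L U Fx"
    unfolding Z_domain_iff[OF m] Z_point_shift[OF d] Z_weight_shift[OF d] strict_mono_def
    by eventually_elim (auto simp: less_imp_le)
  then obtain e where e: "0 < e" "\<And>t. 0 < t \<Longrightarrow> t < e \<Longrightarrow> (x + t *\<^sub>R b, \<omega> + t *\<^sub>R a) \<in> Z_domain L U Fx"
    unfolding eventually_at_right_field by auto
  show ?thesis
  proof (rule that[of "e / 2"])
    show "(x + t *\<^sub>R b, \<omega> + t *\<^sub>R a) \<in> Z_domain L U Fx" if "0 \<le> t" "t \<le> e / 2" for t
      using that e Z by (cases "t = 0") auto
  qed (use e in simp)
qed

lemma info_slope: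
  fixes x \<omega> a b :: "real^'m::{finite,linorder}"
  assumes m: "CARD('m) = m" and d: "(b, a) \<in> directions x" and e: "0 < e"
    and Z: "\<And>t. 0 \<le> t \<Longrightarrow> t \<le> e \<Longrightarrow> (x + t *\<^sub>R b, \<omega> + t *\<^sub>R a) \<in> Z_domain L U Fx"
  shows "((\<lambda>t. (info_matrix M (Z_design L U Fx (x + t *\<^sub>R b, \<omega> + t *\<^sub>R a)) -
    info_matrix M (Z_design L U Fx (x, \<omega>))) /\<^sub>R t) \<longlongrightarrow> velocity x \<omega> (b, a)) (at_right 0)"
proof -
  let ?p = "Z_point L U Fx x"
  define g where "g t = info_matrix M (Z_design L U Fx (x + t *\<^sub>R b, \<omega> + t *\<^sub>R a))" for t
  have g: "g t = (\<Sum>i\<in>UNIV. (Z_weight \<omega> i + t * a $ i) *\<^sub>R M (?p i + t * b $ i))" if "t \<in> {0..e}" for t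
  proof -
    have "inj (Z_point L U Fx (x + t *\<^sub>R b))"
      using Z[of t] that Z_domain_iff[OF m] strict_mono_imp_inj_on by auto
    then show ?thesis
      unfolding g_def by (simp add: info_Z_design Z_point_shift[OF d] Z_weight_shift[OF d])
  qed
  have pX: "?p i + t * b $ i \<in> X" if "t \<in> {0..e}" for i t
    using Z[of t] that Z_domain_iff[OF m] Z_point_shift[OF d] by fastforce
  have Md: "((\<lambda>t. M (?p i + t * b $ i)) has_vector_derivative b $ i *\<^sub>R M' (?p i)) (at 0 within {0..e})" for i
  proof -
    have "((\<lambda>t. ?p i + t * b $ i) has_vector_derivative b $ i) (at 0 within {0..e})"
      by (auto intro!: derivative_eq_intros simp: has_real_derivative_iff_has_vector_derivative[symmetric])
    moreover have "(M has_vector_derivative M' (?p i)) (at (?p i + 0 * b $ i) within (\<lambda>t. ?p i + t * b $ i) ` {0..e})"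
    proof (rule has_vector_derivative_within_subset)
      show "(M has_vector_derivative M' (?p i)) (at (?p i + 0 * b $ i) within X)"
        using M_deriv[of "?p i"] pX[of 0 i] e by simp
    qed (use pX in auto)
    ultimately show ?thesis
      using vector_diff_chain_within[of "\<lambda>t. ?p i + t * b $ i" "b $ i" 0 "{0..e}" M "M' (?p i)"]
      by (simp add: o_def)
  qed
  have "((\<lambda>t. \<Sum>i\<in>UNIV. (Z_weight \<omega> i + t * a $ i) *\<^sub>R M (?p i + t * b $ i)) has_vector_derivative
      (\<Sum>i\<in>UNIV. (Z_weight \<omega> i + 0 * a $ i) *\<^sub>R (b $ i *\<^sub>R M' (?p i)) + a $ i *\<^sub>R M (?p i + 0 * b $ i)))
      (at 0 within {0..e})"
  proof (intro has_vector_derivative_sum has_vector_derivative_scaleR Md)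
    fix i show "((\<lambda>t. Z_weight \<omega> i + t * a $ i) has_real_derivative a $ i) (at 0 within {0..e})"
      by (auto intro!: derivative_eq_intros)
  qed
  moreover have "(\<Sum>i\<in>UNIV. (Z_weight \<omega> i + 0 * a $ i) *\<^sub>R (b $ i *\<^sub>R M' (?p i)) + a $ i *\<^sub>R M (?p i + 0 * b $ i))
      = velocity x \<omega> (b, a)"
    unfolding velocity_def by (intro sum.cong) (simp_all add: add.commute)
  ultimately have "((\<lambda>t. \<Sum>i\<in>UNIV. (Z_weight \<omega> i + t * a $ i) *\<^sub>R M (?p i + t * b $ i)) has_vector_derivative
      velocity x \<omega> (b, a)) (at 0 within {0..e})" by simp
  then have "(g has_vector_derivative velocity x \<omega> (b, a)) (at 0 within {0..e})"
    unfolding has_vector_derivative_def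
    by (rule has_derivative_transform[rotated 2]) (use e g in auto)
  from right_slope[OF this e] show ?thesis by (simp add: g_def)
qed

lemma fixed_index_iff:
  fixes x \<omega> :: "real^'m::{finite,linorder}"
  assumes m: "CARD('m) = m" and Z: "(x, \<omega>) \<in> Z_domain L U Fx"
  shows "ereal (Z_point L U Fx x i) \<in> Fx \<longleftrightarrow> fixed_index i"
proof -
  let ?p = "Z_point L U Fx x"
  have mono: "strict_mono ?p" and pX: "?p i \<in> X" for i
    using Z Z_domain_iff[OF m] by auto
  have Fxp: "Fx \<subseteq> ereal ` range ?p"
    using Z by (auto simp: Z_domain_def Xi_def Z_design_def)
  have bounds: "L \<le> ereal (?p i)" "ereal (?p i) \<le> U" for i using pX[of i] by (auto simp: X design_space_def)
  have inj: "?p i = ?p j \<longleftrightarrow> i = j" for i j using mono by (simp add: strict_mono_eq)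
  have le: "?p (Min UNIV) \<le> ?p i" "?p i \<le> ?p (Max UNIV)" for i
    using mono by (simp_all add: strict_mono_less_eq)
  have Lp: "ereal (?p (Min UNIV)) = L" if L: "L \<in> Fx"
  proof -
    obtain j where "L = ereal (?p j)" using Fxp L by auto
    then have "ereal (?p (Min UNIV)) \<le> L" using le(1)[of j] by (metis ereal_less_eq(3))
    then show ?thesis using bounds(1)[of "Min UNIV"] by simp
  qed
  have Up: "ereal (?p (Max UNIV)) = U" if U: "U \<in> Fx"
  proof -
    obtain j where "U = ereal (?p j)" using Fxp U by auto
    then have "U \<le> ereal (?p (Max UNIV))" using le(2)[of j] by (metis ereal_less_eq(3))
    then show ?thesis using bounds(2)[of "Max UNIV"] by simp
  qed
  show ?thesis
  proof
    assume F: "ereal (?p i) \<in> Fx"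
    then consider "ereal (?p i) = L" | "ereal (?p i) = U" using FxLU by auto
    then show "fixed_index i"
    proof cases
      case 1
      then have "?p i = ?p (Min UNIV)" using Lp F by (metis ereal.inject)
      then show ?thesis using 1 F inj by (simp add: fixed_index_def)
    next
      case 2
      then have "?p i = ?p (Max UNIV)" using Up F by (metis ereal.inject)
      then show ?thesis using 2 F inj by (simp add: fixed_index_def)
    qed
  next
    assume "fixed_index i"
    then show "ereal (?p i) \<in> Fx" using Lp Up by (auto simp: fixed_index_def)
  qed
qed

text \<open>If no velocity exceeds \<open>(1 - \<delta>) *\<^sub>R N - M\<^sub>\<xi>\<close> in the Loewner order, a functional in
  the dual cone separates the velocities from all larger matrices. It takes the same value at all
  design points and is critical at the free ones, so by the sign rule this value is its maximum on
  the design space and bounds its value at \<open>N\<close>. The separation and the factor \<open>1 - \<delta>\<close> give the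
  opposite strict inequality.\<close>

lemma ascent_direction:
  fixes x \<omega> :: "real^'m::{finite,linorder}"
  assumes m: "CARD('m) = m" and Z: "(x, \<omega>) \<in> Z_domain L U Fx" and w: "\<And>i. 0 < Z_weight \<omega> i"
    and N: "N \<in> posdef" and N_hull: "\<And>R \<kappa>. (\<And>x. x \<in> X \<Longrightarrow> R \<bullet> M x \<le> \<kappa>) \<Longrightarrow> R \<bullet> N \<le> \<kappa>"
    and \<delta>: "0 < \<delta>"
  shows "\<exists>d\<in>directions x.
    velocity x \<omega> d - ((1 - \<delta>) *\<^sub>R N - info_matrix M (Z_design L U Fx (x, \<omega>))) \<in> posdef"
proof (rule ccontr)
  assume contra: "\<not> ?thesis"
  let ?p = "Z_point L U Fx x"
  define A where "A = info_matrix M (Z_design L U Fx (x, \<omega>))"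
  define T where "T = (1 - \<delta>) *\<^sub>R N - A"
  define W where "W = velocity x \<omega> ` directions x"
  have mono: "strict_mono ?p" and pX: "?p i \<in> X" for i
    using Z Z_domain_iff[OF m] by auto
  have inj: "inj ?p" using mono by (rule strict_mono_imp_inj_on)
  have A: "A = (\<Sum>i\<in>UNIV. Z_weight \<omega> i *\<^sub>R M (?p i))" by (simp add: A_def info_Z_design inj)
  have lin: "linear (velocity x \<omega>)"
    unfolding velocity_def
    by (rule linearI) (simp_all add: algebra_simps sum.distrib scaleR_sum_right)
  have cone: "r *\<^sub>R d \<in> directions x" if "d \<in> directions x" "0 \<le> r" for r d
    using that by (cases d) (auto simp: directions_def mult_nonneg_nonpos sum_distrib_left[symmetric])
  have add: "d + d' \<in> directions x" if "d \<in> directions x" "d' \<in> directions x" for d d'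
    using that by (cases d; cases d') (auto simp: directions_def sum.distrib add_nonpos_nonpos)
  have "convex (directions x)" by (rule convexI) (intro add cone, auto)
  then have convW: "convex W" unfolding W_def by (rule convex_linear_image[OF lin])
  have "convex ((+) T ` posdef)" by (rule convex_translation[OF convex_posdef])
  moreover have "0 \<in> directions x" by (simp add: directions_def zero_prod_def)
  then have W0: "0 \<in> W" unfolding W_def using linear_0[OF lin] by (metis imageI)
  moreover have "W \<inter> (+) T ` posdef = {}"
  proof -
    have "velocity x \<omega> d \<noteq> T + S" if "d \<in> directions x" "S \<in> posdef" for d S
    proof
      assume "velocity x \<omega> d = T + S"
      then have "velocity x \<omega> d - T \<in> posdef" using that by simp
      then show False using contra that(1) by (auto simp: T_def A_def)
    qed
    then show ?thesis by (auto simp: W_def)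
  qed
  ultimately obtain R \<beta> where R: "R \<noteq> 0" "\<forall>t\<in>W. R \<bullet> t \<le> \<beta>" "\<forall>t\<in>(+) T ` posdef. \<beta> \<le> R \<bullet> t"
    using separating_hyperplane_sets[OF convW, of "(+) T ` posdef"] mat_1_posdef by blast
  have \<beta>0: "0 \<le> \<beta>" using R(2) W0 by force
  have RS: "\<beta> - R \<bullet> T \<le> R \<bullet> S" if "S \<in> posdef" for S
    using R(3) that by (force simp: inner_add_right)
  then have dual: "R \<in> psd_dual" by (rule psd_dualI_bounded)
  have RT: "0 \<le> R \<bullet> T"
  proof (rule field_le_epsilon)
    fix e :: real assume "0 < e"
    define I :: "real^('a+'b)^('a+'b)" where "I = mat 1"
    have I: "0 < R \<bullet> I" using psd_dual_inner_posdef[OF dual R(1) mat_1_posdef] by (simp add: I_def)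
    have "\<beta> - R \<bullet> T \<le> R \<bullet> ((e / (R \<bullet> I)) *\<^sub>R I)"
      using \<open>0 < e\<close> I by (intro RS posdef_scaleR) (auto simp: I_def mat_1_posdef)
    then show "0 \<le> R \<bullet> T + e" using I \<beta>0 by simp
  qed
  have le0: "R \<bullet> velocity x \<omega> d \<le> 0" if "d \<in> directions x" for d
  proof (rule ccontr)
    assume pos: "\<not> R \<bullet> velocity x \<omega> d \<le> 0"
    define r where "r = (\<beta> + 1) / (R \<bullet> velocity x \<omega> d)"
    have "0 \<le> r" using \<beta>0 pos by (simp add: r_def)
    then have "velocity x \<omega> (r *\<^sub>R d) \<in> W" using cone[OF that] by (simp add: W_def)
    then have "R \<bullet> velocity x \<omega> (r *\<^sub>R d) \<le> \<beta>" using R(2) by blast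
    then show False using pos by (simp add: linear_cmul[OF lin] r_def)
  qed
  define \<kappa> where "\<kappa> = R \<bullet> M (?p (Min UNIV))"
  have weights: "R \<bullet> M (?p i) \<le> R \<bullet> M (?p j)" for i j
  proof -
    define d :: "(real^('m::{finite,linorder})) \<times> (real^('m::{finite,linorder}))"
      where "d = (0, axis i 1 - axis j 1)"
    have "d \<in> directions x"
      by (auto simp: d_def directions_def sum_subtractf axis_def)
    moreover have "velocity x \<omega> d = M (?p i) - M (?p j)"
    proof -
      have "velocity x \<omega> d = (\<Sum>l\<in>UNIV. (axis i 1 $ l) *\<^sub>R M (?p l)) - (\<Sum>l\<in>UNIV. (axis j 1 $ l) *\<^sub>R M (?p l))"
        by (simp add: velocity_def d_def sum_subtractf algebra_simps)
      moreover have "(\<Sum>l\<in>UNIV. (axis i (1::real) $ l) *\<^sub>R M (?p l)) = M (?p i)" for i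
        by (subst sum.remove[of _ i]) (auto simp: axis_def)
      ultimately show ?thesis by simp
    qed
    ultimately show ?thesis using le0[of d] by (simp add: inner_diff_right)
  qed
  then have \<kappa>: "R \<bullet> M (?p i) = \<kappa>" for i unfolding \<kappa>_def by (meson antisym)
  have RA: "R \<bullet> A = \<kappa>"
    unfolding A using Z_weight_sum[of \<omega>] by (simp add: inner_sum_right \<kappa> sum_distrib_right[symmetric])
  have move: "s * (R \<bullet> M' (?p i)) \<le> 0"
    if "\<not> fixed_index i" "ereal (?p i) = U \<Longrightarrow> s \<le> 0" "ereal (?p i) = L \<Longrightarrow> 0 \<le> s" for s i
  proof -
    define d :: "(real^('m::{finite,linorder})) \<times> (real^('m::{finite,linorder}))"
      where "d = (axis i s, 0)"
    have "d \<in> directions x"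
    proof -
      have "axis i s $ j = (if j = i then s else 0)" for j by (simp add: axis_def)
      then show ?thesis using that unfolding d_def directions_def by auto
    qed
    moreover have "velocity x \<omega> d = (Z_weight \<omega> i * s) *\<^sub>R M' (?p i)"
      unfolding velocity_def d_def by (subst sum.remove[of _ i]) (auto simp: axis_def)
    ultimately have "Z_weight \<omega> i * (s * (R \<bullet> M' (?p i))) \<le> 0" using le0[of d] by (simp add: mult.assoc)
    then show ?thesis using w[of i] by (simp add: mult_le_0_iff)
  qed
  have crit: "R \<bullet> M' (?p i) = 0" if free: "\<not> fixed_index i" for i
  proof -
    have notFx: "ereal (?p i) \<notin> Fx" using fixed_index_iff[OF m Z] free by blast
    obtain y where y: "y \<in> X" "y \<noteq> ?p i" by (rule X_other_point)
    have deriv: "((\<lambda>z. R \<bullet> M z) has_real_derivative R \<bullet> M' (?p i)) (at (?p i) within X)"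
      using bounded_linear.has_vector_derivative[OF bounded_linear_inner_right M_deriv[OF pX[of i]], of R]
      by (simp add: has_real_derivative_iff_has_vector_derivative)
    have min: "R \<bullet> M (?p i) \<le> R \<bullet> M z" if "z \<in> X" "ereal (?p i) \<in> {L, U}" for z
      using free_end[OF pX that(2) notFx] psd_dual_inner_psd[OF dual M_psd[OF that(1)]] by simp
    consider "ereal (?p i) = U" | "ereal (?p i) = L" | "ereal (?p i) \<noteq> U" "ereal (?p i) \<noteq> L" by blast
    then show ?thesis
    proof cases
      case 1
      then have "z \<le> ?p i" if "z \<in> X" for z
        using that by (metis (mono_tags, lifting) X design_space_def ereal_less_eq(3) mem_Collect_eq)
      then have "R \<bullet> M' (?p i) \<le> 0"
        using min_endpoint_derivative(1)[OF X_interval y pX deriv] min 1 by blast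
      moreover have "- 1 * (R \<bullet> M' (?p i)) \<le> 0" by (rule move[OF free]) (use 1 LU in auto)
      ultimately show ?thesis by simp
    next
      case 2
      then have "?p i \<le> z" if "z \<in> X" for z
        using that by (metis (mono_tags, lifting) X design_space_def ereal_less_eq(3) mem_Collect_eq)
      then have "0 \<le> R \<bullet> M' (?p i)"
        using min_endpoint_derivative(2)[OF X_interval y pX deriv] min 2 by blast
      moreover have "1 * (R \<bullet> M' (?p i)) \<le> 0" by (rule move[OF free]) (use 2 LU in auto)
      ultimately show ?thesis by simp
    next
      case 3
      have "1 * (R \<bullet> M' (?p i)) \<le> 0" "- 1 * (R \<bullet> M' (?p i)) \<le> 0"
        by (rule move[OF free]; use 3 in auto)+
      then show ?thesis by simp
    qed
  qed
  have "R \<bullet> M z \<le> \<kappa>" if "z \<in> X" for z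
  proof (rule functional_sign_M[OF dual, of "range ?p"])
    show "card (range ?p) = m" using card_image[OF inj] m by simp
    show "E \<subseteq> range ?p"
      using Z by (auto simp: E Z_domain_def Xi_def Z_design_def)
    show "R \<bullet> M' y = 0" if y: "y \<in> range ?p - E" for y
    proof -
      obtain i where i: "y = ?p i" using y by blast
      then have "ereal (?p i) \<notin> Fx" using y pX[of i] by (auto simp: E)
      then show ?thesis using crit fixed_index_iff[OF m Z] i by blast
    qed
  qed (use pX \<kappa> that in auto)
  then have "R \<bullet> N \<le> \<kappa>" by (rule N_hull)
  moreover have "0 < \<delta> * (R \<bullet> N)" using psd_dual_inner_posdef[OF dual R(1) N] \<delta> by simp
  ultimately have "R \<bullet> T < 0"
    by (simp add: T_def inner_diff_right RA algebra_simps)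
  with RT show False by simp
qed

text \<open>If some design were better, there would be a direction in which the information matrix grows, to
  first order, faster than along the segment towards a slightly shrunk better matrix \<open>N\<close>. By
  monotonicity and concavity the criterion then has a positive slope in this direction, also where
  the information matrix is singular, so the point is not critical.\<close>

theorem critical_point_optimal:
  fixes Z :: "(real^('m::{finite,linorder})) \<times> (real^('m::{finite,linorder}))"
  assumes m: "CARD('m) = m" and Z: "feasible_critical_point \<Phi> M L U Fx Z"
    and ex: "optimal_design \<Phi> M X \<xi>"
  shows "optimal_design \<Phi> M X (Z_design L U Fx Z)"
proof -
  obtain x \<omega> where Z_eq: "Z = (x, \<omega>)" by (cases Z)
  have dom: "(x, \<omega>) \<in> Z_domain L U Fx" and pos: "\<And>i. i \<noteq> Min UNIV \<Longrightarrow> 0 < \<omega> $ i"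
    and sum1: "(\<Sum>i\<in>UNIV - {Min UNIV}. \<omega> $ i) < 1"
    and deriv: "(Phi_tilde \<Phi> M L U Fx has_derivative (\<lambda>_. 0)) (at (x, \<omega>) within Z_domain L U Fx)"
    using Z unfolding feasible_critical_point_def Z_eq by auto
  have w: "0 < Z_weight \<omega> i" for i using pos sum1 by (simp add: Z_weight_def)
  define A where "A = info_matrix M (Z_design L U Fx (x, \<omega>))"
  have desA: "is_design X (Z_design L U Fx (x, \<omega>))"
    using dom by (simp add: Z_domain_def Xi_def X)
  have A: "A \<in> NND" unfolding A_def by (rule info_NND[OF desA])
  define B where "B = info_matrix M \<xi>"
  have B: "B \<in> NND" unfolding B_def using ex by (intro info_NND) (simp add: optimal_design_def)
  have "\<Phi> B \<le> \<Phi> A"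
  proof (rule ccontr)
    assume "\<not> \<Phi> B \<le> \<Phi> A"
    then have less: "\<Phi> A < \<Phi> B" by simp
    obtain \<zeta> where \<zeta>: "is_design X \<zeta>" "info_matrix M \<zeta> \<in> PD" using nonsingular by blast
    define S where "S = info_matrix M \<zeta>"
    have S: "S \<in> NND" "S \<in> posdef" using \<zeta> info_NND by (auto simp: S_def PD_eq)
    \<comment> \<open>One factor \<open>1 - \<tau>\<close> is lost by mixing with a nonsingular design, the other one by the
      shrinking that makes the ascent direction strict.\<close>
    obtain \<tau> where \<tau>: "0 < \<tau>" "\<tau> < 1" "\<Phi> A < (1 - \<tau>) * ((1 - \<tau>) * \<Phi> B)"
    proof -
      have "((\<lambda>t. (1 - t) * ((1 - t) * \<Phi> B)) \<longlongrightarrow> (1 - 0) * ((1 - 0) * \<Phi> B)) (at_right 0)"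
        by (intro tendsto_intros)
      then have "\<forall>\<^sub>F t in at_right 0. \<Phi> A < (1 - t) * ((1 - t) * \<Phi> B)"
        using less by (intro order_tendstoD(1)) auto
      moreover have "\<forall>\<^sub>F t::real in at_right 0. 0 < t \<and> t < 1"
        unfolding eventually_at_right_field by (intro exI[of _ 1]) auto
      ultimately have "\<forall>\<^sub>F t in at_right 0. 0 < t \<and> t < 1 \<and> \<Phi> A < (1 - t) * ((1 - t) * \<Phi> B)"
        by eventually_elim auto
      then show ?thesis using that eventually_happens'[OF trivial_limit_at_right_real] by blast
    qed
    define N where "N = (1 - \<tau>) *\<^sub>R B + \<tau> *\<^sub>R S"
    have N: "N \<in> posdef"
      unfolding N_def using B S \<tau>
      by (subst add.commute, intro posdef_add_psd posdef_scaleR psd_scaleR) (auto simp: NND_eq)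
    have N_NND: "N \<in> NND" unfolding N_def using NND_sum[of UNIV "\<lambda>b. if b then 1 - \<tau> else \<tau>" "\<lambda>b. if b then B else S"] B S \<tau>
      by (simp add: UNIV_bool add.commute)
    have "(1 - \<tau>) * \<Phi> B \<le> \<Phi> N"
      using Phi_concave[OF B S(1), of \<tau>] \<tau> mult_nonneg_nonneg[OF _ Phi_nonneg[OF S(1)], of \<tau>]
      unfolding N_def by linarith
    then have "(1 - \<tau>) * ((1 - \<tau>) * \<Phi> B) \<le> (1 - \<tau>) * \<Phi> N" using \<tau> by (intro mult_left_mono) auto
    also have "\<dots> \<le> \<Phi> ((1 - \<tau>) *\<^sub>R N)" using \<tau> by (intro Phi_scaleR N_NND) auto
    finally have gain: "\<Phi> A < \<Phi> ((1 - \<tau>) *\<^sub>R N)" using \<tau> by linarith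
    have N1_NND: "(1 - \<tau>) *\<^sub>R N \<in> NND"
      using NND_sum[of "{()}" "\<lambda>_. 1 - \<tau>" "\<lambda>_. N"] N_NND \<tau> by simp
    have info_hull: "R \<bullet> info_matrix M \<xi>' \<le> \<kappa>"
      if "\<And>x. x \<in> X \<Longrightarrow> R \<bullet> M x \<le> \<kappa>" "is_design X \<xi>'" for R \<kappa> \<xi>'
    proof -
      have "R \<bullet> info_matrix M \<xi>' = (\<Sum>x\<in>fst \<xi>'. snd \<xi>' x * (R \<bullet> M x))"
        by (simp add: info_matrix_def inner_sum_right)
      also have "\<dots> \<le> (\<Sum>x\<in>fst \<xi>'. snd \<xi>' x * \<kappa>)"
        using that by (intro sum_mono mult_left_mono) (auto simp: is_design_def)
      also have "\<dots> = \<kappa>" using that(2) by (simp add: is_design_def sum_distrib_right[symmetric])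
      finally show ?thesis .
    qed
    have N_hull: "R \<bullet> N \<le> \<kappa>" if "\<And>x. x \<in> X \<Longrightarrow> R \<bullet> M x \<le> \<kappa>" for R \<kappa>
    proof -
      have "R \<bullet> B \<le> \<kappa>" "R \<bullet> S \<le> \<kappa>"
        using info_hull[OF that] ex \<zeta> by (auto simp: B_def S_def optimal_design_def)
      then have "(1 - \<tau>) * (R \<bullet> B) + \<tau> * (R \<bullet> S) \<le> (1 - \<tau>) * \<kappa> + \<tau> * \<kappa>"
        using \<tau> by (intro add_mono mult_left_mono) auto
      then show ?thesis by (simp add: N_def inner_add_right algebra_simps)
    qed
    obtain b a where d: "(b, a) \<in> directions x" and vel: "velocity x \<omega> (b, a) - ((1 - \<tau>) *\<^sub>R N - A) \<in> posdef"
      using ascent_direction[OF m dom w N N_hull \<tau>(1)] unfolding A_def by auto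
    obtain e where e: "0 < e" "\<And>t. 0 \<le> t \<Longrightarrow> t \<le> e \<Longrightarrow> (x + t *\<^sub>R b, \<omega> + t *\<^sub>R a) \<in> Z_domain L U Fx"
      using directions_stay_in_Z_domain[OF m dom w d] by blast
    define g where "g t = info_matrix M (Z_design L U Fx (x + t *\<^sub>R b, \<omega> + t *\<^sub>R a))" for t
    have "((\<lambda>t. (g t - A) /\<^sub>R t) \<longlongrightarrow> velocity x \<omega> (b, a)) (at_right 0)"
      using info_slope[OF m d e] by (simp add: g_def A_def)
    then have "((\<lambda>t. (g t - A) /\<^sub>R t - ((1 - \<tau>) *\<^sub>R N - A)) \<longlongrightarrow> velocity x \<omega> (b, a) - ((1 - \<tau>) *\<^sub>R N - A)) (at_right 0)"
      by (intro tendsto_intros)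
    then have ev: "\<forall>\<^sub>F t in at_right 0. (g t - A) /\<^sub>R t - ((1 - \<tau>) *\<^sub>R N - A) \<in> posdef"
      using open_posdef vel by (rule topological_tendstoD)
    have ev01: "\<forall>\<^sub>F t::real in at_right 0. 0 < t \<and> t < min e 1"
      unfolding eventually_at_right_field using e(1) by (intro exI[of _ "min e 1"]) auto
    define \<phi> where "\<phi> t = \<Phi> (g t)" for t
    have low: "\<forall>\<^sub>F t in at_right 0. \<Phi> ((1 - \<tau>) *\<^sub>R N) - \<Phi> A \<le> (\<phi> t - \<phi> 0) /\<^sub>R t"
      using ev ev01
    proof eventually_elim
      case (elim t)
      have t: "0 < t" "t < 1" "t \<le> e" using elim by auto
      define H where "H = (1 - t) *\<^sub>R A + t *\<^sub>R ((1 - \<tau>) *\<^sub>R N)"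
      have H: "H \<in> NND" unfolding H_def
        using NND_sum[of UNIV "\<lambda>b. if b then 1 - t else t" "\<lambda>b. if b then A else (1 - \<tau>) *\<^sub>R N"] A N1_NND t
        by (simp add: UNIV_bool add.commute)
      have gN: "g t \<in> NND" unfolding g_def
        using e(2)[of t] t by (intro info_NND) (simp add: Z_domain_def Xi_def X)
      have "t *\<^sub>R ((g t - A) /\<^sub>R t - ((1 - \<tau>) *\<^sub>R N - A)) \<in> posdef"
        using elim t by (intro posdef_scaleR) auto
      also have "t *\<^sub>R ((g t - A) /\<^sub>R t - ((1 - \<tau>) *\<^sub>R N - A)) = g t - H"
        using t by (simp add: H_def algebra_simps)
      finally have "\<Phi> H \<le> \<Phi> (g t)" using Phi_mono[OF gN H] posdef_subset_psd by blast
      moreover have "(1 - t) * \<Phi> A + t * \<Phi> ((1 - \<tau>) *\<^sub>R N) \<le> \<Phi> H"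
        unfolding H_def using t by (intro Phi_concave A N1_NND) auto
      ultimately have "t * (\<Phi> ((1 - \<tau>) *\<^sub>R N) - \<Phi> A) \<le> \<phi> t - \<phi> 0"
        by (simp add: \<phi>_def g_def A_def algebra_simps)
      then show ?case using t by (simp add: field_simps)
    qed
    have "((\<lambda>t. Phi_tilde \<Phi> M L U Fx (x + t *\<^sub>R b, \<omega> + t *\<^sub>R a)) has_vector_derivative 0) (at 0 within {0..e})"
    proof -
      have path: "((\<lambda>t. (x + t *\<^sub>R b, \<omega> + t *\<^sub>R a)) has_derivative (\<lambda>t. (t *\<^sub>R b, t *\<^sub>R a))) (at 0 within {0..e})"
        by (auto intro!: derivative_eq_intros)
      have "(Phi_tilde \<Phi> M L U Fx has_derivative (\<lambda>_. 0))
          (at (x + 0 *\<^sub>R b, \<omega> + 0 *\<^sub>R a) within (\<lambda>t. (x + t *\<^sub>R b, \<omega> + t *\<^sub>R a)) ` {0..e})"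
        using deriv e(2) by (auto intro: has_derivative_subset)
      from has_derivative_in_compose[OF path this] show ?thesis
        by (simp add: has_vector_derivative_def)
    qed
    from right_slope[OF this e(1)] have "((\<lambda>t. (\<phi> t - \<phi> 0) /\<^sub>R t) \<longlongrightarrow> 0) (at_right 0)"
      by (simp add: \<phi>_def g_def Phi_tilde_def)
    then have "\<Phi> ((1 - \<tau>) *\<^sub>R N) - \<Phi> A \<le> 0"
      by (rule tendsto_lowerbound[OF _ low trivial_limit_at_right_real])
    with gain show False by simp
  qed
  then show ?thesis
    using ex desA unfolding optimal_design_def Z_eq A_def B_def by (meson order_trans)
qed

end

section \<open>Existence of a feasible critical point\<close>

lemma finite_strict_mono_enumeration:
  fixes T :: "real set"
  assumes "finite T" "card T = CARD('m::{finite,linorder})"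
  shows "\<exists>e :: 'm \<Rightarrow> real. strict_mono e \<and> range e = T"
proof -
  define rank where "rank i = card {j. j < i}" for i :: 'm
  define ys where "ys = sorted_list_of_set T"
  have len: "length ys = CARD('m)" using assms by (simp add: ys_def)
  have rank_less: "rank i < CARD('m)" for i
    unfolding rank_def by (rule psubset_card_mono) auto
  have "strict_mono rank"
    unfolding strict_mono_def rank_def by (intro allI impI psubset_card_mono) auto
  define e where "e i = ys ! rank i" for i
  have "sorted_wrt (<) ys" by (simp add: ys_def)
  then have mono: "strict_mono e"
    unfolding strict_mono_def e_def
  proof (intro allI impI)
    fix i j :: 'm assume "i < j"
    then have "rank i < rank j" using \<open>strict_mono rank\<close> by (simp add: strict_mono_def)
    then show "ys ! rank i < ys ! rank j"
      using sorted_wrt_nth_less[OF \<open>sorted_wrt (<) ys\<close>] rank_less len by simp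
  qed
  have "range e \<subseteq> set ys" unfolding e_def using rank_less len by (auto intro!: nth_mem)
  then have sub: "range e \<subseteq> T" using assms by (simp add: ys_def)
  have "card (range e) = CARD('m)"
    using card_image[OF strict_mono_imp_inj_on[OF mono]] by simp
  then have "range e = T" using card_subset_eq[OF assms(1) sub] assms(2) by simp
  with mono show ?thesis by blast
qed

text \<open>Directions of increase in the Loewner order that leave the first columns unchanged.\<close>

definition block_cone :: "(real^('a::finite+'b::finite)^('a+'b)) set" where
  "block_cone = {D \<in> psd. \<forall>i a. D $ i $ Inl a = 0 \<and> D $ Inl a $ i = 0}"

lemma block_cone_psd: "D \<in> block_cone \<Longrightarrow> D \<in> psd"
  by (simp add: block_cone_def)

lemma block_cone_add: "D \<in> block_cone \<Longrightarrow> D' \<in> block_cone \<Longrightarrow> D + D' \<in> block_cone"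
  by (simp add: block_cone_def psd_add)

lemma block_cone_scaleR: "D \<in> block_cone \<Longrightarrow> 0 \<le> r \<Longrightarrow> r *\<^sub>R D \<in> block_cone"
  by (simp add: block_cone_def psd_scaleR)

lemma zero_block_cone: "0 \<in> block_cone"
  by (simp add: block_cone_def psd_def)

lemma convex_block_cone: "convex block_cone"
  by (rule convexI) (intro block_cone_add block_cone_scaleR, auto)

lemma closed_block_cone: "closed (block_cone :: (real^('a::finite+'b::finite)^('a+'b)) set)"
proof -
  have eq: "block_cone = psd \<inter> {D :: real^('a+'b)^('a+'b). \<forall>i a. D $ i $ Inl a = 0 \<and> D $ Inl a $ i = 0}"
    by (auto simp: block_cone_def)
  show ?thesis unfolding eq
    by (intro closed_Int closed_psd closed_Collect_all closed_Collect_conj closed_Collect_eq continuous_intros)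
qed

lemma lower_embed_block_cone: "S \<in> psd \<Longrightarrow> lower_embed S \<in> block_cone"
  by (auto simp: block_cone_def lower_embed_psd) (auto simp: lower_embed_def split: sum.splits)

lemma block_cone_inner: "D \<in> block_cone \<Longrightarrow> Q \<bullet> D = lower_block Q \<bullet> lower_block D"
  by (simp add: inner_vec_def sum_UNIV_sum_type lower_block_def block_cone_def)

lemma mat_1_inner_psd:
  fixes D :: "real^'n^'n"
  assumes "D \<in> psd" shows "0 \<le> mat 1 \<bullet> D"
proof (rule psd_dual_inner_psd[OF _ assms])
  have "0 \<le> mat 1 \<bullet> S" if "S \<in> posdef" for S :: "real^'n^'n"
  proof -
    have "0 \<le> S $ i $ i" for i
    proof -
      have "S \<bullet> outer (axis i 1) \<ge> 0"
        using that posdef_subset_psd by (auto simp: psd_def quadratic_form_eq_inner)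
      moreover have "outer (axis i 1) = axis i (axis i (1::real))"
        by (simp add: outer_def vec_eq_iff axis_def)
      ultimately show ?thesis by (simp add: inner_axis)
    qed
    then show ?thesis
      by (auto simp: inner_vec_def mat_def if_distrib[of "\<lambda>x. x * _"] cong: if_cong intro!: sum_nonneg)
  qed
  then show "(mat 1 :: real^'n^'n) \<in> psd_dual" by (simp add: psd_dual_def)
qed

context design_problem
begin

lemma finite_E: "finite E"
proof -
  have "ereal ` E \<subseteq> {L, U}" using FxLU by (auto simp: E)
  then have "finite (ereal ` E)" by (rule finite_subset) simp
  then show ?thesis by (rule finite_imageD) simp
qed

lemma C_eq:
  assumes "x \<in> X"
  shows "C x = matrix_inv P ** M x ** transpose (matrix_inv P)"
proof -
  have inv: "matrix_inv P ** P = mat 1" 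
    unfolding matrix_inv_def by (rule conjunct2[OF someI_ex[OF P[unfolded invertible_def]]])
  have "matrix_inv P ** M x ** transpose (matrix_inv P)
      = (matrix_inv P ** P) ** C x ** transpose (matrix_inv P ** P)"
    using assms by (simp add: M matrix_transpose_mul matrix_mul_assoc)
  then show ?thesis by (simp add: inv transpose_mat)
qed

lemma C_psd: "x \<in> X \<Longrightarrow> C x \<in> psd"
  using M_psd[of x] by (simp add: C_eq psd_def congruence_quadratic_form)

lemma congruence_psd: "A \<in> psd \<Longrightarrow> P ** A ** transpose P \<in> psd"
  by (simp add: psd_def congruence_quadratic_form)

lemma info_M_C:
  assumes "is_design X \<xi>"
  shows "info_matrix M \<xi> = P ** info_matrix C \<xi> ** transpose P"
proof -
  have "info_matrix M \<xi> = (\<Sum>x\<in>fst \<xi>. snd \<xi> x *\<^sub>R (P ** C x ** transpose P))"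
    unfolding info_matrix_def using assms M by (intro sum.cong) (auto simp: is_design_def)
  also have "\<dots> = P ** info_matrix C \<xi> ** transpose P"
    unfolding info_matrix_def
    by (simp add: linear_sum[OF linear_congruence] linear_cmul[OF linear_congruence])
  finally show ?thesis .
qed

text \<open>The image of the design space under \<open>M\<close> becomes compact by adding the limit \<open>0\<close>: outside a
  compact part of the design space, \<open>M\<close> is small.\<close>

lemma compact_insert_0_M:
  assumes lim: "\<And>e. e \<in> {L, U} \<Longrightarrow> e \<in> Fx \<or> info_at_endpoint M e 0"
  shows "compact (insert 0 (M ` X))"
proof -
  have cont: "continuous_on X M" 
    using M_deriv unfolding has_vector_derivative_def by (rule has_derivative_continuous_on)
  have part: "\<exists>Y\<subseteq>X. compact Y \<and> (\<forall>x\<in>X - Y. norm (M x) < e)" if e: "0 < e" for e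
  proof -
    have "\<exists>l. \<forall>x\<in>X. x < l \<longrightarrow> norm (M x) < e"
    proof (cases L)
      case (real l)
      then have "\<forall>x\<in>X. \<not> x < l" by (auto simp: X design_space_def)
      then show ?thesis by blast
    next
      case PInf
      then show ?thesis using LU by simp
    next
      case MInf
      then have "(M \<longlongrightarrow> 0) at_bot" using lim[of L] Fx_real[of L] by (auto simp: info_at_endpoint_def)
      then have "\<forall>\<^sub>F x in at_bot. norm (M x) < e" using e by (simp add: tendsto_iff)
      then show ?thesis unfolding eventually_at_bot_linorder by (meson less_imp_le)
    qed
    moreover have "\<exists>u. \<forall>x\<in>X. u < x \<longrightarrow> norm (M x) < e"
    proof (cases U)
      case (real u)
      then have "\<forall>x\<in>X. \<not> u < x" by (auto simp: X design_space_def)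
      then show ?thesis by blast
    next
      case MInf
      then show ?thesis using LU by simp
    next
      case PInf
      then have "(M \<longlongrightarrow> 0) at_top" using lim[of U] Fx_real[of U] by (auto simp: info_at_endpoint_def)
      then have "\<forall>\<^sub>F x in at_top. norm (M x) < e" using e by (simp add: tendsto_iff)
      then show ?thesis unfolding eventually_at_top_linorder by (meson less_imp_le)
    qed
    ultimately obtain l u where lu: "\<forall>x\<in>X. x < l \<longrightarrow> norm (M x) < e" "\<forall>x\<in>X. u < x \<longrightarrow> norm (M x) < e"
      by blast
    have "closed X" unfolding X design_space_def
      by (intro closed_Collect_conj closed_Collect_le continuous_intros continuous_on_ereal)
    then have "compact (X \<inter> {l..u})" by (simp add: closed_Int_compact)
    moreover have "\<forall>x\<in>X - X \<inter> {l..u}. norm (M x) < e" using lu by force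
    ultimately show ?thesis by blast
  qed
  have cover: "\<exists>Y\<subseteq>X. compact (M ` Y) \<and> insert 0 (M ` X) \<subseteq> M ` Y \<union> cball 0 e" if e: "0 < e" for e
  proof -
    obtain Y where Y: "Y \<subseteq> X" "compact Y" "\<forall>x\<in>X - Y. norm (M x) < e" using part[OF e] by blast
    then have "compact (M ` Y)" using cont continuous_on_subset compact_continuous_image by blast
    moreover have "insert 0 (M ` X) \<subseteq> M ` Y \<union> cball 0 e" using Y(3) e by (force simp: less_imp_le)
    ultimately show ?thesis using Y(1) by blast
  qed
  have "bounded (insert 0 (M ` X))"
    using cover[of 1] by (metis bounded_Un bounded_cball bounded_subset compact_imp_bounded zero_less_one)
  moreover have "closed (insert 0 (M ` X))"
  proof -
    have "y \<in> insert 0 (M ` X)" if y: "y \<in> closure (insert 0 (M ` X))" for y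
    proof (cases "y = 0")
      case False
      then have "0 < norm y / 2" by simp
      from cover[OF this] obtain Y where Y: "Y \<subseteq> X" "compact (M ` Y)"
          "insert 0 (M ` X) \<subseteq> M ` Y \<union> cball 0 (norm y / 2)" by blast
      have "closed (M ` Y \<union> cball 0 (norm y / 2))" using Y(2) by (simp add: compact_imp_closed closed_Un)
      then have "y \<in> M ` Y \<union> cball 0 (norm y / 2)" using closure_minimal[OF Y(3)] y by blast
      then show ?thesis using Y(1) False by auto
    qed simp
    then show ?thesis by (metis closure_subset closure_closed closed_closure subsetI subset_antisym)
  qed
  ultimately show ?thesis by (simp add: compact_eq_bounded_closed)
qed

lemma closure_C:
  assumes "\<And>e. e \<in> {L, U} \<Longrightarrow> e \<in> Fx \<or> info_at_endpoint M e 0"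
  shows "compact (closure (C ` X))" "closure (C ` X) \<subseteq> insert 0 (C ` X)"
proof -
  define T where "T A = matrix_inv P ** A ** transpose (matrix_inv P)" for A
  have lin: "linear T" using linear_congruence[of "matrix_inv P"] by (simp add: T_def[abs_def])
  have "insert 0 (C ` X) = T ` insert 0 (M ` X)"
    using linear_0[OF lin] C_eq by (force simp: T_def image_iff)
  moreover have "compact (T ` insert 0 (M ` X))"
    using compact_insert_0_M[OF assms] lin
    by (intro compact_continuous_image linear_continuous_on) (auto simp: linear_conv_bounded_linear)
  ultimately have c: "compact (insert 0 (C ` X))" by simp
  show "closure (C ` X) \<subseteq> insert 0 (C ` X)"
    using c by (intro closure_minimal compact_imp_closed) auto
  have "bounded (C ` X)" using bounded_subset[OF compact_imp_bounded[OF c]] by blast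
  then show "compact (closure (C ` X))" by (simp add: compact_eq_bounded_closed bounded_closure)
qed

text \<open>Among the points of the convex hull that dominate a given one with the same first columns,
  take one of largest trace. It cannot be increased within the hull in the directions of the
  block cone, so it is a relative boundary point of the hull minus the cone, and a supporting
  functional there is a nonconstant functional of the model with a maximum at every point that
  takes part in a representation of the boundary point.\<close>

lemma maximal_dominating_point:
  assumes G: "G = closure (C ` X)" and comp: "compact G" and A: "A \<in> convex hull G"
  shows "\<exists>N Q. N \<in> convex hull G \<and> N - A \<in> block_cone \<and> lower_block Q \<in> psd_dual \<and>
    (\<forall>B\<in>G. Q \<bullet> B \<le> Q \<bullet> N) \<and> (\<exists>x\<in>X. Q \<bullet> C x \<noteq> Q \<bullet> N)"
proof -
  define K where "K = convex hull G"
  have K: "compact K" "convex K" using comp by (auto simp: K_def compact_convex_hull)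
  define K1 where "K1 = K \<inter> (+) A ` block_cone"
  have "closed ((+) A ` block_cone)" using closed_block_cone by (rule closed_translation)
  then have "compact K1" unfolding K1_def using K by (intro compact_Int_closed) auto
  moreover have "A \<in> K1" using A zero_block_cone by (force simp: K1_def K_def)
  moreover have "continuous_on K1 (\<lambda>B. mat 1 \<bullet> B)" by (intro continuous_intros)
  ultimately obtain N where N: "N \<in> K1" "\<And>B. B \<in> K1 \<Longrightarrow> mat 1 \<bullet> B \<le> mat 1 \<bullet> N"
    using continuous_attains_sup[of K1 "\<lambda>B. mat 1 \<bullet> B"] by blast
  have NK: "N \<in> K" and NA: "N - A \<in> block_cone" using N(1) by (auto simp: K1_def)
  define K' where "K' = (\<Union>x\<in>K. \<Union>y\<in>block_cone. {x - y})"
  have conv: "convex K'" unfolding K'_def by (intro convex_differences K convex_block_cone)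
  have sub: "B - D \<in> K'" if "B \<in> K" "D \<in> block_cone" for B D using that by (auto simp: K'_def)
  have NK': "N \<in> K'" using sub[OF NK zero_block_cone] by simp
  have "N \<notin> rel_interior K'"
  proof
    assume ri: "N \<in> rel_interior K'"
    define I :: "real^('a+'b)^('a+'b)" where "I = lower_embed (mat 1)"
    have I: "I \<in> block_cone"
      unfolding I_def using mat_1_posdef posdef_subset_psd by (blast intro: lower_embed_block_cone)
    have "N - I \<in> K'" by (rule sub[OF NK I])
    then obtain e where e: "1 < e" "(1 - e) *\<^sub>R (N - I) + e *\<^sub>R N \<in> K'"
      using convex_rel_interior_iff[OF conv] ri NK' by blast
    then obtain B D where BD: "B \<in> K" "D \<in> block_cone" "(1 - e) *\<^sub>R (N - I) + e *\<^sub>R N = B - D"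
      by (auto simp: K'_def)
    have B: "B = N + (D + (e - 1) *\<^sub>R I)" using BD(3) by (simp add: algebra_simps)
    have "N - A + (D + (e - 1) *\<^sub>R I) \<in> block_cone"
      using NA BD(2) I e(1) by (intro block_cone_add block_cone_scaleR) auto
    then have "A + (N - A + (D + (e - 1) *\<^sub>R I)) \<in> (+) A ` block_cone" by (rule imageI)
    then have "B \<in> K1" using BD(1) by (simp add: K1_def B)
    then have "mat 1 \<bullet> B \<le> mat 1 \<bullet> N" by (rule N(2))
    moreover have "0 \<le> mat 1 \<bullet> D" using BD(2) by (intro mat_1_inner_psd block_cone_psd)
    moreover have "0 < mat 1 \<bullet> I"
    proof -
      have "lower_block (mat 1 :: real^('a+'b)^('a+'b)) = (mat 1 :: real^'b^'b)"
        by (simp add: lower_block_def mat_def vec_eq_iff)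
      moreover have "(mat 1 :: real^'b^'b) \<noteq> 0"
        by (auto simp: vec_eq_iff mat_def)
      ultimately show ?thesis by (simp add: I_def inner_lower_embed)
    qed
    then have "0 < (e - 1) * (mat 1 \<bullet> I)" using e(1) by simp
    ultimately show False by (simp add: B inner_add_right)
  qed
  have "\<exists>q. (\<forall>y\<in>K'. q \<bullet> N \<le> q \<bullet> y) \<and> (\<forall>y\<in>rel_interior K'. q \<bullet> N < q \<bullet> y)"
  proof (rule supporting_hyperplane_rel_boundary[OF conv NK' \<open>N \<notin> rel_interior K'\<close>])
    fix q assume "\<And>y. y \<in> K' \<Longrightarrow> q \<bullet> N \<le> q \<bullet> y" "\<And>y. y \<in> rel_interior K' \<Longrightarrow> q \<bullet> N < q \<bullet> y"
    then show ?thesis by (intro exI[of _ q]) simp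
  qed
  then obtain q where q: "\<forall>y\<in>K'. q \<bullet> N \<le> q \<bullet> y" "\<forall>y\<in>rel_interior K'. q \<bullet> N < q \<bullet> y" by blast
  define Q where "Q = - q"
  have Q: "y \<in> K' \<Longrightarrow> Q \<bullet> y \<le> Q \<bullet> N" "y \<in> rel_interior K' \<Longrightarrow> Q \<bullet> y < Q \<bullet> N" for y
    using q by (auto simp: Q_def)
  have QD: "0 \<le> Q \<bullet> D" if "D \<in> block_cone" for D
    using Q(1)[OF sub[OF NK that]] by (simp add: inner_diff_right)
  have dual: "lower_block Q \<in> psd_dual"
    unfolding psd_dual_def
    using QD lower_embed_block_cone posdef_subset_psd by (auto simp flip: inner_lower_embed)
  have "\<exists>x\<in>X. Q \<bullet> C x \<noteq> Q \<bullet> N"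
  proof (rule ccontr)
    assume const: "\<not> ?thesis"
    have "C ` X \<subseteq> {B. Q \<bullet> B = Q \<bullet> N}" using const by auto
    then have "G \<subseteq> {B. Q \<bullet> B = Q \<bullet> N}" unfolding G by (intro closure_minimal closed_hyperplane)
    then have const_K: "K \<subseteq> {B. Q \<bullet> B = Q \<bullet> N}" unfolding K_def by (intro hull_minimal convex_hyperplane)
    have "rel_interior K' \<noteq> {}" using conv NK' rel_interior_eq_empty by blast
    then obtain y where y: "y \<in> rel_interior K'" by blast
    then have "y \<in> K'" using rel_interior_subset by blast
    then obtain B D where BD: "B \<in> K" "D \<in> block_cone" "y = B - D" by (auto simp: K'_def)
    have "0 < Q \<bullet> D" using Q(2)[OF y] const_K BD by (auto simp: inner_diff_right)
    then have "lower_block Q \<noteq> 0" using block_cone_inner[OF BD(2), of Q] by auto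
    then show False using nontrivial[OF dual, of "Q \<bullet> N"] const by blast
  qed
  moreover have "Q \<bullet> B \<le> Q \<bullet> N" if "B \<in> G" for B
    using Q(1)[OF sub[OF _ zero_block_cone], of B] that hull_inc[of B G] by (simp add: K_def)
  ultimately have "N \<in> convex hull G \<and> N - A \<in> block_cone \<and> lower_block Q \<in> psd_dual \<and>
    (\<forall>B\<in>G. Q \<bullet> B \<le> Q \<bullet> N) \<and> (\<exists>x\<in>X. Q \<bullet> C x \<noteq> Q \<bullet> N)"
    using NK NA dual unfolding K_def by blast
  then show ?thesis by (intro exI)
qed

definition interior_points :: "real set" where
  "interior_points = {x. L < ereal x \<and> ereal x < U}"

lemma open_interior_points: "open interior_points"
  unfolding interior_points_def
  by (intro open_Collect_conj open_Collect_less continuous_intros continuous_on_ereal)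

lemma interior_points_subset: "interior_points \<subseteq> X"
  by (auto simp: interior_points_def X design_space_def less_imp_le)

lemma at_within_interior_points: "x \<in> interior_points \<Longrightarrow> at x within X = at x"
  using interior_maximal[OF interior_points_subset open_interior_points] by (intro at_within_interior) blast

lemma interior_extremum:
  assumes x: "x \<in> interior_points" and d: "(g has_real_derivative d) (at x within X)"
    and ext: "(\<forall>y\<in>X. g y \<le> g x) \<or> (\<forall>y\<in>X. g x \<le> g y)"
  shows "d = 0"
proof -
  have "(g has_derivative (*) d) (at x)"
    using d at_within_interior_points[OF x] by (simp add: has_field_derivative_def)
  then have "(*) d = (\<lambda>v. 0)"
    by (rule differential_zero_maxmin[OF x open_interior_points]) (use ext interior_points_subset in blast)
  then show ?thesis by (metis mult.right_neutral)
qed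

text \<open>Minus its maximum, the functional of a maximal dominating point vanishes at all points of a
  representation, and to second order at the free ones. The bound on the number of zeros then
  leaves at most \<open>m\<close> points, and \<open>m\<close> of them only if the fixed points are among them. Mass at \<open>0\<close>, which stands for
  the endpoints without information, is redistributed over the other points.\<close>

lemma saturated_optimal_design:
  assumes lim: "\<And>e. e \<in> {L, U} \<Longrightarrow> e \<in> Fx \<or> info_at_endpoint M e 0"
    and opt: "optimal_design \<Phi> M X \<xi>"
    and support: "\<And>\<xi>. optimal_design \<Phi> M X \<xi> \<Longrightarrow> m \<le> card (support_points \<xi>)"
  shows "\<exists>T \<omega>. optimal_design \<Phi> M X (T, \<omega>) \<and> card T = m \<and> E \<subseteq> T \<and> (\<forall>x\<in>T. 0 < \<omega> x) \<and> T - E \<subseteq> interior_points"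
proof -
  define G where "G = closure (C ` X)"
  define A where "A = info_matrix C \<xi>"
  have des: "is_design X \<xi>" using opt by (simp add: optimal_design_def)
  have comp: "compact G" and G_sub: "G \<subseteq> insert 0 (C ` X)" using closure_C[OF lim] by (auto simp: G_def)
  have "A \<in> convex hull G"
  proof -
    have "C x \<in> convex hull G" if "x \<in> fst \<xi>" for x
    proof -
      have "C x \<in> C ` X" using that des by (auto simp: is_design_def)
      then have "C x \<in> G" unfolding G_def using closure_subset[of "C ` X"] by blast
      then show ?thesis by (rule hull_inc)
    qed
    then show ?thesis unfolding A_def info_matrix_def
      using des by (intro convex_sum convex_convex_hull) (auto simp: is_design_def)
  qed
  from maximal_dominating_point[OF G_def comp this] obtain N Q where
    N: "N \<in> convex hull G" "N - A \<in> block_cone" and dual: "lower_block Q \<in> psd_dual"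
    and Q_le: "\<And>B. B \<in> G \<Longrightarrow> Q \<bullet> B \<le> Q \<bullet> N" and nonconst: "\<exists>x\<in>X. Q \<bullet> C x \<noteq> Q \<bullet> N" by (elim exE conjE) blast
  define \<kappa> where "\<kappa> = Q \<bullet> N"
  have dominated_opt: "optimal_design \<Phi> M X \<zeta>" if "is_design X \<zeta>" "info_matrix C \<zeta> - A \<in> psd" for \<zeta>
  proof -
    have "info_matrix M \<zeta> - info_matrix M \<xi> = P ** (info_matrix C \<zeta> - A) ** transpose P"
      by (simp only: info_M_C[OF that(1)] info_M_C[OF des] linear_diff[OF linear_congruence] A_def)
    then have "\<Phi> (info_matrix M \<xi>) \<le> \<Phi> (info_matrix M \<zeta>)"
      using congruence_psd[OF that(2)] by (intro Phi_mono info_NND that(1) des) simp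
    then show ?thesis using opt that(1) unfolding optimal_design_def by (meson order_trans)
  qed
  obtain S u where S: "finite S" "S \<subseteq> G" "\<forall>B\<in>S. 0 \<le> u B" "sum u S = 1" "(\<Sum>B\<in>S. u B *\<^sub>R B) = N"
    using N(1) unfolding convex_hull_explicit mem_Collect_eq by (elim exE conjE) (rule that)
  define S' where "S' = {B \<in> S. 0 < u B} - {0}"
  have S': "finite S'" "S' \<subseteq> C ` X" using S G_sub by (auto simp: S'_def)
  define s where "s = sum u S'"
  have s1: "s \<le> 1" unfolding s_def using S by (subst S(4)[symmetric], intro sum_mono2) (auto simp: S'_def)
  have NS': "N = (\<Sum>B\<in>S'. u B *\<^sub>R B)"
    unfolding S(5)[symmetric] using S by (intro sum.mono_neutral_right) (auto simp: S'_def)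
  define f where "f = inv_into X C"
  have f: "f B \<in> X" "C (f B) = B" if "B \<in> S'" for B
    using that S'(2) by (auto simp: f_def inv_into_into f_inv_into_f)
  have "S' \<noteq> {}"
  proof
    assume "S' = {}"
    then have "N = 0" using NS' by simp
    obtain x where x: "x \<in> X" "x \<noteq> 0" by (rule X_other_point)
    have "C x - A \<in> psd"
      using psd_add[OF C_psd[OF x(1)] block_cone_psd[OF N(2)]] \<open>N = 0\<close> by simp
    then have "info_matrix C ({x}, \<lambda>_. 1) - A \<in> psd" by (simp add: info_matrix_def)
    then have "m \<le> card (support_points ({x}, \<lambda>_. 1))"
      using x by (intro support dominated_opt) (auto simp: is_design_def)
    moreover have "support_points ({x}, \<lambda>_. 1) = {x}" by (auto simp: support_points_def)
    ultimately show False using m2 by simp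
  qed
  then have s0: "0 < s" unfolding s_def using S'(1) by (intro sum_pos) (auto simp: S'_def)
  define T where "T = f ` S'"
  define \<omega> where "\<omega> x = u (C x) / s" for x
  have inj: "inj_on f S'" using f by (metis inj_onI)
  have T: "finite T" "T \<subseteq> X" using S' f by (auto simp: T_def)
  have \<omega>: "0 < \<omega> x" if x: "x \<in> T" for x
  proof -
    obtain B where B: "B \<in> S'" "x = f B" using x by (auto simp: T_def)
    then have "\<omega> x = u B / s" by (simp add: \<omega>_def f)
    moreover have "0 < u B" using B(1) by (simp add: S'_def)
    ultimately show ?thesis using s0 by simp
  qed
  have desT: "is_design X (T, \<omega>)"
  proof -
    have "(\<Sum>x\<in>T. \<omega> x) = (\<Sum>B\<in>S'. u B / s)"
      unfolding T_def \<omega>_def sum.reindex[OF inj] by (intro sum.cong) (simp_all add: f)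
    also have "\<dots> = 1" using s0 by (simp add: s_def sum_divide_distrib[symmetric])
    finally show ?thesis using T \<omega> by (auto simp: is_design_def less_imp_le)
  qed
  have infoT: "info_matrix C (T, \<omega>) = (1 / s) *\<^sub>R N"
    unfolding info_matrix_def T_def \<omega>_def NS' fst_conv snd_conv sum.reindex[OF inj] scaleR_sum_right
    by (intro sum.cong) (simp_all add: f)
  have "optimal_design \<Phi> M X (T, \<omega>)"
  proof (rule dominated_opt[OF desT])
    have "N \<in> psd" unfolding NS' using S'(2) C_psd by (intro psd_sum psd_scaleR) (auto simp: S'_def)
    then have "(1 / s - 1) *\<^sub>R N \<in> psd" using s0 s1 by (intro psd_scaleR) auto
    then have "(1 / s - 1) *\<^sub>R N + (N - A) \<in> psd" using block_cone_psd[OF N(2)] by (rule psd_add)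
    then show "info_matrix C (T, \<omega>) - A \<in> psd" by (simp add: infoT algebra_simps)
  qed
  have "m \<le> card (support_points (T, \<omega>))" by (rule support) fact
  moreover have "support_points (T, \<omega>) = T" using \<omega> by (auto simp: support_points_def)
  ultimately have mT: "m \<le> card T" by simp
  have zero: "Q \<bullet> C x = \<kappa>" if x: "x \<in> T" for x
  proof -
    have "(\<Sum>B\<in>S. u B * (\<kappa> - Q \<bullet> B)) = sum u S * \<kappa> - Q \<bullet> (\<Sum>B\<in>S. u B *\<^sub>R B)"
      by (simp add: inner_sum_right right_diff_distrib sum_subtractf sum_distrib_right)
    then have "(\<Sum>B\<in>S. u B * (\<kappa> - Q \<bullet> B)) = 0" using S by (simp add: \<kappa>_def)
    moreover have "\<forall>B\<in>S. 0 \<le> u B * (\<kappa> - Q \<bullet> B)" using S Q_le by (auto simp: \<kappa>_def)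
    ultimately have "\<forall>B\<in>S. u B * (\<kappa> - Q \<bullet> B) = 0" using S(1) by (simp add: sum_nonneg_eq_0_iff)
    moreover obtain B where B: "B \<in> S'" "x = f B" using x by (auto simp: T_def)
    ultimately have "u B * (\<kappa> - Q \<bullet> B) = 0" by (auto simp: S'_def)
    then have "Q \<bullet> B = \<kappa>" using B(1) by (simp add: S'_def)
    then show ?thesis using f[OF B(1)] B(2) by simp
  qed
  have interior: "T - E \<subseteq> interior_points"
  proof
    fix x assume x: "x \<in> T - E"
    obtain B where B: "B \<in> S'" "x = f B" using x by (auto simp: T_def)
    have "C x \<noteq> 0" using B f[OF B(1)] by (auto simp: S'_def)
    then have "M x \<noteq> 0" using C_eq[of x] x T(2) by auto
    moreover have "ereal x \<notin> Fx" using x T(2) by (auto simp: E)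
    ultimately have "ereal x \<notin> {L, U}" using free_end[of x] x T(2) by auto
    then show "x \<in> interior_points" using x T(2) by (auto simp: interior_points_def X design_space_def less_le)
  qed
  have crit: "Q \<bullet> C' x = 0" if x: "x \<in> T - E" for x
  proof (rule interior_extremum)
    show "x \<in> interior_points" using x interior by blast
    have "x \<in> X" using x T by blast
    then show "((\<lambda>y. Q \<bullet> C y) has_real_derivative Q \<bullet> C' x) (at x within X)"
      using bounded_linear.has_vector_derivative[OF bounded_linear_inner_right deriv, of x Q]
      by (simp add: has_real_derivative_iff_has_vector_derivative)
    have "Q \<bullet> C y \<le> Q \<bullet> C x" if "y \<in> X" for y
    proof -
      have "C y \<in> G" unfolding G_def using that closure_subset[of "C ` X"] by blast
      then show ?thesis using Q_le zero x by (auto simp: \<kappa>_def)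
    qed
    then show "(\<forall>y\<in>X. Q \<bullet> C y \<le> Q \<bullet> C x) \<or> (\<forall>y\<in>X. Q \<bullet> C x \<le> Q \<bullet> C y)" by blast
  qed
  obtain x0 where x0: "x0 \<in> X" "Q \<bullet> C x0 \<noteq> \<kappa>" using nonconst by (auto simp: \<kappa>_def)
  have count: "card T + card (T - E) + card E \<le> 2 * m"
    by (rule zeros[OF dual T zero crit x0])
  have "card ((T - E) \<union> (T \<inter> E)) = card (T - E) + card (T \<inter> E)"
    using T(1) by (intro card_Un_disjoint) auto
  then have split: "card T = card (T - E) + card (T \<inter> E)" by (simp add: Un_Diff_Int)
  have "card (T \<inter> E) \<le> card E" using finite_E by (intro card_mono) auto
  then have "card T = m" "card (T \<inter> E) = card E" using count split mT by linarith+
  then have "T \<inter> E = E" using card_subset_eq[OF finite_E] by blast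
  then have "E \<subseteq> T" by blast
  then have "optimal_design \<Phi> M X (T, \<omega>) \<and> card T = m \<and> E \<subseteq> T \<and> (\<forall>x\<in>T. 0 < \<omega> x) \<and> T - E \<subseteq> interior_points"
    using \<open>optimal_design \<Phi> M X (T, \<omega>)\<close> \<open>card T = m\<close> \<omega> interior by simp
  then show ?thesis by (intro exI)
qed

text \<open>A null vector of the information matrix gives a nonnegative functional with the same zeros,
  which by the sign rule is nonpositive; then all information matrices are singular.\<close>

lemma saturated_info_posdef:
  assumes des: "is_design X (T, \<omega>)" and card: "card T = m" and ET: "E \<subseteq> T" and \<omega>: "\<And>x. x \<in> T \<Longrightarrow> 0 < \<omega> x"
    and interior: "T - E \<subseteq> interior_points"
  shows "info_matrix M (T, \<omega>) \<in> posdef"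
proof (rule ccontr)
  assume "info_matrix M (T, \<omega>) \<notin> posdef"
  then obtain v where v: "v \<noteq> 0" "v \<bullet> (info_matrix M (T, \<omega>) *v v) \<le> 0" by (auto simp: posdef_def not_less)
  define R where "R = outer v"
  have dual: "R \<in> psd_dual" by (simp add: R_def outer_psd_dual)
  have T: "finite T" "T \<subseteq> X" using des by (auto simp: is_design_def)
  have nonneg: "0 \<le> R \<bullet> M x" if "x \<in> X" for x using psd_dual_inner_psd[OF dual M_psd[OF that]] .
  have "R \<bullet> info_matrix M (T, \<omega>) \<le> 0" using v(2) by (simp add: R_def quadratic_form_eq_inner inner_commute)
  then have "(\<Sum>x\<in>T. \<omega> x * (R \<bullet> M x)) \<le> 0" by (simp add: info_matrix_def inner_sum_right)
  moreover have terms: "\<forall>x\<in>T. 0 \<le> \<omega> x * (R \<bullet> M x)" using \<omega> nonneg T(2) by (auto simp: less_imp_le)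
  ultimately have "\<forall>x\<in>T. \<omega> x * (R \<bullet> M x) = 0"
    using sum_nonneg_eq_0_iff[OF T(1), of "\<lambda>x. \<omega> x * (R \<bullet> M x)"] sum_nonneg[of T "\<lambda>x. \<omega> x * (R \<bullet> M x)"] by force
  then have zero: "R \<bullet> M x = 0" if "x \<in> T" for x using that \<omega>[OF that] by auto
  have crit: "R \<bullet> M' x = 0" if x: "x \<in> T - E" for x
  proof (rule interior_extremum)
    show "x \<in> interior_points" using x interior by blast
    have "x \<in> X" using x T by blast
    then show "((\<lambda>y. R \<bullet> M y) has_real_derivative R \<bullet> M' x) (at x within X)"
      using bounded_linear.has_vector_derivative[OF bounded_linear_inner_right M_deriv, of x R]
      by (simp add: has_real_derivative_iff_has_vector_derivative)
    show "(\<forall>y\<in>X. R \<bullet> M y \<le> R \<bullet> M x) \<or> (\<forall>y\<in>X. R \<bullet> M x \<le> R \<bullet> M y)" using zero x nonneg by simp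
  qed
  have le: "R \<bullet> M x \<le> 0" if "x \<in> X" for x
    by (rule functional_sign_M[OF dual T card ET zero crit that])
  obtain \<zeta> where \<zeta>: "is_design X \<zeta>" "info_matrix M \<zeta> \<in> PD" using nonsingular by blast
  have "R \<bullet> info_matrix M \<zeta> \<le> 0"
    unfolding info_matrix_def inner_sum_right
    using \<zeta>(1) le by (intro sum_nonpos) (auto simp: is_design_def mult_nonneg_nonpos)
  moreover have "0 < v \<bullet> (info_matrix M \<zeta> *v v)" using \<zeta>(2) v(1) by (simp add: PD_def)
  ultimately show False by (simp add: R_def quadratic_form_eq_inner inner_commute)
qed

lemma sym_matrices_weighted_sum:
  "(\<And>i. i \<in> I \<Longrightarrow> A i \<in> NND) \<Longrightarrow> (\<Sum>i\<in>I. w i *\<^sub>R A i) \<in> sym_matrices"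
proof (rule sym_matrices_sum)
  fix i assume A: "i \<in> I" and NND: "\<And>i. i \<in> I \<Longrightarrow> A i \<in> NND"
  have "transpose (w i *\<^sub>R A i) = w i *\<^sub>R transpose (A i)" by (simp add: transpose_def vec_eq_iff)
  then show "w i *\<^sub>R A i \<in> sym_matrices" using NND[OF A] by (simp add: NND_def sym_matrices_def)
qed

text \<open>At an optimal design with \<open>m\<close> support points whose free points are interior, all free coordinates
  can vary in both directions, and the criterion is differentiable since the information matrix is
  nonsingular.\<close>

theorem feasible_critical_point_exists:
  assumes m: "m = CARD('m::{finite,linorder})"
    and lim: "\<And>e. e \<in> {L, U} \<Longrightarrow> e \<in> Fx \<or> info_at_endpoint M e 0"
    and opt: "optimal_design \<Phi> M X \<xi>"
    and support: "\<And>\<xi>. optimal_design \<Phi> M X \<xi> \<Longrightarrow> m \<le> card (support_points \<xi>)"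
  shows "\<exists>Z :: (real^('m::{finite,linorder})) \<times> (real^('m::{finite,linorder})).
    feasible_critical_point \<Phi> M L U Fx Z"
proof -
  obtain T \<omega> where optT: "optimal_design \<Phi> M X (T, \<omega>)" and card: "card T = m" and ET: "E \<subseteq> T"
    and \<omega>: "\<forall>x\<in>T. 0 < \<omega> x" and interior: "T - E \<subseteq> interior_points"
    using saturated_optimal_design[OF lim opt support] by blast
  have des: "is_design X (T, \<omega>)" using optT by (simp add: optimal_design_def)
  then have T: "finite T" "T \<subseteq> X" "(\<Sum>x\<in>T. \<omega> x) = 1" by (auto simp: is_design_def)
  obtain e :: "'m \<Rightarrow> real" where e: "strict_mono e" "range e = T"
    using finite_strict_mono_enumeration[of T] T(1) card m by auto
  have inj_e: "inj e" using e(1) by (rule strict_mono_imp_inj_on)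
  have eX: "e i \<in> X" for i using e(2) T(2) by blast
  define x :: "real^('m::{finite,linorder})" where "x = (\<chi> i. e i)"
  define w :: "real^('m::{finite,linorder})" where "w = (\<chi> i. \<omega> (e i))"
  define Z where "Z = (x, w)"
  have bounds: "L \<le> ereal (e i)" "ereal (e i) \<le> U" for i using eX[of i] by (auto simp: X design_space_def)
  have point: "Z_point L U Fx x i = e i" for i
  proof -
    have "e (Min UNIV) = real_of_ereal L" if LF: "L \<in> Fx"
    proof -
      obtain l where l: "L = ereal l" "l \<in> X" using LF FxX by auto
      then have "l \<in> T" using ET LF by (auto simp: E)
      then obtain j where "e j = l" using e(2) by auto
      then have "e (Min UNIV) \<le> l" using e(1) by (metis Min_le UNIV_I finite strict_mono_less_eq)
      then show ?thesis using bounds(1)[of "Min UNIV"] l(1) by simp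
    qed
    moreover have "e (Max UNIV) = real_of_ereal U" if UF: "U \<in> Fx"
    proof -
      obtain u where u: "U = ereal u" "u \<in> X" using UF FxX by auto
      then have "u \<in> T" using ET UF by (auto simp: E)
      then obtain j where "e j = u" using e(2) by auto
      then have "u \<le> e (Max UNIV)" using e(1) by (metis Max_ge UNIV_I finite strict_mono_less_eq)
      then show ?thesis using bounds(2)[of "Max UNIV"] u(1) by simp
    qed
    ultimately show ?thesis by (simp add: Z_point_def x_def)
  qed
  have sum_w: "(\<Sum>i\<in>UNIV. \<omega> (e i)) = 1"
    using T(3) unfolding e(2)[symmetric] by (simp add: sum.reindex[OF inj_e])
  have weight: "Z_weight w i = \<omega> (e i)" for i
  proof (cases "i = Min UNIV")
    case True
    have "(\<Sum>i\<in>UNIV. \<omega> (e i)) = \<omega> (e (Min UNIV)) + (\<Sum>i\<in>UNIV - {Min UNIV}. \<omega> (e i))"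
      by (rule sum.remove) auto
    then show ?thesis using True sum_w by (simp add: Z_weight_def w_def)
  qed (simp add: Z_weight_def w_def)
  have w_pos: "0 < Z_weight w i" for i using \<omega> e(2) by (auto simp: weight)
  have pfun: "Z_point L U Fx x = e" using point by blast
  have dom: "Z \<in> Z_domain L U Fx"
    unfolding Z_def Z_domain_iff[OF m[symmetric]] pfun using e(1) eX w_pos by (auto simp: less_imp_le)
  have info_Z: "info_matrix M (Z_design L U Fx Z) = info_matrix M (T, \<omega>)"
  proof -
    have "info_matrix M (Z_design L U Fx Z) = (\<Sum>i\<in>UNIV. \<omega> (e i) *\<^sub>R M (e i))"
      unfolding Z_def using inj_e by (simp add: info_Z_design pfun weight)
    also have "\<dots> = info_matrix M (T, \<omega>)"
      unfolding info_matrix_def e(2)[symmetric] by (simp add: sum.reindex[OF inj_e])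
    finally show ?thesis .
  qed
  have free_interior: "x $ i \<in> interior_points" if "\<not> fixed_index i" for i
  proof -
    have "e i \<notin> E"
      using fixed_index_iff[OF m[symmetric] dom[unfolded Z_def], of i] that by (simp add: pfun E)
    then show ?thesis using interior e(2) by (auto simp: x_def)
  qed
  define F where "F Y = (\<Sum>i\<in>UNIV. Z_weight (snd Y) i *\<^sub>R M (Z_point L U Fx (fst Y) i))"
    for Y :: "(real^('m::{finite,linorder})) \<times> (real^('m::{finite,linorder}))"
  have point_tendsto: "((\<lambda>Y. Z_point L U Fx (fst Y) i) \<longlongrightarrow> e i) (nhds Z)" for i
  proof (cases "fixed_index i")
    case True
    then have "(\<lambda>Y :: (real^('m::{finite,linorder})) \<times> (real^('m::{finite,linorder})). Z_point L U Fx (fst Y) i) = (\<lambda>_. e i)"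
      using Z_point_fixed point by metis
    then show ?thesis by simp
  next
    case False
    then have "((\<lambda>Y. fst Y $ i) \<longlongrightarrow> fst Z $ i) (nhds Z)" by (intro tendsto_intros filterlim_ident)
    then show ?thesis using False by (simp add: Z_point_free Z_def x_def)
  qed
  have weight_tendsto: "((\<lambda>Y. Z_weight (snd Y) i) \<longlongrightarrow> Z_weight (snd Z) i) (nhds Z)" for i
    unfolding Z_weight_def by (auto intro!: tendsto_intros filterlim_ident)
  have "\<forall>\<^sub>F Y in nhds Z. Y \<in> Z_domain L U Fx"
  proof -
    have "\<forall>\<^sub>F Y in nhds Z. \<forall>i j. i < j \<longrightarrow> Z_point L U Fx (fst Y) i < Z_point L U Fx (fst Y) j"
    proof (intro eventually_all_finite)
      fix i j
      show "\<forall>\<^sub>F Y in nhds Z. i < j \<longrightarrow> Z_point L U Fx (fst Y) i < Z_point L U Fx (fst Y) j"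
      proof (cases "i < j")
        case True
        then have "0 < e j - e i" using e(1) by (simp add: strict_mono_def)
        from order_tendstoD(1)[OF tendsto_diff[OF point_tendsto point_tendsto] this]
        show ?thesis by eventually_elim simp
      qed simp
    qed
    moreover have "\<forall>\<^sub>F Y in nhds Z. \<forall>i. Z_point L U Fx (fst Y) i \<in> X"
    proof (intro eventually_all_finite)
      fix i
      show "\<forall>\<^sub>F Y in nhds Z. Z_point L U Fx (fst Y) i \<in> X"
      proof (cases "fixed_index i")
        case True
        then show ?thesis using Z_point_fixed[OF True, of _ x] point eX by simp
      next
        case False
        have "e i \<in> interior_points" using free_interior[OF False] by (simp add: x_def)
        from topological_tendstoD[OF point_tendsto open_interior_points this]
        show ?thesis by (rule eventually_mono) (use interior_points_subset in blast)
      qed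
    qed
    moreover have "\<forall>\<^sub>F Y in nhds Z. \<forall>i. 0 < Z_weight (snd Y) i"
      using w_pos by (intro eventually_all_finite order_tendstoD(1)[OF weight_tendsto]) (simp add: Z_def)
    ultimately show ?thesis
    proof eventually_elim
      case (elim Y)
      then show ?case
        using Z_domain_iff[OF m[symmetric], of "fst Y" "snd Y"] by (auto simp: strict_mono_def less_imp_le)
    qed
  qed
  then obtain V where V: "open V" "Z \<in> V" "V \<subseteq> Z_domain L U Fx"
    unfolding eventually_nhds by auto
  have VD: "strict_mono (Z_point L U Fx (fst Y)) \<and> (\<forall>i. Z_point L U Fx (fst Y) i \<in> X)" if "Y \<in> V" for Y
    using Z_domain_iff[OF m[symmetric], of "fst Y" "snd Y"] V(3) that by auto
  have info_F: "info_matrix M (Z_design L U Fx Y) = F Y" if "Y \<in> V" for Y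
    using info_Z_design[of L U Fx "fst Y" M "snd Y"] VD[OF that] by (simp add: F_def strict_mono_imp_inj_on)
  have F_sym: "F ` V \<subseteq> sym_matrices"
    using VD M_NND by (auto simp: F_def intro!: sym_matrices_weighted_sum)
  have "\<exists>D. (F has_derivative D) (at Z)"
  proof -
    have "(\<lambda>Y. M (Z_point L U Fx (fst Y) i)) differentiable (at Z)" for i
    proof (cases "fixed_index i")
      case True
      then have "(\<lambda>Y :: (real^('m::{finite,linorder})) \<times> (real^('m::{finite,linorder})). M (Z_point L U Fx (fst Y) i)) = (\<lambda>_. M (e i))"
        using Z_point_fixed point by metis
      then show ?thesis by simp
    next
      case False
      have "(M has_vector_derivative M' (e i)) (at (e i))"
        using M_deriv[of "e i"] eX at_within_interior_points free_interior[OF False] by (simp add: x_def)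
      then have "M differentiable (at (fst Z $ i))"
        by (auto simp: Z_def x_def has_vector_derivative_def differentiable_def)
      moreover have "((\<lambda>Y. fst Y $ i) has_derivative (\<lambda>Y. fst Y $ i)) (at Z)"
        by (intro bounded_linear_imp_has_derivative bounded_linear_compose[OF bounded_linear_vec_nth bounded_linear_fst])
      then have "(\<lambda>Y. fst Y $ i) differentiable (at Z)" unfolding differentiable_def by blast
      ultimately have "(M \<circ> (\<lambda>Y. fst Y $ i)) differentiable (at Z)"
        by (intro differentiable_chain_at)
      then show ?thesis using False by (simp add: o_def Z_point_free)
    qed
    moreover have "(\<lambda>Y :: (real^('m::{finite,linorder})) \<times> (real^('m::{finite,linorder})). Z_weight (snd Y) i) differentiable (at Z)" for i
    proof -
      have "((\<lambda>Y :: (real^('m::{finite,linorder})) \<times> (real^('m::{finite,linorder})). snd Y $ j) has_derivative (\<lambda>Y. snd Y $ j)) (at Z)" for j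
        by (intro bounded_linear_imp_has_derivative bounded_linear_compose[OF bounded_linear_vec_nth bounded_linear_snd])
      then have "(\<lambda>Y :: (real^('m::{finite,linorder})) \<times> (real^('m::{finite,linorder})). snd Y $ j) differentiable (at Z)" for j
        unfolding differentiable_def by blast
      then show ?thesis unfolding Z_weight_def by (cases "i = Min UNIV") (auto intro!: differentiable_diff differentiable_sum)
    qed
    ultimately have "F differentiable (at Z)"
      unfolding F_def by (intro differentiable_sum differentiable_scaleR) auto
    then show ?thesis by (simp add: differentiable_def)
  qed
  then obtain DF where DF: "(F has_derivative DF) (at Z)" by blast
  have FZ: "F Z = info_matrix M (T, \<omega>)" using info_F[OF V(2)] info_Z by simp
  have "F Z \<in> PD"
    unfolding PD_eq using saturated_info_posdef[OF des card ET _ interior] \<omega> F_sym V(2) FZ by auto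
  then obtain D\<Phi> where "(\<Phi> has_derivative D\<Phi>) (at (F Z) within sym_matrices)"
    using criterion unfolding assumption_A_def smooth_on_PD_def by blast
  then have "(\<Phi> has_derivative D\<Phi>) (at (F Z) within F ` V)" using F_sym by (rule has_derivative_subset)
  moreover have "(F has_derivative DF) (at Z within V)" using DF by (rule has_derivative_at_withinI)
  ultimately have "((\<lambda>Y. \<Phi> (F Y)) has_derivative (\<lambda>v. D\<Phi> (DF v))) (at Z within V)"
    using has_derivative_in_compose by blast
  then have "((\<lambda>Y. \<Phi> (F Y)) has_derivative (\<lambda>v. D\<Phi> (DF v))) (at Z)"
    using at_within_open[OF V(2,1)] by simp
  then have der: "(Phi_tilde \<Phi> M L U Fx has_derivative (\<lambda>v. D\<Phi> (DF v))) (at Z)"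
    by (rule has_derivative_transform_within_open[OF _ V(1,2)]) (simp add: Phi_tilde_def info_F)
  have "Phi_tilde \<Phi> M L U Fx Y \<le> Phi_tilde \<Phi> M L U Fx Z" if "Y \<in> V" for Y
  proof -
    have "is_design X (Z_design L U Fx Y)" using that V(3) by (auto simp: Z_domain_def Xi_def X)
    then have "\<Phi> (info_matrix M (Z_design L U Fx Y)) \<le> \<Phi> (info_matrix M (T, \<omega>))"
      using optT unfolding optimal_design_def by blast
    then show ?thesis by (simp add: Phi_tilde_def info_Z)
  qed
  then have "(\<lambda>v. D\<Phi> (DF v)) = (\<lambda>v. 0)"
    using differential_zero_maxmin[OF V(2,1) der] by blast
  with der have "(Phi_tilde \<Phi> M L U Fx has_derivative (\<lambda>v. 0)) (at Z within Z_domain L U Fx)"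
    by (simp add: has_derivative_at_withinI)
  moreover have "0 < snd Z $ i" for i using \<omega> e(2) by (auto simp: Z_def w_def)
  moreover have "(\<Sum>i\<in>UNIV - {Min UNIV}. snd Z $ i) < 1"
    using w_pos[of "Min UNIV"] by (simp add: Z_weight_def Z_def)
  ultimately show ?thesis using dom unfolding feasible_critical_point_def by blast
qed

end

section \<open>Optimality of feasible critical points\<close>

theorem theorem2p3:
  fixes L U :: ereal
    and \<eta> :: "real \<Rightarrow> real^('a::finite + 'b::finite) \<Rightarrow> real"
    and \<theta> :: "real^('a + 'b)"
    and w :: "real \<Rightarrow> real"
    and f :: "real \<Rightarrow> real^('a + 'b)"
    and M :: "real \<Rightarrow> real^('a + 'b)^('a + 'b)"
    and \<Phi> :: "real^('a + 'b)^('a + 'b) \<Rightarrow> real"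
    and Fx :: "ereal set"
    and m :: nat
  assumes "L < U"
    and model: "\<And>x. x \<in> design_space L U \<Longrightarrow> GDERIV (\<eta> x) \<theta> :> f x"
      "\<And>x. x \<in> design_space L U \<Longrightarrow> 0 \<le> w x"
      "M = fisher_info w f"
    and nonsingular: "\<exists>\<xi>. is_design (design_space L U) \<xi> \<and> info_matrix M \<xi> \<in> PD"
    and criterion: "assumption_A \<Phi>"
    and complete_class: "complete_class_hypothesis L U M m Fx"
      "\<And>e. e \<in> Fx \<Longrightarrow> e \<in> ereal ` design_space L U"
    and m: "CARD('a + 'b) \<le> m" "m = CARD('m::{finite,linorder})"
    and optimal_exists: "\<exists>\<xi>. optimal_design \<Phi> M (design_space L U) \<xi>"
    and optimal_support:
      "\<And>\<xi>. optimal_design \<Phi> M (design_space L U) \<xi> \<Longrightarrow> m \<le> card (support_points \<xi>)"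
    and conditions:
      "(Fx = {L} \<and> info_at_endpoint M U 0) \<or>
       (Fx = {U} \<and> info_at_endpoint M L 0) \<or>
       (Fx = {} \<and> info_at_endpoint M U 0 \<and> info_at_endpoint M L 0) \<or>
       Fx = {L, U}"
  shows "(\<exists>Z :: (real^('m::{finite,linorder})) \<times> (real^('m::{finite,linorder})).
            feasible_critical_point \<Phi> M L U Fx Z) \<and>
         (\<forall>Z :: (real^('m::{finite,linorder})) \<times> (real^('m::{finite,linorder})).
            feasible_critical_point \<Phi> M L U Fx Z \<longrightarrow>
              optimal_design \<Phi> M (design_space L U) (Z_design L U Fx Z))"
proof -
  have "0 < CARD('a)" "0 < CARD('b)" by (simp_all add: card_gt_0_iff)
  moreover have "CARD('a + 'b) = CARD('a) + CARD('b)"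
    using card_Plus[of "UNIV :: 'a set" "UNIV :: 'b set"] by simp
  ultimately have m2: "2 \<le> m" using m(1) by linarith
  have FxX: "Fx \<subseteq> ereal ` design_space L U" using complete_class(2) by blast
  obtain P :: "real^('a+'b)^('a+'b)" and C :: "real \<Rightarrow> real^('a+'b)^('a+'b)" and C' where P: "invertible P"
    and M: "\<forall>x\<in>design_space L U. M x = P ** C x ** transpose P"
    and osc: "oscillating_model (design_space L U) C C' {x \<in> design_space L U. ereal x \<in> Fx} m"
    using complete_class_oscillating_model[OF \<open>L < U\<close> complete_class(1) FxX m2] by blast
  have lim: "e \<in> Fx \<or> info_at_endpoint M e 0" if "e \<in> {L, U}" for e
    using conditions that by auto
  have M_psd: "M x \<in> psd" if "x \<in> design_space L U" for x
  proof -
    have "M x = w x *\<^sub>R outer (f x)" by (simp add: model(3) fisher_info_def outer_def)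
    moreover have "outer (f x) \<in> psd"
    proof -
      have "outer (f x) \<bullet> outer v = (f x \<bullet> v) * (f x \<bullet> v)" for v
        by (simp add: outer_def inner_vec_def sum_product mult_ac)
      then show ?thesis by (simp add: psd_def quadratic_form_eq_inner)
    qed
    ultimately show ?thesis using model(2)[OF that] by (simp add: psd_scaleR)
  qed
  interpret design_problem "design_space L U" C C' "{x \<in> design_space L U. ereal x \<in> Fx}" m L U Fx M P \<Phi>
  proof (intro design_problem.intro osc design_problem_axioms.intro refl)
    show "Fx \<subseteq> {L, U}" using conditions by auto
    show "M x = 0" if "x \<in> design_space L U" "ereal x \<in> {L, U}" "ereal x \<notin> Fx" for x
      using lim[OF that(2)] that(3) by (simp add: info_at_endpoint_def)
  qed (use \<open>L < U\<close> FxX P M M_psd nonsingular criterion m2 in auto)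
  obtain \<xi> where "optimal_design \<Phi> M (design_space L U) \<xi>" using optimal_exists by blast
  then show ?thesis
    using feasible_critical_point_exists[OF m(2) lim _ optimal_support] critical_point_optimal[OF m(2)[symmetric]]
    by blast
qed

end
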